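(* For each $e\in S^{d-1}$, the random variable $\omega\mapsto\tilde{\varphi}^{\omega}(e)$ is $\Sigma$-measurable.
   Context: Setting: $\lambda,\Lambda\in(0,\infty)$; $(\Omega,\mathscr{B},\mathbb{P})$ probability space with measurable $\Phi:\Omega\to\mathscr{F}_{d}(\lambda,\Lambda)$ (continuous $\varphi:S^{d-1}\to[\sqrt{\lambda},\sqrt{\Lambda}]$ with convex one-homogeneous extension; Borel $\sigma$-algebra of sup norm) and a jointly measurable, $\mathbb{P}$-preserving, ergodic group action $\tau$ of $\mathbb{R}^{d}$ on $\Omega$. $\varphi^{\omega}(x,p)=\|p\|\Phi^{\tau_{x}\omega}(p/\|p\|)$, $\varphi^{\omega}(x,0)=0$. $W:[-1,1]\to[0,\infty)$ continuous with zero set $\{-1,1\}$; $\mathcal{F}^{\omega}(u;A)=\int_{A}(\frac{1}{2}\varphi^{\omega}(x,Du)^{2}+W(u))\,dx$. $q:\mathbb{R}\to[-1,1]$ smooth, $q(\pm\infty)=\pm1$, $\int_{\mathbb{R}}(\frac{\Lambda}{2}q'^{2}+W(q))\,ds<\infty$; $q_{e}(y)=q(\langle y,e\rangle)$. $O_{e}$ fixed linear isometry of $\mathbb{R}^{d-1}$ onto $\langle e\rangle^{\perp}$, $A\oplus_{e}B=\{O_{e}(a)+be : a\in A, b\in B\}$; orthonormal basis $e_{1},\dots,e_{d-1}$ of $\mathbb{R}^{d-1}$ fixed, $Q(y,r)=\{x\in\mathbb{R}^{d-1}:\max_{i}|\langle x-y,e_{i}\rangle|<r/2\}$. $\tilde{\varphi}^{\omega}(e,A,h)=\inf\{\mathcal{F}^{\omega}(u;A\oplus_{e}(-h,h)):u\in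 H^{1}(A\oplus_{e}(-h,h);[-1,1]),\ u-q_{e}\in H^{1}_{0}(A\oplus_{e}(-h,h))\}$ and $\tilde{\varphi}^{\omega}(e) = \liminf_{R\to\infty}R^{1-d}\tilde{\varphi}^{\omega}(e,Q(0,R),R)$. $\Sigma$ is the $\sigma$-algebra of events $E\in\mathscr{B}$ with $\tau_{x}^{-1}(E)=E$ for all $x\in\mathbb{R}^{d}$. *)

theory Defs
  imports "HOL-Probability.Probability"
begin

text \<open>Elements of F_d(lambda,Lambda) are continuous functions on the unit sphere, represented
  extensionally (value 0 off the sphere), with values in [sqrt lambda, sqrt Lambda] and whose
  one-homogeneous extension is convex.\<close>

definition hom_ext :: "(real^'n \<Rightarrow> real) \<Rightarrow> real^'n \<Rightarrow> real" where
  "hom_ext f p = (if p = 0 then 0 else norm p * f (p /\<^sub>R norm p))"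

definition Fd :: "real \<Rightarrow> real \<Rightarrow> (real^'n \<Rightarrow> real) set" where
  "Fd lam Lam = {f. continuous_on (sphere 0 1) f
     \<and> (\<forall>x\<in>sphere 0 1. sqrt lam \<le> f x \<and> f x \<le> sqrt Lam)
     \<and> convex_on UNIV (hom_ext f)
     \<and> (\<forall>x. x \<notin> sphere 0 1 \<longrightarrow> f x = 0)}"

definition sup_dist :: "(real^'n \<Rightarrow> real) \<Rightarrow> (real^'n \<Rightarrow> real) \<Rightarrow> real" where
  "sup_dist f g = (SUP x\<in>sphere 0 1. \<bar>f x - g x\<bar>)"

definition Fd_open_sets :: "real \<Rightarrow> real \<Rightarrow> (real^'n \<Rightarrow> real) set set" where
  "Fd_open_sets lam Lam = {U. U \<subseteq> Fd lam Lam \<and>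
     (\<forall>f\<in>U. \<exists>\<epsilon>>0. \<forall>g\<in>Fd lam Lam. sup_dist f g < \<epsilon> \<longrightarrow> g \<in> U)}"

definition Fd_borel :: "real \<Rightarrow> real \<Rightarrow> (real^'n \<Rightarrow> real) measure" where
  "Fd_borel lam Lam = sigma (Fd lam Lam) (Fd_open_sets lam Lam)"

definition phiw :: "('w \<Rightarrow> real^'n \<Rightarrow> real) \<Rightarrow> (real^'n \<Rightarrow> 'w \<Rightarrow> 'w) \<Rightarrow> 'w
    \<Rightarrow> real^'n \<Rightarrow> real^'n \<Rightarrow> real" where
  "phiw \<Phi> \<tau> \<omega> x p = (if p = 0 then 0 else norm p * \<Phi> (\<tau> x \<omega>) (p /\<^sub>R norm p))"

definition invariant_events :: "'w measure \<Rightarrow> (real^'n \<Rightarrow> 'w \<Rightarrow> 'w) \<Rightarrow> 'w set set" where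
  "invariant_events M \<tau> = {E \<in> sets M. \<forall>x. \<tau> x -` E \<inter> space M = E}"

definition partial :: "'n \<Rightarrow> (real^'n \<Rightarrow> real) \<Rightarrow> real^'n \<Rightarrow> real" where
  "partial i f x = frechet_derivative f (at x) (axis i 1)"

definition smooth_fun :: "(real^'n \<Rightarrow> real) \<Rightarrow> bool" where
  "smooth_fun f \<longleftrightarrow> (\<forall>is x. foldr partial is f differentiable (at x))"

definition test_fun :: "(real^'n) set \<Rightarrow> (real^'n \<Rightarrow> real) \<Rightarrow> bool" where
  "test_fun U \<psi> \<longleftrightarrow> smooth_fun \<psi> \<and> compact (closure {x. \<psi> x \<noteq> 0})
      \<and> closure {x. \<psi> x \<noteq> 0} \<subseteq> U"

definition weak_grad :: "(real^'n) set \<Rightarrow> (real^'n \<Rightarrow> real) \<Rightarrow> (real^'n \<Rightarrow> real^'n) \<Rightarrow> bool" where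
  "weak_grad U u g \<longleftrightarrow> (\<forall>\<psi> i. test_fun U \<psi> \<longrightarrow>
     (LINT x:U|lebesgue. u x * partial i \<psi> x) = - (LINT x:U|lebesgue. g x $ i * \<psi> x))"

definition L2 :: "(real^'n) set \<Rightarrow> (real^'n \<Rightarrow> real) \<Rightarrow> bool" where
  "L2 U u \<longleftrightarrow> set_borel_measurable lebesgue U u \<and> set_integrable lebesgue U (\<lambda>x. (u x)\<^sup>2)"

definition H1 :: "(real^'n) set \<Rightarrow> (real^'n \<Rightarrow> real) set" where
  "H1 U = {u. L2 U u \<and> (\<exists>g. weak_grad U u g \<and> (\<forall>i. L2 U (\<lambda>x. g x $ i)))}"

text \<open>The weak gradient Du (unique up to null sets).\<close>
definition Dw :: "(real^'n) set \<Rightarrow> (real^'n \<Rightarrow> real) \<Rightarrow> real^'n \<Rightarrow> real^'n" where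
  "Dw U u = (SOME g. weak_grad U u g \<and> (\<forall>i. L2 U (\<lambda>x. g x $ i)))"

definition H1_dist :: "(real^'n) set \<Rightarrow> (real^'n \<Rightarrow> real) \<Rightarrow> (real^'n \<Rightarrow> real) \<Rightarrow> real" where
  "H1_dist U u v = sqrt ((LINT x:U|lebesgue. (u x - v x)\<^sup>2)
                      + (LINT x:U|lebesgue. (norm (Dw U u x - Dw U v x))\<^sup>2))"

definition H1_0 :: "(real^'n) set \<Rightarrow> (real^'n \<Rightarrow> real) set" where
  "H1_0 U = {u \<in> H1 U. \<exists>\<psi>. (\<forall>k::nat. test_fun U (\<psi> k)) \<and>
              (\<lambda>k. H1_dist U (\<psi> k) u) \<longlonglongrightarrow> 0}"

definition energy :: "('w \<Rightarrow> real^'n \<Rightarrow> real) \<Rightarrow> (real^'n \<Rightarrow> 'w \<Rightarrow> 'w) \<Rightarrow> (real \<Rightarrow> real)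
    \<Rightarrow> 'w \<Rightarrow> (real^'n \<Rightarrow> real) \<Rightarrow> (real^'n) set \<Rightarrow> ennreal" where
  "energy \<Phi> \<tau> W \<omega> u A = (\<integral>\<^sup>+ x\<in>A. ennreal (1/2 * (phiw \<Phi> \<tau> \<omega> x (Dw A u x))\<^sup>2 + W (u x)) \<partial>lebesgue)"

definition qe :: "(real \<Rightarrow> real) \<Rightarrow> real^'n \<Rightarrow> real^'n \<Rightarrow> real" where
  "qe q e y = q (y \<bullet> e)"

definition oplus :: "(real^'n \<Rightarrow> real^'m \<Rightarrow> real^'n) \<Rightarrow> real^'n \<Rightarrow> (real^'m) set \<Rightarrow> real set
    \<Rightarrow> (real^'n) set" where
  "oplus Oe e A B = {Oe e a + b *\<^sub>R e | a b. a \<in> A \<and> b \<in> B}"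

text \<open>Cube Q(y,r) in R^{d-1} with respect to the fixed orthonormal basis bs.\<close>
definition cube :: "('m \<Rightarrow> real^'m) \<Rightarrow> real^'m \<Rightarrow> real \<Rightarrow> (real^'m) set" where
  "cube bs y r = {x. \<forall>i. \<bar>(x - y) \<bullet> bs i\<bar> < r / 2}"

definition cell :: "('w \<Rightarrow> real^'n \<Rightarrow> real) \<Rightarrow> (real^'n \<Rightarrow> 'w \<Rightarrow> 'w) \<Rightarrow> (real \<Rightarrow> real)
    \<Rightarrow> (real \<Rightarrow> real) \<Rightarrow> (real^'n \<Rightarrow> real^'m \<Rightarrow> real^'n) \<Rightarrow> 'w \<Rightarrow> real^'n
    \<Rightarrow> (real^'m) set \<Rightarrow> real \<Rightarrow> ennreal" where
  "cell \<Phi> \<tau> W q Oe \<omega> e A h =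
     (let U = oplus Oe e A {-h<..<h} in
      INF u\<in>{u. u \<in> H1 U \<and> (\<forall>x\<in>U. -1 \<le> u x \<and> u x \<le> 1)
               \<and> (\<lambda>x. u x - qe q e x) \<in> H1_0 U}. energy \<Phi> \<tau> W \<omega> u U)"

definition phi_tilde :: "('w \<Rightarrow> real^'n \<Rightarrow> real) \<Rightarrow> (real^'n \<Rightarrow> 'w \<Rightarrow> 'w) \<Rightarrow> (real \<Rightarrow> real)
    \<Rightarrow> (real \<Rightarrow> real) \<Rightarrow> (real^'n \<Rightarrow> real^'m \<Rightarrow> real^'n) \<Rightarrow> ('m \<Rightarrow> real^'m) \<Rightarrow> 'w
    \<Rightarrow> real^'n \<Rightarrow> ennreal" where
  "phi_tilde \<Phi> \<tau> W q Oe bs \<omega> e =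
     Liminf at_top (\<lambda>R::real. ennreal (R powr (1 - real CARD('n)))
                        * cell \<Phi> \<tau> W q Oe \<omega> e (cube bs 0 R) R)"

end

theory Submission
  imports Defs
begin

text \<open>
  The random variable is the lower limit of the normalised energies of the cylinders of size R. Two
  facts are needed: the cell energy is measurable in the medium, and the lower limit is invariant
  under the shifts (and may be taken along the integers).

  Measurability. The energy depends Lipschitz continuously, uniformly in the medium, on the pair
  (W(u), |Du| Du) in L1. Since every subset of L1 is separable, the infimum over the admissible
  functions is an infimum over a countable family.

  Invariance. An admissible function u on the cylinder of size R for the medium shifted by x becomes,
  after translation by x, a function on x + (cylinder of size R). It is continued to a slightly larger
  concentric cylinder by q(y.e - (x.e) eta(y)), where the smooth cutoff eta is 1 on the translated small
  cylinder and has compact support in the large one. If the slope of eta is small enough, the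
  continuation costs a multiple of the one-dimensional energy of q per unit area of the lateral
  annulus, plus the tail energy of q per unit area of the base, which is negligible after division by
  R^(d-1).
\<close>

section \<open>Smooth functions and cutoffs\<close>

text \<open>Boundary data are the obstacle to shift invariance. After translation a competitor has
  the boundary profile q((y-x).e), while the larger cylinder asks for q(y.e), and H1_0 offers no
  traces to glue along. The two profiles are therefore joined by one globally smooth function, and
  what is added to it is the difference of competitor and profile, which lies in H1_0 and can be
  extended by zero. The slope of the cutoff is chosen so that the phase y.e - (x.e) eta(y) still
  grows at rate at least 1/2 along e; hence every line parallel to e carries at most a fixed
  multiple of the one-dimensional energy of q. The slope does not depend on R, so the annulus has
  bounded width and its base area is of order R^(d-2). No monotonicity or continuity of the cell
  energy in R is available, so passing from real R to integers also needs a comparison of two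
  cylinders. It is the same comparison with x = 0, applied to an integer n(R) with n(R)/R tending to
  1. One inequality suffices: the shift by -x gives its converse.\<close>

definition smooth1 :: "(real \<Rightarrow> real) \<Rightarrow> bool" where
  "smooth1 g \<longleftrightarrow> (\<forall>k s. ((deriv ^^ k) g) differentiable (at s))"

lemma smooth1_DERIV:
  assumes "smooth1 g" shows "(g has_real_derivative deriv g x) (at x)"
proof -
  have "((deriv ^^ 0) g) differentiable (at x)"
    using assms unfolding smooth1_def by blast
  then have "g differentiable (at x)" by simp
  then show ?thesis
    using DERIV_imp_deriv real_differentiable_def by blast
qed

lemma smooth1_deriv: "smooth1 g \<Longrightarrow> smooth1 (deriv g)"
  unfolding smooth1_def by (metis comp_apply funpow_Suc_right)

lemma smooth1_continuous: "smooth1 g \<Longrightarrow> continuous_on S g"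
  by (meson DERIV_isCont continuous_at_imp_continuous_on smooth1_DERIV)

text \<open>A set of differentiable functions closed under \<open>deriv\<close> replaces an
  induction on the order of the derivative. It serves for the family p(1/t) exp(1 - 1/t), whose
  higher derivatives have no convenient closed form.\<close>

lemma smooth1_coinduct:
  assumes "g \<in> S"
    and "\<And>g. g \<in> S \<Longrightarrow> (\<forall>x. g differentiable (at x)) \<and> deriv g \<in> S"
  shows "smooth1 g"
proof -
  have "(deriv ^^ k) g \<in> S" for k
    by (induction k) (use assms in auto)
  then show ?thesis using assms(2) unfolding smooth1_def by blast
qed

lemma partial_eq: "(f has_derivative f') (at x) \<Longrightarrow> partial i f x = f' (axis i 1)"
  unfolding partial_def using frechet_derivative_at by metis

lemma smooth_fun_differentiable: "smooth_fun f \<Longrightarrow> f differentiable (at x)"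
  unfolding smooth_fun_def by (metis foldr.simps(1) id_apply)

lemma smooth_fun_partial: "smooth_fun f \<Longrightarrow> smooth_fun (partial i f)"
  unfolding smooth_fun_def
proof (intro allI)
  fix "is" x assume a: "\<forall>is x. foldr partial is f differentiable at x"
  show "foldr partial is (partial i f) differentiable at x"
    \<comment> \<open>\<open>foldr\<close> applies the last entry of the list first, so appending i
      makes \<open>partial i\<close> the innermost derivative.\<close>
    using a[rule_format, of "is @ [i]" x] by simp
qed

text \<open>The analogue for partial derivatives; the sets used are \<open>smooth_closure\<close>,
  the affine functions, and the translates of smooth functions.\<close>

lemma smooth_fun_coinduct:
  assumes "f \<in> S"
    and S: "\<And>f. f \<in> S \<Longrightarrow> (\<forall>x. f differentiable (at x)) \<and> (\<forall>i. partial i f \<in> S)"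
  shows "smooth_fun f"
proof -
  have "foldr partial is f \<in> S" for "is"
    by (induction "is") (use assms in auto)
  then show ?thesis using S unfolding smooth_fun_def by blast
qed

lemma smooth_fun_continuous: "smooth_fun f \<Longrightarrow> continuous_on S f"
  by (meson continuous_at_imp_continuous_on differentiable_imp_continuous_within smooth_fun_differentiable)

text \<open>Closing the smooth functions under the operations first reduces all closure properties to one
  rule induction: the closure is stable under partial derivatives.\<close>

inductive_set smooth_closure :: "(real^'n \<Rightarrow> real) set" where
  base: "smooth_fun f \<Longrightarrow> f \<in> smooth_closure"
| add: "f \<in> smooth_closure \<Longrightarrow> g \<in> smooth_closure \<Longrightarrow> (\<lambda>x. f x + g x) \<in> smooth_closure"
| mult: "f \<in> smooth_closure \<Longrightarrow> g \<in> smooth_closure \<Longrightarrow> (\<lambda>x. f x * g x) \<in> smooth_closure"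
| comp: "f \<in> smooth_closure \<Longrightarrow> smooth1 h \<Longrightarrow> (\<lambda>x. h (f x)) \<in> smooth_closure"

lemma smooth_closure_step:
  assumes "f \<in> smooth_closure"
  shows "(\<forall>x. f differentiable (at x)) \<and> (\<forall>i. partial i f \<in> smooth_closure)"
  using assms
proof induction
  case (base f)
  then show ?case
    using smooth_fun_differentiable smooth_fun_partial smooth_closure.base by blast
next
  case (add f g)
  have "partial i (\<lambda>x. f x + g x) = (\<lambda>x. partial i f x + partial i g x)" for i
  proof
    fix x
    show "partial i (\<lambda>x. f x + g x) x = partial i f x + partial i g x"
      unfolding partial_def
      using add by (subst frechet_derivative_at[symmetric, OF has_derivative_add])
        (auto simp: frechet_derivative_works[symmetric])
  qed
  with add show ?case by (auto intro: smooth_closure.add)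
next
  case (mult f g)
  have "partial i (\<lambda>x. f x * g x) = (\<lambda>x. f x * partial i g x + partial i f x * g x)" for i
  proof
    fix x
    show "partial i (\<lambda>x. f x * g x) x = f x * partial i g x + partial i f x * g x"
      unfolding partial_def
      using mult by (subst frechet_derivative_at[symmetric, OF has_derivative_mult])
        (auto simp: frechet_derivative_works[symmetric])
  qed
  with mult show ?case by (auto intro!: smooth_closure.add smooth_closure.mult)
next
  case (comp f h)
  have d: "((\<lambda>x. h (f x)) has_derivative (\<lambda>v. deriv h (f x) * frechet_derivative f (at x) v)) (at x)" for x
  proof (rule has_derivative_compose[of f "frechet_derivative f (at x)" x UNIV h "(*) (deriv h (f x))"])
    show "(f has_derivative frechet_derivative f (at x)) (at x)"
      using comp frechet_derivative_works by blast
    show "(h has_derivative (*) (deriv h (f x))) (at (f x))"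
      using smooth1_DERIV[OF comp(2)] by (simp add: has_field_derivative_def)
  qed
  have "partial i (\<lambda>x. h (f x)) = (\<lambda>x. deriv h (f x) * partial i f x)" for i
    by (rule ext, subst partial_eq[OF d]) (simp add: partial_def)
  moreover have "(\<lambda>x. deriv h (f x) * partial i f x) \<in> smooth_closure" for i
    by (rule smooth_closure.mult[OF smooth_closure.comp[OF comp(1) smooth1_deriv[OF comp(2)]]]) (use comp in blast)
  ultimately show ?case
    using d unfolding differentiable_def by auto
qed

lemma smooth_closure_smooth: "f \<in> smooth_closure \<Longrightarrow> smooth_fun f"
  by (rule smooth_fun_coinduct[of _ smooth_closure]) (use smooth_closure_step in auto)

lemma smooth_fun_add: "smooth_fun f \<Longrightarrow> smooth_fun g \<Longrightarrow> smooth_fun (\<lambda>x. f x + g x)"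
  by (rule smooth_closure_smooth[OF smooth_closure.add[OF smooth_closure.base smooth_closure.base]])

lemma smooth_fun_mult: "smooth_fun f \<Longrightarrow> smooth_fun g \<Longrightarrow> smooth_fun (\<lambda>x. f x * g x)"
  by (rule smooth_closure_smooth[OF smooth_closure.mult[OF smooth_closure.base smooth_closure.base]])

lemma smooth_fun_comp: "smooth1 h \<Longrightarrow> smooth_fun f \<Longrightarrow> smooth_fun (\<lambda>x. h (f x))"
  by (rule smooth_closure_smooth[OF smooth_closure.comp[OF smooth_closure.base]])

lemma smooth_fun_affine: "smooth_fun (\<lambda>x::real^'n. x \<bullet> v + c)"
proof (rule smooth_fun_coinduct[of _ "{f. \<exists>v c. f = (\<lambda>x. x \<bullet> v + c)}"], blast)
  fix f :: "real^'n \<Rightarrow> real" assume "f \<in> {f. \<exists>v c. f = (\<lambda>x. x \<bullet> v + c)}"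
  then obtain v c where f: "f = (\<lambda>x. x \<bullet> v + c)" by blast
  have d: "(f has_derivative (\<lambda>h. h \<bullet> v)) (at x)" for x
    unfolding f by (auto intro!: derivative_eq_intros)
  \<comment> \<open>The constant derivative is written as an affine function of zero slope so that
    it stays in the chosen set.\<close>
  have "partial i f = (\<lambda>x. x \<bullet> 0 + axis i 1 \<bullet> v)" for i
    by (rule ext, subst partial_eq[OF d]) simp
  then show "(\<forall>x. f differentiable (at x)) \<and> (\<forall>i. partial i f \<in> {f. \<exists>v c. f = (\<lambda>x. x \<bullet> v + c)})"
    using d unfolding differentiable_def by blast
qed

lemma smooth_fun_const: "smooth_fun (\<lambda>x::real^'n. c)"
  using smooth_fun_affine[of 0 c] by simp

lemma smooth_fun_prod:
  "(\<And>i. i \<in> I \<Longrightarrow> smooth_fun (f i)) \<Longrightarrow> smooth_fun (\<lambda>x. \<Prod>i\<in>I. f i x)"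
  by (induction I rule: infinite_finite_induct) (auto intro: smooth_fun_const smooth_fun_mult)

lemma smooth_fun_diff: "smooth_fun f \<Longrightarrow> smooth_fun g \<Longrightarrow> smooth_fun (\<lambda>x. f x - g x)"
proof -
  assume f: "smooth_fun f" and g: "smooth_fun g"
  have "smooth_fun (\<lambda>x. f x + -1 * g x)"
    by (rule smooth_fun_add[OF f smooth_fun_mult[OF smooth_fun_const g]])
  then show ?thesis by simp
qed

lemma smooth_fun_translate:
  assumes "smooth_fun f"
  shows "smooth_fun (\<lambda>x. f (x - a))" and "partial i (\<lambda>x. f (x - a)) = (\<lambda>x. partial i f (x - a))"
proof -
  have d: "((\<lambda>x. g (x - a)) has_derivative frechet_derivative g (at (x - a))) (at x)"
    if "smooth_fun g" for g :: "real^'a \<Rightarrow> real" and x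
  proof (rule has_derivative_compose[of "\<lambda>x. x - a" "\<lambda>x. x" x UNIV g "frechet_derivative g (at (x - a))", simplified])
    show "((\<lambda>x. x - a) has_derivative (\<lambda>x. x)) (at x)"
      by (auto intro!: derivative_eq_intros)
    show "(g has_derivative frechet_derivative g (at (x - a))) (at (x - a))"
      using smooth_fun_differentiable[OF that] frechet_derivative_works by blast
  qed
  have p: "partial i (\<lambda>x. g (x - a)) = (\<lambda>x. partial i g (x - a))"
    if "smooth_fun g" for g :: "real^'a \<Rightarrow> real" and i
    by (rule ext, subst partial_eq[OF d[OF that]]) (simp add: partial_def)
  show "partial i (\<lambda>x. f (x - a)) = (\<lambda>x. partial i f (x - a))" by (rule p[OF assms])
  show "smooth_fun (\<lambda>x. f (x - a))"
  proof (rule smooth_fun_coinduct[of _ "{h. \<exists>g. smooth_fun g \<and> h = (\<lambda>x. g (x - a))}"])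
    show "(\<lambda>x. f (x - a)) \<in> {h. \<exists>g. smooth_fun g \<and> h = (\<lambda>x. g (x - a))}" using assms by blast
  next
    fix h :: "real^'a \<Rightarrow> real" assume "h \<in> {h. \<exists>g. smooth_fun g \<and> h = (\<lambda>x. g (x - a))}"
    then obtain g where g: "smooth_fun g" "h = (\<lambda>x. g (x - a))" by blast
    show "(\<forall>x. h differentiable at x) \<and> (\<forall>i. partial i h \<in> {h. \<exists>g. smooth_fun g \<and> h = (\<lambda>x. g (x - a))})"
      using d[OF g(1)] p[OF g(1)] smooth_fun_partial[OF g(1)] unfolding g(2) differentiable_def
      by blast
  qed
qed

section \<open>Gradients of differentiable functions\<close>

definition grad :: "(real^'n \<Rightarrow> real) \<Rightarrow> real^'n \<Rightarrow> real^'n" where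
  "grad f x = (\<chi> i. partial i f x)"

lemma grad_nth [simp]: "grad f x $ i = partial i f x"
  by (simp add: grad_def)

lemma has_derivative_grad:
  assumes "f differentiable (at x)"
  shows "(f has_derivative (\<lambda>h. grad f x \<bullet> h)) (at x)"
proof -
  have d: "(f has_derivative frechet_derivative f (at x)) (at x)"
    using assms frechet_derivative_works by blast
  then interpret bounded_linear "frechet_derivative f (at x)"
    by (rule has_derivative_bounded_linear)
  have "frechet_derivative f (at x) h = grad f x \<bullet> h" for h
  proof -
    have "h = (\<Sum>i\<in>UNIV. h $ i *\<^sub>R axis i 1)"
      by (simp add: vec_eq_iff axis_def if_distrib cong: if_cong)
    then have "frechet_derivative f (at x) h = (\<Sum>i\<in>UNIV. h $ i *\<^sub>R frechet_derivative f (at x) (axis i 1))"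
      by (metis (no_types, lifting) scaleR sum sum.cong)
    then show ?thesis by (simp add: inner_vec_def partial_def mult.commute)
  qed
  then show ?thesis using d by (metis (no_types, lifting) ext)
qed

lemma smooth_fun_has_derivative: "smooth_fun f \<Longrightarrow> (f has_derivative (\<lambda>h. grad f x \<bullet> h)) (at x)"
  by (simp add: has_derivative_grad smooth_fun_differentiable)

lemma grad_eqI:
  assumes "(f has_derivative (\<lambda>h. v \<bullet> h)) (at x)" shows "grad f x = v"
  by (simp add: vec_eq_iff partial_eq[OF assms] inner_axis)

lemma continuous_on_grad: "smooth_fun f \<Longrightarrow> continuous_on S (grad f)"
  unfolding grad_def by (intro continuous_on_vec_lambda smooth_fun_continuous smooth_fun_partial)

lemma grad_translate: "smooth_fun f \<Longrightarrow> grad (\<lambda>x. f (x - a)) x = grad f (x - a)"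
  by (simp add: vec_eq_iff smooth_fun_translate)

text \<open>In the direction of the gradient itself the directional derivative is |grad f|^2, while
  the Lipschitz bound allows at most L |grad f|.\<close>

lemma norm_grad_le_Lipschitz:
  assumes "f differentiable (at x)" and L: "\<And>y. \<bar>f y - f x\<bar> \<le> L * norm (y - x)" and "0 \<le> L"
  shows "norm (grad f x) \<le> L"
proof -
  let ?g = "grad f x"
  have "((\<lambda>t. f (x + t *\<^sub>R ?g)) has_derivative (\<lambda>t. ?g \<bullet> (t *\<^sub>R ?g))) (at 0)"
    by (rule has_derivative_compose[of "\<lambda>t. x + t *\<^sub>R ?g" _ 0 UNIV f])
      (use has_derivative_grad[OF assms(1)] in \<open>auto intro!: derivative_eq_intros\<close>)
  then have "((\<lambda>t. f (x + t *\<^sub>R ?g)) has_real_derivative (?g \<bullet> ?g)) (at 0)"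
    by (simp add: has_field_derivative_def mult.commute[of _ "?g \<bullet> ?g"])
  then have lim: "(\<lambda>h. (f (x + h *\<^sub>R ?g) - f x) / h) \<midarrow>0\<rightarrow> ?g \<bullet> ?g"
    by (simp add: DERIV_def)
  have "\<bar>?g \<bullet> ?g\<bar> \<le> L * norm ?g"
  proof (rule tendsto_le[OF _ tendsto_const tendsto_rabs[OF lim]])
    show "\<forall>\<^sub>F h in at 0. \<bar>(f (x + h *\<^sub>R ?g) - f x) / h\<bar> \<le> L * norm ?g"
      unfolding eventually_at
    proof (intro exI[of _ 1] conjI ballI impI)
      fix h :: real assume h: "h \<noteq> 0 \<and> dist h 0 < 1"
      show "\<bar>(f (x + h *\<^sub>R ?g) - f x) / h\<bar> \<le> L * norm ?g"
        using L[of "x + h *\<^sub>R ?g"] h by (simp add: divide_simps mult.assoc mult.commute mult.left_commute)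
    qed simp
  qed simp
  then have "norm ?g * norm ?g \<le> L * norm ?g"
    by (simp add: dot_square_norm power2_eq_square)
  then show ?thesis
    using \<open>0 \<le> L\<close> by (cases "norm ?g = 0") (auto simp: mult_le_cancel_right)
qed

section \<open>A smooth step function\<close>

definition flat_exp :: "real \<Rightarrow> real" where
  "flat_exp t = (if 0 < t then exp (1 - 1 / t) else 0)"

lemma poly_times_exp_minus_tendsto_0: "((\<lambda>x::real. poly p x * exp (1 - x)) \<longlongrightarrow> 0) at_top"
proof -
  have "((\<lambda>x. \<Sum>i\<le>degree p. coeff p i * exp 1 * (x ^ i / exp x)) \<longlongrightarrow> (\<Sum>i\<le>degree p. coeff p i * exp 1 * 0)) at_top"
    by (intro tendsto_intros tendsto_power_div_exp_0)
  moreover have "(\<lambda>x. \<Sum>i\<le>degree p. coeff p i * exp 1 * (x ^ i / exp x)) = (\<lambda>x. poly p x * exp (1 - x))"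
    by (rule ext) (simp add: poly_altdef sum_distrib_left sum_divide_distrib exp_diff mult_ac)
  ultimately show ?thesis by simp
qed

text \<open>Up to the factor e this is the classical flat function exp(-1/t). On the positive axis
  its derivatives are polynomials in 1/t times the function itself, and this family is closed under
  differentiation, also at 0.\<close>

lemma smooth1_flat_exp: "smooth1 flat_exp"
proof -
  define B where "B p t = (if 0 < t then poly p (1 / t) * exp (1 - 1 / t) else 0)" for p and t :: real
  \<comment> \<open>With s = 1/t and ds/dt = -s^2, the derivative of p(s) exp(1 - s) is (p(s) -
    p'(s)) s^2 exp(1 - s), again of the same form.\<close>
  let ?D = "\<lambda>p. (p - pderiv p) * [:0, 0, 1:]"
  have D: "(B p has_real_derivative B (?D p) t) (at t)" for p t
  proof (cases t "0::real" rule: linorder_cases)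
    case greater
    have "((\<lambda>t. poly p (1 / t) * exp (1 - 1 / t)) has_real_derivative B (?D p) t) (at t)"
      using greater unfolding B_def
      by (auto intro!: derivative_eq_intros simp: field_simps power2_eq_square)
    then show ?thesis
      by (rule has_field_derivative_transform_within_open[of _ _ _ "{0<..}"])
        (use greater in \<open>auto simp: B_def\<close>)
  next
    case less
    have "((\<lambda>t. 0) has_real_derivative B (?D p) t) (at t)"
      using less unfolding B_def by auto
    then show ?thesis
      by (rule has_field_derivative_transform_within_open[of _ _ _ "{..<0}"])
        (use less in \<open>auto simp: B_def\<close>)
  next
    case equal
    \<comment> \<open>For h > 0 the difference quotient at 0 is s p(s) exp(1 - s) with s = 1/h, and
      s p(s) is \<open>pCons 0 p\<close>; exponential decay wins as s grows.\<close>
    have r: "((\<lambda>h. B p h / h) \<longlongrightarrow> 0) (at_right 0)"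
    proof (rule Lim_transform_eventually)
      show "((\<lambda>h. poly (pCons 0 p) (inverse h) * exp (1 - inverse h)) \<longlongrightarrow> 0) (at_right 0)"
        by (rule filterlim_compose[OF poly_times_exp_minus_tendsto_0 filterlim_inverse_at_top_right])
      show "\<forall>\<^sub>F h in at_right 0. poly (pCons 0 p) (inverse h) * exp (1 - inverse h) = B p h / h"
        unfolding eventually_at_right_field by (intro exI[of _ 1]) (auto simp: B_def field_simps)
    qed
    have l: "((\<lambda>h. B p h / h) \<longlongrightarrow> 0) (at_left 0)"
      by (rule Lim_transform_eventually[OF tendsto_const])
        (auto simp: B_def eventually_at_left_field intro!: exI[of _ "-1"])
    have "((\<lambda>h. B p h / h) \<longlongrightarrow> 0) (at 0)"
      using filterlim_split_at[OF l r] by simp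
    then show ?thesis
      using equal by (simp add: DERIV_def B_def)
  qed
  have "flat_exp = B 1" by (auto simp: flat_exp_def B_def)
  then have "flat_exp \<in> range B" by blast
  then show ?thesis
  proof (rule smooth1_coinduct)
    fix g assume "g \<in> range B"
    then obtain p where g: "g = B p" by blast
    have "deriv g = B (?D p)"
      unfolding g using D DERIV_imp_deriv by blast
    then show "(\<forall>x. g differentiable at x) \<and> deriv g \<in> range B"
      using D real_differentiable_def unfolding g by blast
  qed
qed

text \<open>Since \<^const>\<open>flat_exp\<close> maps 1 to 1 and the negative half-line to 0, composing it with itself gives a
  smooth step without division.\<close>

definition smooth_step :: "real \<Rightarrow> real" where
  "smooth_step t = flat_exp (1 - flat_exp (1 - t))"

lemma flat_exp_mono: "s \<le> t \<Longrightarrow> flat_exp s \<le> flat_exp t"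
  unfolding flat_exp_def by (auto simp: frac_le)

lemma flat_exp_nonneg: "0 \<le> flat_exp t" and flat_exp_1: "flat_exp 1 = 1" and flat_exp_neg: "t \<le> 0 \<Longrightarrow> flat_exp t = 0"
  unfolding flat_exp_def by auto

lemma smooth_step_ge1: "1 \<le> t \<Longrightarrow> smooth_step t = 1"
  unfolding smooth_step_def by (simp add: flat_exp_neg flat_exp_1)

lemma smooth_step_le0: "t \<le> 0 \<Longrightarrow> smooth_step t = 0"
  unfolding smooth_step_def using flat_exp_mono[of 1 "1 - t"] by (simp add: flat_exp_neg flat_exp_1)

lemma smooth_step_bounds: "0 \<le> smooth_step t" "smooth_step t \<le> 1"
  unfolding smooth_step_def
  using flat_exp_mono[of "1 - flat_exp (1 - t)" 1] by (auto simp: flat_exp_nonneg flat_exp_1)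

lemma smooth_fun_smooth_step: "smooth_fun f \<Longrightarrow> smooth_fun (\<lambda>x. smooth_step (f x))"
  unfolding smooth_step_def
  by (rule smooth_fun_comp[OF smooth1_flat_exp smooth_fun_diff[OF smooth_fun_const
        smooth_fun_comp[OF smooth1_flat_exp smooth_fun_diff[OF smooth_fun_const]]]])

text \<open>The derivative is bounded: it is continuous on [0,1] and vanishes outside, where the
  step is locally constant. The constant c later decides how gently the cutoff must decay.\<close>

lemma smooth_step_Lipschitz:
  obtains c where "0 < c" "\<And>s t. \<bar>smooth_step s - smooth_step t\<bar> \<le> c * \<bar>s - t\<bar>"
proof -
  let ?d = "deriv flat_exp"
  have dF: "(flat_exp has_real_derivative ?d t) (at t)" for t
    by (rule smooth1_DERIV[OF smooth1_flat_exp])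
  have cF: "continuous_on S flat_exp" and cd: "continuous_on S ?d" for S
    by (auto intro: smooth1_continuous smooth1_deriv smooth1_flat_exp)
  define s' where "s' t = ?d (1 - flat_exp (1 - t)) * ?d (1 - t)" for t
  have ds: "(smooth_step has_real_derivative s' t) (at t)" for t
  proof -
    have 1: "((\<lambda>t. 1 - flat_exp (1 - t)) has_real_derivative ?d (1 - t)) (at t)"
      by (auto intro!: derivative_eq_intros DERIV_chain2[OF dF])
    show ?thesis
      unfolding smooth_step_def[abs_def] s'_def by (rule DERIV_chain2[OF dF 1])
  qed
  have "continuous_on {0..1} s'"
    unfolding s'_def
    by (intro continuous_intros continuous_on_compose2[OF cd[of UNIV]] continuous_on_compose2[OF cF[of UNIV]]) auto
  then have "compact (s' ` {0..1})" by (intro compact_continuous_image compact_Icc)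
  then obtain b where b: "\<forall>x\<in>s' ` {0..1}. \<bar>x\<bar> \<le> b"
    using bounded_real compact_imp_bounded by blast
  have l: "\<bar>s' t\<bar> \<le> \<bar>b\<bar> + 1" for t
  proof -
    consider "t \<in> {0..1}" | "t < 0" | "1 < t" by force
    then show ?thesis
    proof cases
      case 1 then show ?thesis using b by force
    next
      case 2
      have "((\<lambda>t. 0) has_real_derivative s' t) (at t)"
        by (rule has_field_derivative_transform_within_open[OF ds, of "{..<0}"])
          (use 2 smooth_step_le0 in auto)
      then have "s' t = 0" using DERIV_unique[OF _ DERIV_const[of 0]] by blast
      then show ?thesis by simp
    next
      case 3
      have "((\<lambda>t. 1) has_real_derivative s' t) (at t)"
        by (rule has_field_derivative_transform_within_open[OF ds, of "{1<..}"])
          (use 3 smooth_step_ge1 in auto)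
      then have "s' t = 0" using DERIV_unique[OF _ DERIV_const[of 1]] by blast
      then show ?thesis by simp
    qed
  qed
  have "\<bar>smooth_step s - smooth_step t\<bar> \<le> (\<bar>b\<bar> + 1) * \<bar>s - t\<bar>" for s t
    using field_differentiable_bound[of UNIV smooth_step s' "\<bar>b\<bar> + 1" s t] ds l
    by (auto simp: has_field_derivative_at_within)
  then show ?thesis by (intro that[of "\<bar>b\<bar> + 1"]) auto
qed

section \<open>Test functions and their supports\<close>

lemma test_fun_smooth: "test_fun U f \<Longrightarrow> smooth_fun f"
  by (simp add: test_fun_def)

lemma test_fun_mono: "test_fun U f \<Longrightarrow> U \<subseteq> V \<Longrightarrow> test_fun V f"
  by (auto simp: test_fun_def)

lemma test_funI:
  assumes "smooth_fun f" "compact K" "K \<subseteq> U" "\<And>x. x \<notin> K \<Longrightarrow> f x = 0"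
  shows "test_fun U f"
proof -
  have "closure {x. f x \<noteq> 0} \<subseteq> K"
    using assms by (intro closure_minimal compact_imp_closed) auto
  moreover from this have "compact (closure {x. f x \<noteq> 0})"
    using \<open>compact K\<close> by (metis closed_Int_compact closed_closure inf.absorb_iff1)
  ultimately show ?thesis using assms unfolding test_fun_def by auto
qed

lemma eq_0_outside_support: "x \<notin> closure {x. f x \<noteq> 0} \<Longrightarrow> f x = 0"
  using closure_subset[of "{x. f x \<noteq> 0}"] by auto

lemma test_fun_add:
  assumes "test_fun U f" "test_fun U g" shows "test_fun U (\<lambda>x. f x + g x)"
proof (rule test_funI[of _ "closure {x. f x \<noteq> 0} \<union> closure {x. g x \<noteq> 0}"])
  show "smooth_fun (\<lambda>x. f x + g x)"
    by (rule smooth_fun_add) (use assms in \<open>simp_all add: test_fun_def\<close>)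
  show "compact (closure {x. f x \<noteq> 0} \<union> closure {x. g x \<noteq> 0})"
    "closure {x. f x \<noteq> 0} \<union> closure {x. g x \<noteq> 0} \<subseteq> U"
    using assms unfolding test_fun_def by blast+
  show "f x + g x = 0" if "x \<notin> closure {x. f x \<noteq> 0} \<union> closure {x. g x \<noteq> 0}" for x
    using that eq_0_outside_support[of x f] eq_0_outside_support[of x g] by auto
qed

lemma test_fun_translate:
  assumes "test_fun U f" shows "test_fun ((+) a ` U) (\<lambda>x. f (x - a))"
proof (rule test_funI)
  show "smooth_fun (\<lambda>x. f (x - a))" using assms smooth_fun_translate(1) test_fun_def by blast
  show "compact ((+) a ` closure {x. f x \<noteq> 0})"
    using assms by (simp add: test_fun_def compact_translation)
  show "(+) a ` closure {x. f x \<noteq> 0} \<subseteq> (+) a ` U"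
    using assms by (auto simp: test_fun_def)
  fix x assume x: "x \<notin> (+) a ` closure {x. f x \<noteq> 0}"
  show "f (x - a) = 0"
  proof (rule ccontr)
    assume "f (x - a) \<noteq> 0"
    then have "x - a \<in> closure {x. f x \<noteq> 0}" using closure_subset by force
    then show False using x by (metis add_diff_cancel_left' diff_add_cancel image_eqI add.commute)
  qed
qed

lemma partial_eq_0_outside: "x \<notin> closure {x. f x \<noteq> 0} \<Longrightarrow> partial i f x = 0"
proof -
  assume x: "x \<notin> closure {x. f x \<noteq> 0}"
  have "((\<lambda>x. 0::real) has_derivative (\<lambda>h. 0)) (at x)" by simp
  then have "(f has_derivative (\<lambda>h. 0)) (at x)"
    by (rule has_derivative_transform_within_open[of _ _ _ _ "- closure {x. f x \<noteq> 0}"])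
      (use x closure_subset[of "{x. f x \<noteq> 0}"] in auto)
  then show ?thesis by (rule partial_eq)
qed

section \<open>Weak gradients\<close>

lemma test_fun_eq_0:
  assumes "test_fun U f" "x \<notin> U" shows "f x = 0" "partial i f x = 0"
proof -
  have "x \<notin> closure {x. f x \<noteq> 0}" using assms unfolding test_fun_def by blast
  then show "f x = 0" "partial i f x = 0"
    by (auto intro: eq_0_outside_support partial_eq_0_outside)
qed

lemma integrable_compact_support:
  fixes f :: "'a::euclidean_space \<Rightarrow> real"
  assumes "continuous_on UNIV f" "compact K" "\<And>x. x \<notin> K \<Longrightarrow> f x = 0"
  shows "integrable lborel f"
proof -
  have "(\<lambda>x. indicator K x *\<^sub>R f x) = f"
    using assms(3) by (force simp: indicator_def)
  then show ?thesis
    using borel_integrable_compact[OF assms(2) continuous_on_subset[OF assms(1)]] by (metis subset_UNIV)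
qed

lemma bounded_compact_support:
  fixes f :: "'a::euclidean_space \<Rightarrow> 'b::real_normed_vector"
  assumes "continuous_on UNIV f" "compact K" "\<And>x. x \<notin> K \<Longrightarrow> f x = 0"
  obtains B where "0 \<le> B" "\<And>x. norm (f x) \<le> B"
proof -
  have "compact (f ` K)"
    by (intro compact_continuous_image continuous_on_subset[OF assms(1)] assms(2)) auto
  then obtain B where "\<And>y. y \<in> f ` K \<Longrightarrow> norm y \<le> B"
    using compact_imp_bounded bounded_iff by metis
  then have "norm (f x) \<le> \<bar>B\<bar>" for x
    using assms(3)[of x] by (cases "x \<in> K") force+
  then show ?thesis by (intro that[of "\<bar>B\<bar>"]) auto
qed

text \<open>By translation invariance the integrals of the difference quotients vanish.\<close>

lemma integral_partial_eq_0:
  fixes f :: "real^'n \<Rightarrow> real"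
  assumes f: "smooth_fun f" and K: "compact K" and 0: "\<And>x. x \<notin> K \<Longrightarrow> f x = 0"
  shows "integral\<^sup>L lborel (partial i f) = 0"
proof -
  let ?e = "axis i 1 :: real^'n"
  \<comment> \<open>Steps of length at most 1 keep all difference quotients supported in one ball,
    which supplies the dominating function.\<close>
  define h where "h n = inverse (real (Suc n))" for n
  have h: "0 < h n" "h n \<le> 1" for n
    by (auto simp: h_def field_simps)
  define F where "F n x = (f (x + h n *\<^sub>R ?e) - f x) / h n" for n x
  have cont: "continuous_on S f" for S by (rule smooth_fun_continuous[OF f])
  have int: "integrable lborel f" by (rule integrable_compact_support[OF cont K 0])
  have shift: "integrable lborel (\<lambda>x. f (x + c))" "(\<integral>x. f (x + c) \<partial>lborel) = integral\<^sup>L lborel f" for c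
  proof -
    have "integrable (distr lborel borel ((+) c)) f" using int by (simp add: lborel_distr_plus)
    then show "integrable lborel (\<lambda>x. f (x + c))"
      by (subst (asm) integrable_distr_eq) (auto simp: add.commute intro: borel_measurable_integrable[OF int, simplified])
    have "integral\<^sup>L (distr lborel borel ((+) c)) f = (\<integral>x. f (c + x) \<partial>lborel)"
      by (rule integral_distr) (use borel_measurable_integrable[OF int] in auto)
    then show "(\<integral>x. f (x + c) \<partial>lborel) = integral\<^sup>L lborel f"
      by (simp add: lborel_distr_plus add.commute)
  qed
  have F0: "integral\<^sup>L lborel (F n) = 0" for n
    unfolding F_def using shift int by (simp add: Bochner_Integration.integral_diff)
  have g0: "grad f x = 0" if "x \<notin> K" for x
  proof -
    have "closure {x. f x \<noteq> 0} \<subseteq> K"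
      using 0 K by (intro closure_minimal compact_imp_closed) auto
    then show ?thesis
      using that partial_eq_0_outside[of x f] by (auto simp: vec_eq_iff)
  qed
  obtain B where B: "0 \<le> B" "\<And>x. norm (grad f x) \<le> B"
    using bounded_compact_support[OF continuous_on_grad[OF f] K g0] by blast
  obtain r where r: "K \<subseteq> cball 0 r"
    using compact_imp_bounded[OF K] unfolding bounded_iff by (metis mem_cball_0 subsetI)
  have on: "onorm (\<lambda>h. grad f x \<bullet> h) \<le> B" for x
  proof (rule onorm_le)
    fix h
    have "norm (grad f x \<bullet> h) \<le> norm (grad f x) * norm h"
      using Cauchy_Schwarz_ineq2 by simp
    also have "\<dots> \<le> B * norm h" by (intro mult_right_mono B) auto
    finally show "norm (grad f x \<bullet> h) \<le> B * norm h" .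
  qed
  have Fbd: "\<bar>F n x\<bar> \<le> B * indicator (cball 0 (r + 1)) x" for n x
  proof (cases "x \<in> cball 0 (r + 1)")
    case True
    have "norm (f (x + h n *\<^sub>R ?e) - f x) \<le> B * norm (x + h n *\<^sub>R ?e - x)"
      by (rule differentiable_bound[of UNIV f "\<lambda>x h. grad f x \<bullet> h"])
        (use on smooth_fun_has_derivative[OF f] in auto)
    then show ?thesis
      using True h[of n] by (simp add: F_def divide_simps)
  next
    case False
    then have "norm x > r + 1" by simp
    moreover have "norm x \<le> norm (x + h n *\<^sub>R ?e) + norm (h n *\<^sub>R ?e)"
      using norm_triangle_ineq4[of "x + h n *\<^sub>R ?e" "h n *\<^sub>R ?e"] by simp
    ultimately have "x \<notin> K" "x + h n *\<^sub>R ?e \<notin> K"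
      using r h[of n] by auto
    then show ?thesis using 0 False by (simp add: F_def)
  qed
  have Fl: "(\<lambda>n. F n x) \<longlonglongrightarrow> partial i f x" for x
  proof -
    have "((\<lambda>t. f (x + t *\<^sub>R ?e)) has_derivative (\<lambda>t. grad f x \<bullet> (t *\<^sub>R ?e))) (at 0)"
      by (rule has_derivative_compose[of "\<lambda>t. x + t *\<^sub>R ?e" _ 0 UNIV f])
        (use smooth_fun_has_derivative[OF f] in \<open>auto intro!: derivative_eq_intros\<close>)
    then have "((\<lambda>t. f (x + t *\<^sub>R ?e)) has_real_derivative partial i f x) (at 0)"
      by (simp add: has_field_derivative_def inner_axis mult.commute[of _ "partial i f x"])
    then have lim: "(\<lambda>h. (f (x + h *\<^sub>R ?e) - f x) / h) \<midarrow>0\<rightarrow> partial i f x"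
      by (simp add: DERIV_def)
    have "filterlim h (at 0) sequentially"
      unfolding filterlim_at using LIMSEQ_inverse_real_of_nat h by (auto simp: h_def[abs_def])
    then show ?thesis
      unfolding F_def by (rule filterlim_compose[OF lim])
  qed
  have "(\<lambda>n. integral\<^sup>L lborel (F n)) \<longlonglongrightarrow> integral\<^sup>L lborel (partial i f)"
  proof (rule integral_dominated_convergence[where w = "\<lambda>x. B * indicator (cball 0 (r + 1)) x"])
    show "partial i f \<in> borel_measurable lborel"
      using smooth_fun_continuous[OF smooth_fun_partial[OF f]] borel_measurable_continuous_onI by force
    show "integrable lborel (\<lambda>x::real^'n. B * indicator (cball 0 (r + 1)) x)"
      using emeasure_bounded_finite[of "cball (0::real^'n) (r + 1)"]
      by (intro integrable_mult_right integrable_real_indicator) auto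
    show "F n \<in> borel_measurable lborel" for n
      unfolding F_def using shift[of "h n *\<^sub>R ?e"] int borel_measurable_integrable by auto
  qed (use Fbd Fl in auto)
  then show ?thesis using F0 LIMSEQ_unique by (auto simp: LIMSEQ_const_iff)
qed

lemma partial_mult:
  "smooth_fun f \<Longrightarrow> smooth_fun g \<Longrightarrow> partial i (\<lambda>x. f x * g x) x = f x * partial i g x + partial i f x * g x"
  by (subst partial_eq[OF has_derivative_mult[OF smooth_fun_has_derivative smooth_fun_has_derivative]])
    (auto simp: inner_axis)

text \<open>The product rule is integrated for f times the test function, whose partial derivatives
  have integral zero. The test function and its derivatives vanish off U, so restricting the
  integrals to U changes nothing.\<close>

lemma weak_grad_smooth:
  assumes f: "smooth_fun f" shows "weak_grad U f (grad f)"
  unfolding weak_grad_def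
proof (intro allI impI)
  fix \<psi> :: "real^'a \<Rightarrow> real" and i assume t: "test_fun U \<psi>"
  then have p: "smooth_fun \<psi>" and K: "compact (closure {x. \<psi> x \<noteq> 0})"
    by (auto simp: test_fun_def)
  let ?K = "closure {x. \<psi> x \<noteq> 0}"
  have z: "\<psi> x = 0" "partial i \<psi> x = 0" if "x \<notin> ?K" for x
    using that by (rule eq_0_outside_support, rule partial_eq_0_outside)
  have c: "continuous_on UNIV f" "continuous_on UNIV \<psi>" "continuous_on UNIV (partial i f)" "continuous_on UNIV (partial i \<psi>)"
    using f p by (auto intro: smooth_fun_continuous smooth_fun_partial)
  have i1: "integrable lborel (\<lambda>x. f x * partial i \<psi> x)"
    by (rule integrable_compact_support[OF _ K]) (intro continuous_on_mult c, drule z(2), simp)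
  have i2: "integrable lborel (\<lambda>x. partial i f x * \<psi> x)"
    by (rule integrable_compact_support[OF _ K]) (intro continuous_on_mult c, drule z(1), simp)
  have "integral\<^sup>L lborel (partial i (\<lambda>x. f x * \<psi> x)) = 0"
    by (rule integral_partial_eq_0[OF smooth_fun_mult[OF f p] K]) (drule z(1), simp)
  then have "(\<integral>x. f x * partial i \<psi> x + partial i f x * \<psi> x \<partial>lborel) = 0"
    unfolding ext[OF partial_mult[OF f p]] .
  then have s: "(\<integral>x. f x * partial i \<psi> x \<partial>lborel) = - (\<integral>x. partial i f x * \<psi> x \<partial>lborel)"
    using i1 i2 by simp
  have e: "(\<lambda>x. indicator U x *\<^sub>R (f x * partial i \<psi> x)) = (\<lambda>x. f x * partial i \<psi> x)"
    "(\<lambda>x. indicator U x *\<^sub>R (grad f x $ i * \<psi> x)) = (\<lambda>x. partial i f x * \<psi> x)"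
    using test_fun_eq_0[OF t] by (auto simp: fun_eq_iff indicator_def)
  show "(LINT x:U|lebesgue. f x * partial i \<psi> x) = - (LINT x:U|lebesgue. grad f x $ i * \<psi> x)"
    unfolding set_lebesgue_integral_def e
    using s i1 i2 by (simp add: integral_completion borel_measurable_integrable)
qed

text \<open>Boxes form an intersection-stable generator of the Borel sets, and the sets over which f
  integrates to zero form a Dynkin system. Hence f and 0 have the same integral over every Borel
  set.\<close>

lemma AE_eq_0_of_box_integrals:
  fixes f :: "'a::euclidean_space \<Rightarrow> real"
  assumes f: "integrable lborel f" and 0: "\<And>a b. (LINT x:box a b|lborel. f x) = 0"
  shows "AE x in lborel. f x = 0"
proof -
  have si: "set_integrable lborel A f" if "A \<in> sets borel" for A
    using f that unfolding set_integrable_def by (intro integrable_mult_indicator) auto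
  let ?A = "\<lambda>n::nat. box (- (real n *\<^sub>R One)) (real n *\<^sub>R One) :: 'a set"
  have inc: "incseq ?A"
    unfolding incseq_def by (intro allI impI subset_box_imp) (auto simp: subset_box inner_Basis)
  have "(\<lambda>n. LINT x:?A n|lborel. f x) \<longlonglongrightarrow> (LINT x:(\<Union>n. ?A n)|lborel. f x)"
    by (rule set_integral_cont_up[OF _ inc]) (auto intro: si)
  \<comment> \<open>The total integral handles the complements in the Dynkin argument; it is the
    limit along an increasing sequence of boxes.\<close>
  then have U: "(LINT x:UNIV|lborel. f x) = 0"
    using 0 by (auto simp: UN_box_eq_UNIV LIMSEQ_const_iff)
  have "(LINT x:A|lborel. f x) = 0" if "A \<in> sets borel" for A
  proof -
    have "Int_stable (range (\<lambda>(a, b). box a b :: 'a set))"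
      by (auto simp: Int_stable_def box_Int_box)
    moreover have "range (\<lambda>(a, b). box a b :: 'a set) \<subseteq> Pow UNIV" by auto
    moreover have "A \<in> sigma_sets UNIV (range (\<lambda>(a, b). box a b))"
      using that unfolding borel_eq_box by simp
    ultimately show ?thesis
    proof (induction rule: sigma_sets_induct_disjoint)
      case (basic A) then show ?case using 0 by auto
    next
      case empty then show ?case by (simp add: set_lebesgue_integral_def)
    next
      case (compl A)
      then have A: "A \<in> sets borel" by (simp add: borel_eq_box)
      have "(LINT x:A \<union> (UNIV - A)|lborel. f x) = (LINT x:A|lborel. f x) + (LINT x:UNIV - A|lborel. f x)"
        by (rule set_integral_Un) (use A si in auto)
      then show ?case using U compl by simp
    next
      case (union F)
      then have F: "\<And>i. F i \<in> sets borel" by (simp add: borel_eq_box subset_eq)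
      have "(LINT x:(\<Union>i. F i)|lborel. f x) = (\<Sum>i. (LINT x:(F i)|lborel. f x))"
        by (rule lebesgue_integral_countable_add)
          (use F si union in \<open>auto simp: disjoint_family_on_def intro!: si sets.countable_UN\<close>)
      then show ?case using union by simp
    qed
  qed
  then show ?thesis
    by (intro density_unique_real[OF f integrable_zero]) (auto simp: set_lebesgue_integral_def)
qed

text \<open>A smooth approximation of the indicator of the open box from inside: the supports stay
  in the closed box, and the limit as k grows is the indicator.\<close>

definition box_bump :: "real^'n \<Rightarrow> real^'n \<Rightarrow> nat \<Rightarrow> real^'n \<Rightarrow> real" where
  "box_bump a b k x = (\<Prod>i\<in>UNIV. smooth_step (real k * (x $ i - a $ i)) * smooth_step (real k * (b $ i - x $ i)))"

lemma test_fun_box_bump: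
  assumes "cbox a b \<subseteq> U" shows "test_fun U (box_bump a b k)"
proof (rule test_funI[of _ "cbox a b"])
  have s: "smooth_fun (\<lambda>x::real^'a. smooth_step (real k * (x $ i - a $ i)))"
    "smooth_fun (\<lambda>x::real^'a. smooth_step (real k * (b $ i - x $ i)))" for i
    using smooth_fun_smooth_step[OF smooth_fun_affine[of "real k *\<^sub>R axis i 1" "- real k * a $ i"]]
      smooth_fun_smooth_step[OF smooth_fun_affine[of "- real k *\<^sub>R axis i 1" "real k * b $ i"]]
    by (simp_all add: inner_axis algebra_simps)
  show "smooth_fun (box_bump a b k)"
    unfolding box_bump_def[abs_def] by (intro smooth_fun_prod smooth_fun_mult s)
  fix x assume "x \<notin> cbox a b"
  then obtain i where "x $ i < a $ i \<or> b $ i < x $ i" by (auto simp: mem_box_cart not_le)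
  then have "real k * (x $ i - a $ i) \<le> 0 \<or> real k * (b $ i - x $ i) \<le> 0"
    by (auto intro!: mult_nonneg_nonpos)
  then show "box_bump a b k x = 0"
    unfolding box_bump_def using smooth_step_le0 by (intro prod_zero) fastforce+
qed (use assms in auto)

lemma box_bump_bounds: "0 \<le> box_bump a b k x" "box_bump a b k x \<le> 1"
  unfolding box_bump_def
  by (auto intro!: prod_nonneg prod_le_1 mult_nonneg_nonneg mult_le_one simp: smooth_step_bounds)

lemma box_bump_tendsto: "(\<lambda>k. box_bump a b k x) \<longlonglongrightarrow> indicator (box a b) x"
proof (cases "x \<in> box a b")
  case True
  have s: "(\<lambda>k. smooth_step (real k * t)) \<longlonglongrightarrow> 1" if "0 < t" for t
  proof (rule tendsto_eventually)
    have "\<forall>\<^sub>F k in sequentially. 1 / t \<le> real k"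
      by (rule eventually_ge_at_top[THEN filterlim_real_sequentially[unfolded filterlim_iff, rule_format]])
    then show "\<forall>\<^sub>F k in sequentially. smooth_step (real k * t) = 1"
      by eventually_elim (use that in \<open>auto intro!: smooth_step_ge1 simp: field_simps\<close>)
  qed
  have "(\<lambda>k. box_bump a b k x) \<longlonglongrightarrow> (\<Prod>i\<in>(UNIV :: 'a set). 1 * 1)"
    unfolding box_bump_def using True by (intro tendsto_prod tendsto_mult s) (auto simp: mem_box_cart)
  then show ?thesis using True by simp
next
  case False
  then obtain i where "x $ i \<le> a $ i \<or> b $ i \<le> x $ i" by (auto simp: mem_box_cart not_less)
  then have "real k * (x $ i - a $ i) \<le> 0 \<or> real k * (b $ i - x $ i) \<le> 0" for k
    by (auto intro!: mult_nonneg_nonpos)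
  then have "box_bump a b k x = 0" for k
    unfolding box_bump_def using smooth_step_le0 by (intro prod_zero) fastforce+
  then show ?thesis using False by simp
qed

text \<open>Testing with \<open>box_bump\<close> and passing to the limit gives zero integrals over
  all open boxes whose closed box lies in U. The criterion for boxes then applies locally, and
  countably many closed boxes cover U.\<close>

lemma fundamental_lemma_calculus_of_variations:
  fixes h :: "real^'n \<Rightarrow> real"
  assumes U: "open U" and h: "set_integrable lebesgue U h"
    and 0: "\<And>\<psi>. test_fun U \<psi> \<Longrightarrow> (LINT x:U|lebesgue. h x * \<psi> x) = 0"
  shows "AE x in lebesgue. x \<in> U \<longrightarrow> h x = 0"
proof -
  have box0: "(LINT x:box a b|lebesgue. h x) = 0" if ab: "cbox a b \<subseteq> U" for a b
  proof -
    have "(\<lambda>k. \<integral>x. indicator U x *\<^sub>R (h x * box_bump a b k x) \<partial>lebesgue) \<longlonglongrightarrow> (\<integral>x. indicator (box a b) x *\<^sub>R h x \<partial>lebesgue)"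
    proof (rule integral_dominated_convergence[where w = "\<lambda>x. norm (indicator U x *\<^sub>R h x)"])
      have m: "(\<lambda>x. indicator U x *\<^sub>R h x) \<in> borel_measurable lebesgue"
        using h by (simp add: set_integrable_def borel_measurable_integrable)
      show "integrable lebesgue (\<lambda>x. norm (indicator U x *\<^sub>R h x))"
        using h unfolding set_integrable_def by (rule integrable_norm)
      have "(\<lambda>x. indicator (box a b) x *\<^sub>R (indicator U x *\<^sub>R h x)) \<in> borel_measurable lebesgue"
        using m by (rule borel_measurable_scaleR[OF borel_measurable_indicator, rotated]) auto
      moreover have "(\<lambda>x. indicator (box a b) x *\<^sub>R (indicator U x *\<^sub>R h x)) = (\<lambda>x. indicator (box a b) x *\<^sub>R h x)"
        using ab box_subset_cbox[of a b] by (auto simp: fun_eq_iff indicator_def)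
      ultimately show "(\<lambda>x. indicator (box a b) x *\<^sub>R h x) \<in> borel_measurable lebesgue" by simp
      have "box_bump a b k \<in> borel_measurable lebesgue" for k
        using borel_measurable_continuous_onI[OF smooth_fun_continuous[OF test_fun_smooth[OF test_fun_box_bump[OF subset_refl]]]]
        by (intro measurable_completion) simp
      then show "(\<lambda>x. indicator U x *\<^sub>R (h x * box_bump a b k x)) \<in> borel_measurable lebesgue" for k
        using borel_measurable_times[OF m] by (simp add: mult.assoc)
      show "AE x in lebesgue. (\<lambda>k. indicator U x *\<^sub>R (h x * box_bump a b k x)) \<longlonglongrightarrow> indicator (box a b) x *\<^sub>R h x"
      proof (intro AE_I2)
        fix x
        have lim: "(\<lambda>k. indicator U x *\<^sub>R (h x * box_bump a b k x)) \<longlonglongrightarrow> indicator U x *\<^sub>R (h x * indicator (box a b) x)"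
          by (intro tendsto_intros box_bump_tendsto)
        have eq: "indicator U x *\<^sub>R (h x * indicator (box a b) x) = indicator (box a b) x *\<^sub>R h x"
          using ab box_subset_cbox[of a b] by (auto simp: indicator_def)
        show "(\<lambda>k. indicator U x *\<^sub>R (h x * box_bump a b k x)) \<longlonglongrightarrow> indicator (box a b) x *\<^sub>R h x"
          using lim unfolding eq .
      qed
      show "AE x in lebesgue. norm (indicator U x *\<^sub>R (h x * box_bump a b k x)) \<le> norm (indicator U x *\<^sub>R h x)" for k
        using box_bump_bounds[of a b k] by (auto simp: abs_mult indicator_def mult_left_le)
    qed
    moreover have "(\<integral>x. indicator U x *\<^sub>R (h x * box_bump a b k x) \<partial>lebesgue) = 0" for k
      using 0[OF test_fun_box_bump[OF ab]] by (simp add: set_lebesgue_integral_def)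
    ultimately show ?thesis by (simp add: set_lebesgue_integral_def LIMSEQ_const_iff)
  qed
  have cbox0: "AE x in lebesgue. x \<in> box c d \<longrightarrow> h x = 0" if cd: "cbox c d \<subseteq> U" for c d
  proof -
    let ?f = "\<lambda>x. indicator (box c d) x *\<^sub>R h x"
    have int: "integrable lebesgue ?f"
      using set_integrable_subset[OF h, of "box c d"] cd box_subset_cbox[of c d]
      unfolding set_integrable_def by force
    \<comment> \<open>The criterion for boxes concerns \<open>lborel\<close>, so h restricted to the
      box is exchanged for an almost everywhere equal Borel function.\<close>
    then obtain f' where f': "f' \<in> borel_measurable lborel" "AE x in lborel. ?f x = f' x"
      using completion_ex_borel_measurable_real[of ?f lborel] borel_measurable_integrable by blast
    have ae: "AE x in lebesgue. ?f x = f' x" using f'(2) by (rule AE_completion)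
    have int': "integrable lborel f'"
      using integrable_cong_AE_imp[OF int _ ae] f'(1)
      by (metis integrable_completion measurable_completion)
    have "AE x in lborel. f' x = 0"
    proof (rule AE_eq_0_of_box_integrals[OF int'])
      fix a b
      have "(LINT x:box a b|lborel. f' x) = (LINT x:box a b|lebesgue. f' x)"
        unfolding set_lebesgue_integral_def using f'(1) by (intro integral_completion[symmetric]) auto
      also have "\<dots> = (LINT x:box a b|lebesgue. ?f x)"
        unfolding set_lebesgue_integral_def
      proof (rule integral_cong_AE)
        show "(\<lambda>x. indicator (box a b) x *\<^sub>R f' x) \<in> borel_measurable lebesgue"
          using f'(1) by (intro measurable_completion) auto
        show "(\<lambda>x. indicator (box a b) x *\<^sub>R ?f x) \<in> borel_measurable lebesgue"
          using borel_measurable_integrable[OF int] by (rule borel_measurable_scaleR[OF borel_measurable_indicator, rotated]) auto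
        show "AE x in lebesgue. indicator (box a b) x *\<^sub>R f' x = indicator (box a b) x *\<^sub>R ?f x"
          using ae by eventually_elim simp
      qed
      also have "\<dots> = (LINT x:box a b \<inter> box c d|lebesgue. h x)"
        by (simp add: set_lebesgue_integral_def indicator_inter_arith mult.assoc)
      also have "\<dots> = 0"
      proof (cases "box a b \<inter> box c d = {}")
        case True then show ?thesis by (simp add: set_lebesgue_integral_def)
      next
        case False
        \<comment> \<open>Two open boxes meet in an open box. If it is nonempty, its closure lies in
          \<open>cbox c d\<close> and hence in U, so \<open>box0\<close> applies.\<close>
        obtain p q where pq: "box a b \<inter> box c d = box p q"
          by (simp add: box_Int_box)
        then have "box p q \<subseteq> box c d" "box p q \<noteq> {}" using False by auto
        then have "cbox p q \<subseteq> cbox c d"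
          by (metis closure_box closure_mono box_eq_empty(1) closure_empty closure_closure bot.extremum_unique subset_empty)
        then show ?thesis using box0[of p q] cd pq by auto
      qed
      finally show "(LINT x:box a b|lborel. f' x) = 0" .
    qed
    then have "AE x in lebesgue. f' x = 0" by (rule AE_completion)
    with ae show ?thesis by eventually_elim (auto simp: indicator_def)
  qed
  obtain D where D: "countable D" "D \<subseteq> Pow U" "\<And>X. X \<in> D \<Longrightarrow> \<exists>a b. X = cbox a b" "\<Union>D = U"
    using open_countable_Union_open_cbox[OF U] by metis
  have "AE x in lebesgue. \<forall>X\<in>D. x \<in> X \<longrightarrow> h x = 0"
  proof (subst AE_ball_countable[OF D(1)], intro ballI)
    fix X assume "X \<in> D"
    then obtain a b where X: "X = cbox a b" "cbox a b \<subseteq> U" using D by blast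
    \<comment> \<open>The cover of U consists of closed boxes, whereas \<open>cbox0\<close> reaches
      only their interiors; the boundaries are negligible.\<close>
    have "cbox a b - box a b \<in> null_sets lebesgue"
      using negligible_frontier_interval by (simp add: negligible_iff_null_sets)
    then have "AE x in lebesgue. x \<notin> cbox a b - box a b" by (rule AE_not_in)
    with cbox0[OF X(2)] show "AE x in lebesgue. x \<in> X \<longrightarrow> h x = 0"
      unfolding X(1) by eventually_elim auto
  qed
  then show ?thesis by eventually_elim (use D(4) in blast)
qed

section \<open>Square integrable functions\<close>

lemma L2_measurable: "L2 U u \<Longrightarrow> (\<lambda>x. indicator U x *\<^sub>R u x) \<in> borel_measurable lebesgue"
  by (simp add: L2_def set_borel_measurable_def)

lemma L2_integrable_square: "L2 U u \<Longrightarrow> integrable lebesgue (\<lambda>x. indicator U x *\<^sub>R (u x)\<^sup>2)"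
  by (simp add: L2_def set_integrable_def)

lemma L2_mult_integrable:
  assumes "L2 U u" "L2 U v" shows "set_integrable lebesgue U (\<lambda>x. u x * v x)"
  unfolding set_integrable_def
proof (rule Bochner_Integration.integrable_bound)
  show "integrable lebesgue (\<lambda>x. indicator U x *\<^sub>R (u x)\<^sup>2 + indicator U x *\<^sub>R (v x)\<^sup>2)"
    by (intro Bochner_Integration.integrable_add L2_integrable_square assms)
  have "(\<lambda>x. (indicator U x *\<^sub>R u x) * (indicator U x *\<^sub>R v x)) \<in> borel_measurable lebesgue"
    by (intro borel_measurable_times L2_measurable assms)
  moreover have "(\<lambda>x. (indicator U x *\<^sub>R u x) * (indicator U x *\<^sub>R v x)) = (\<lambda>x. indicator U x *\<^sub>R (u x * v x))"
    by (auto simp: fun_eq_iff indicator_def)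
  ultimately show "(\<lambda>x. indicator U x *\<^sub>R (u x * v x)) \<in> borel_measurable lebesgue" by simp
  have "\<bar>a * b\<bar> \<le> a\<^sup>2 + b\<^sup>2" for a b :: real
  proof -
    have "2 * (\<bar>a\<bar> * \<bar>b\<bar>) \<le> a\<^sup>2 + b\<^sup>2"
      using sum_squares_bound[of "\<bar>a\<bar>" "\<bar>b\<bar>"] by simp
    moreover have "0 \<le> \<bar>a\<bar> * \<bar>b\<bar>" by simp
    ultimately show ?thesis unfolding abs_mult by linarith
  qed
  then show "AE x in lebesgue. norm (indicator U x *\<^sub>R (u x * v x)) \<le> norm (indicator U x *\<^sub>R (u x)\<^sup>2 + indicator U x *\<^sub>R (v x)\<^sup>2)"
    by (auto simp: indicator_def)
qed

lemma L2_linear: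
  assumes "L2 U u" "L2 U v" shows "L2 U (\<lambda>x. a * u x + b * v x)"
proof -
  have "(\<lambda>x. a * (indicator U x *\<^sub>R u x) + b * (indicator U x *\<^sub>R v x)) \<in> borel_measurable lebesgue"
    by (intro borel_measurable_add borel_measurable_times borel_measurable_const L2_measurable assms)
  moreover have "(\<lambda>x. a * (indicator U x *\<^sub>R u x) + b * (indicator U x *\<^sub>R v x)) = (\<lambda>x. indicator U x *\<^sub>R (a * u x + b * v x))"
    by (auto simp: fun_eq_iff indicator_def)
  moreover have "integrable lebesgue (\<lambda>x. a\<^sup>2 * (indicator U x *\<^sub>R (u x)\<^sup>2) + 2 * a * b * (indicator U x *\<^sub>R (u x * v x)) + b\<^sup>2 * (indicator U x *\<^sub>R (v x)\<^sup>2))"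
    by (intro Bochner_Integration.integrable_add integrable_mult_right L2_integrable_square assms
        L2_mult_integrable[OF assms, unfolded set_integrable_def])
  moreover have "(\<lambda>x. a\<^sup>2 * (indicator U x *\<^sub>R (u x)\<^sup>2) + 2 * a * b * (indicator U x *\<^sub>R (u x * v x)) + b\<^sup>2 * (indicator U x *\<^sub>R (v x)\<^sup>2))
    = (\<lambda>x. indicator U x *\<^sub>R (a * u x + b * v x)\<^sup>2)"
    by (auto simp: fun_eq_iff indicator_def power2_eq_square algebra_simps)
  ultimately show ?thesis
    by (simp add: L2_def set_borel_measurable_def set_integrable_def)
qed

lemma L2_add: "L2 U u \<Longrightarrow> L2 U v \<Longrightarrow> L2 U (\<lambda>x. u x + v x)"
  using L2_linear[of U u v 1 1] by simp

lemma L2_diff: "L2 U u \<Longrightarrow> L2 U v \<Longrightarrow> L2 U (\<lambda>x. u x - v x)"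
  using L2_linear[of U u v 1 "-1"] by simp

lemma L2_continuous:
  fixes f :: "real^'n \<Rightarrow> real"
  assumes U: "U \<in> sets lebesgue" "bounded U" and f: "continuous_on UNIV f"
  shows "L2 U f"
proof -
  have fm: "f \<in> borel_measurable lebesgue"
    by (intro measurable_completion) (simp add: borel_measurable_continuous_onI f)
  have sq: "(\<lambda>x. (f x)\<^sup>2) \<in> borel_measurable lebesgue" using fm by simp
  have "compact (f ` closure U)"
    using U(2) by (intro compact_continuous_image continuous_on_subset[OF f]) auto
  then obtain B where B: "\<And>y. y \<in> f ` closure U \<Longrightarrow> norm y \<le> B"
    using compact_imp_bounded bounded_iff by metis
  have B: "\<bar>f x\<bar> \<le> B" if "x \<in> U" for x
    using B[of "f x"] closure_subset that by auto
  have "integrable lebesgue (\<lambda>x. indicator U x *\<^sub>R (f x)\<^sup>2)"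
  proof (rule Bochner_Integration.integrable_bound)
    have "emeasure lebesgue U < \<infinity>"
      using fmeasurableD2[OF bounded_set_imp_lmeasurable[OF U(2,1)]] by (simp add: less_top)
    then show "integrable lebesgue (\<lambda>x. B\<^sup>2 * indicator U x)"
      using U by (intro integrable_mult_right integrable_real_indicator)
    show "(\<lambda>x. indicator U x *\<^sub>R (f x)\<^sup>2) \<in> borel_measurable lebesgue"
      using sq U(1) by (rule borel_measurable_scaleR[OF borel_measurable_indicator, rotated])
    show "AE x in lebesgue. norm (indicator U x *\<^sub>R (f x)\<^sup>2) \<le> norm (B\<^sup>2 * indicator U x)"
      using B by (auto simp: indicator_def abs_le_square_iff[symmetric] intro!: order_trans[OF _ abs_ge_self])
  qed
  moreover have "(\<lambda>x. indicator U x *\<^sub>R f x) \<in> borel_measurable lebesgue"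
    using fm U(1) by (rule borel_measurable_scaleR[OF borel_measurable_indicator, rotated])
  ultimately show ?thesis
    by (simp add: L2_def set_borel_measurable_def set_integrable_def)
qed

lemma L2_set_integrable:
  assumes "U \<in> sets lebesgue" "bounded U" "L2 U u" shows "set_integrable lebesgue U u"
  using L2_mult_integrable[OF assms(3) L2_continuous[OF assms(1,2) continuous_on_const[of _ 1]]] by simp

text \<open>A weighted Young inequality takes the place of Cauchy-Schwarz: the integral is at most
  a_k/t + t G, where G is the squared norm of g. First t is made small, then k large.\<close>

lemma L2_tendsto_mult:
  assumes f: "\<And>k. L2 U (f k)" and g: "L2 U g"
    and lim: "(\<lambda>k. LINT x:U|lebesgue. (f k x)\<^sup>2) \<longlonglongrightarrow> 0"
  shows "(\<lambda>k. LINT x:U|lebesgue. f k x * g x) \<longlonglongrightarrow> 0"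
proof -
  define G where "G = (LINT x:U|lebesgue. (g x)\<^sup>2)"
  define a where "a k = (LINT x:U|lebesgue. (f k x)\<^sup>2)" for k
  have G: "0 \<le> G" unfolding G_def set_lebesgue_integral_def by (rule Bochner_Integration.integral_nonneg) simp
  have est: "\<bar>LINT x:U|lebesgue. f k x * g x\<bar> \<le> a k / t + t * G" if t: "0 < t" for k t
  proof -
    have "norm (LINT x:U|lebesgue. f k x * g x) \<le> (\<integral>x. inverse t * (indicator U x *\<^sub>R (f k x)\<^sup>2) + t * (indicator U x *\<^sub>R (g x)\<^sup>2) \<partial>lebesgue)"
      unfolding set_lebesgue_integral_def
    proof (rule Bochner_Integration.integral_norm_bound_integral)
      show "integrable lebesgue (\<lambda>x. indicator U x *\<^sub>R (f k x * g x))"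
        using L2_mult_integrable[OF f g] by (simp add: set_integrable_def)
      show "integrable lebesgue (\<lambda>x. inverse t * (indicator U x *\<^sub>R (f k x)\<^sup>2) + t * (indicator U x *\<^sub>R (g x)\<^sup>2))"
        by (intro Bochner_Integration.integrable_add integrable_mult_right L2_integrable_square f g)
      fix x
      have "2 * (\<bar>f k x\<bar> * (t * \<bar>g x\<bar>)) \<le> \<bar>f k x\<bar>\<^sup>2 + (t * \<bar>g x\<bar>)\<^sup>2"
        using sum_squares_bound[of "\<bar>f k x\<bar>" "t * \<bar>g x\<bar>"] by (simp add: mult.assoc)
      moreover have "0 \<le> \<bar>f k x\<bar> * (t * \<bar>g x\<bar>)" using t by simp
      ultimately have "\<bar>f k x\<bar> * (t * \<bar>g x\<bar>) \<le> (f k x)\<^sup>2 + (t * g x)\<^sup>2"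
        by (simp add: power_mult_distrib)
      then have "\<bar>f k x * g x\<bar> \<le> inverse t * (f k x)\<^sup>2 + t * (g x)\<^sup>2"
        using t by (simp add: field_simps abs_mult power2_eq_square)
      then show "norm (indicator U x *\<^sub>R (f k x * g x)) \<le> inverse t * (indicator U x *\<^sub>R (f k x)\<^sup>2) + t * (indicator U x *\<^sub>R (g x)\<^sup>2)"
        by (simp add: indicator_def)
    qed
    also have "\<dots> = a k / t + t * G"
      unfolding a_def G_def set_lebesgue_integral_def
      by (subst Bochner_Integration.integral_add) (use L2_integrable_square[OF f, of k] L2_integrable_square[OF g] in \<open>auto simp: divide_inverse mult.commute\<close>)
    finally show ?thesis by simp
  qed
  show ?thesis
  proof (rule LIMSEQ_I)
    fix e :: real assume e: "0 < e"
    \<comment> \<open>The summand 1 keeps t well defined and t G below e/2 also when G = 0.\<close>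
    define t where "t = e / (2 * (G + 1))"
    have t: "0 < t" and tG: "t * G < e / 2"
      using e G by (auto simp: t_def field_simps)
    have "(\<lambda>k. a k / t) \<longlonglongrightarrow> 0 / t"
      using lim t unfolding a_def by (intro tendsto_intros) auto
    then have "\<forall>\<^sub>F k in sequentially. a k / t < e / 2"
      using e by (intro order_tendstoD) auto
    then obtain N where N: "\<And>k. N \<le> k \<Longrightarrow> a k / t < e / 2"
      unfolding eventually_sequentially by blast
    have "norm ((LINT x:U|lebesgue. f k x * g x) - 0) < e" if "N \<le> k" for k
      using est[OF t, of k] N[OF that] tG unfolding diff_0_right real_norm_def by linarith
    then show "\<exists>N. \<forall>k\<ge>N. norm ((LINT x:U|lebesgue. f k x * g x) - 0) < e" by blast
  qed
qed

text \<open>\<open>Dw\<close> is a choice among almost everywhere equal gradients and does not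
  compute. Sums, limits and translates are handled with this relation, and \<open>Dw\<close> is
  reached at the end through uniqueness.\<close>

definition has_wgrad :: "(real^'n) set \<Rightarrow> (real^'n \<Rightarrow> real) \<Rightarrow> (real^'n \<Rightarrow> real^'n) \<Rightarrow> bool" where
  "has_wgrad U u g \<longleftrightarrow> L2 U u \<and> weak_grad U u g \<and> (\<forall>i. L2 U (\<lambda>x. g x $ i))"

lemma H1_iff: "u \<in> H1 U \<longleftrightarrow> (\<exists>g. has_wgrad U u g)"
  by (auto simp: H1_def has_wgrad_def)

lemma has_wgrad_Dw:
  assumes "u \<in> H1 U" shows "has_wgrad U u (Dw U u)"
proof -
  have "\<exists>g. weak_grad U u g \<and> (\<forall>i. L2 U (\<lambda>x. g x $ i))" using assms by (auto simp: H1_def)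
  from someI_ex[OF this] show ?thesis
    using assms by (simp add: has_wgrad_def Dw_def H1_def)
qed

lemma test_fun_L2:
  assumes U: "U \<in> sets lebesgue" "bounded U" and "test_fun V \<psi>"
  shows "L2 U \<psi>" "L2 U (partial i \<psi>)"
  using smooth_fun_partial[OF test_fun_smooth[OF assms(3)]] test_fun_smooth[OF assms(3)]
  by (auto intro!: L2_continuous U smooth_fun_continuous)

text \<open>Each component of the difference is orthogonal to all test functions; boundedness of U
  makes it integrable, as the fundamental lemma asks.\<close>

lemma has_wgrad_unique:
  fixes U :: "(real^'n) set"
  assumes U: "open U" "bounded U" and g: "has_wgrad U u g" and h: "has_wgrad U u h"
  shows "AE x in lebesgue. x \<in> U \<longrightarrow> g x = h x"
proof -
  have Um: "U \<in> sets lebesgue" using U(1) by simp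
  have "AE x in lebesgue. x \<in> U \<longrightarrow> g x $ i - h x $ i = 0" for i
  proof (rule fundamental_lemma_calculus_of_variations[OF U(1)])
    have gi: "L2 U (\<lambda>x. g x $ i)" and hi: "L2 U (\<lambda>x. h x $ i)"
      using g h by (auto simp: has_wgrad_def)
    show "set_integrable lebesgue U (\<lambda>x. g x $ i - h x $ i)"
      by (rule L2_set_integrable[OF Um U(2) L2_diff[OF gi hi]])
    fix \<psi> assume t: "test_fun U \<psi>"
    have "set_integrable lebesgue U (\<lambda>x. g x $ i * \<psi> x)" "set_integrable lebesgue U (\<lambda>x. h x $ i * \<psi> x)"
      by (rule L2_mult_integrable[OF _ test_fun_L2(1)[OF Um U(2) t]], fact)+
    then have "(LINT x:U|lebesgue. g x $ i * \<psi> x - h x $ i * \<psi> x) = (LINT x:U|lebesgue. g x $ i * \<psi> x) - (LINT x:U|lebesgue. h x $ i * \<psi> x)"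
      by (rule set_integral_diff)
    also have "\<dots> = 0"
      using g h t by (simp add: has_wgrad_def weak_grad_def)
    finally show "(LINT x:U|lebesgue. (g x $ i - h x $ i) * \<psi> x) = 0"
      by (simp add: left_diff_distrib)
  qed
  then have "AE x in lebesgue. \<forall>i\<in>UNIV. x \<in> U \<longrightarrow> g x $ i - h x $ i = 0"
    by (subst AE_ball_countable) auto
  then show ?thesis by eventually_elim (auto simp: vec_eq_iff)
qed

lemma Dw_AE_eq:
  assumes "open U" "bounded U" "has_wgrad U u g"
  shows "AE x in lebesgue. x \<in> U \<longrightarrow> Dw U u x = g x"
  by (rule has_wgrad_unique[OF assms(1,2) has_wgrad_Dw assms(3)]) (use assms in \<open>auto simp: H1_iff\<close>)

lemma has_wgrad_add:
  assumes U: "U \<in> sets lebesgue" "bounded U" and u: "has_wgrad U u g" and v: "has_wgrad U v h"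
  shows "has_wgrad U (\<lambda>x. u x + v x) (\<lambda>x. g x + h x)"
  unfolding has_wgrad_def
proof (intro conjI allI)
  have L: "L2 U u" "L2 U v" "L2 U (\<lambda>x. g x $ i)" "L2 U (\<lambda>x. h x $ i)" for i
    using u v by (auto simp: has_wgrad_def)
  show "L2 U (\<lambda>x. u x + v x)" "L2 U (\<lambda>x. (g x + h x) $ i)" for i
    using L by (auto intro: L2_add)
  show "weak_grad U (\<lambda>x. u x + v x) (\<lambda>x. g x + h x)"
    unfolding weak_grad_def
  proof (intro allI impI)
    fix \<psi> i assume t: "test_fun U \<psi>"
    note T = test_fun_L2[OF U t]
    have "(LINT x:U|lebesgue. (u x + v x) * partial i \<psi> x) = (LINT x:U|lebesgue. u x * partial i \<psi> x) + (LINT x:U|lebesgue. v x * partial i \<psi> x)"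
      unfolding distrib_right by (rule set_integral_add) (auto intro!: L2_mult_integrable L T)
    also have "\<dots> = - (LINT x:U|lebesgue. g x $ i * \<psi> x) - (LINT x:U|lebesgue. h x $ i * \<psi> x)"
      using u v t by (simp add: has_wgrad_def weak_grad_def)
    also have "\<dots> = - (LINT x:U|lebesgue. (g x + h x) $ i * \<psi> x)"
      unfolding vector_add_component distrib_right
      by (subst set_integral_add) (auto intro!: L2_mult_integrable L T)
    finally show "(LINT x:U|lebesgue. (u x + v x) * partial i \<psi> x) = - (LINT x:U|lebesgue. (g x + h x) $ i * \<psi> x)" .
  qed
qed

lemma has_wgrad_smooth:
  assumes "U \<in> sets lebesgue" "bounded U" "smooth_fun w" shows "has_wgrad U w (grad w)"
  unfolding has_wgrad_def using assms
  by (auto intro!: L2_continuous weak_grad_smooth smooth_fun_continuous smooth_fun_partial)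

lemma L2_norm_square_integrable:
  fixes g :: "real^'n \<Rightarrow> real^'n"
  assumes "\<And>i. L2 U (\<lambda>x. g x $ i)"
  shows "set_integrable lebesgue U (\<lambda>x. (norm (g x))\<^sup>2)"
proof -
  have "integrable lebesgue (\<lambda>x. \<Sum>i\<in>UNIV. indicator U x *\<^sub>R (g x $ i)\<^sup>2)"
    by (intro Bochner_Integration.integrable_sum L2_integrable_square assms)
  moreover have "(\<lambda>x. \<Sum>i\<in>UNIV. indicator U x *\<^sub>R (g x $ i)\<^sup>2) = (\<lambda>x. indicator U x *\<^sub>R (norm (g x))\<^sup>2)"
    by (simp add: norm_vec_def L2_set_def sum_nonneg sum_distrib_left)
  ultimately show ?thesis by (simp add: set_integrable_def)
qed

text \<open>Both sides of the integration by parts formula are continuous under L2 convergence. This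
  closedness is what turns limits of test functions into weakly differentiable functions on a larger
  set.\<close>

lemma has_wgrad_limit:
  fixes U :: "(real^'n) set"
  assumes U: "U \<in> sets lebesgue" "bounded U" and f: "\<And>k::nat. has_wgrad U (f k) (F k)"
    and v: "L2 U v" and g: "\<And>i. L2 U (\<lambda>x. g x $ i)"
    and l1: "(\<lambda>k. LINT x:U|lebesgue. (f k x - v x)\<^sup>2) \<longlonglongrightarrow> 0"
    and l2: "(\<lambda>k. LINT x:U|lebesgue. (norm (F k x - g x))\<^sup>2) \<longlonglongrightarrow> 0"
  shows "has_wgrad U v g"
  unfolding has_wgrad_def
proof (intro conjI allI v g)
  have fL: "L2 U (f k)" and FL: "L2 U (\<lambda>x. F k x $ i)" for k i
    using f by (auto simp: has_wgrad_def)
  show "weak_grad U v g"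
    unfolding weak_grad_def
  proof (intro allI impI)
    fix \<psi> i assume t: "test_fun U \<psi>"
    note T = test_fun_L2[OF U t]
    have "(\<lambda>k. LINT x:U|lebesgue. (f k x - v x) * partial i \<psi> x) \<longlonglongrightarrow> 0"
      by (rule L2_tendsto_mult[OF _ T(2) l1]) (intro L2_diff fL v)
    moreover have "(LINT x:U|lebesgue. (f k x - v x) * partial i \<psi> x) = (LINT x:U|lebesgue. f k x * partial i \<psi> x) - (LINT x:U|lebesgue. v x * partial i \<psi> x)" for k
      unfolding left_diff_distrib by (rule set_integral_diff) (auto intro!: L2_mult_integrable fL v T)
    ultimately have 1: "(\<lambda>k. LINT x:U|lebesgue. f k x * partial i \<psi> x) \<longlonglongrightarrow> (LINT x:U|lebesgue. v x * partial i \<psi> x)"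
      by (simp add: LIM_zero_cancel)
    have "(\<lambda>k. LINT x:U|lebesgue. (F k x $ i - g x $ i)\<^sup>2) \<longlonglongrightarrow> 0"
    proof (rule tendsto_sandwich[OF _ _ tendsto_const l2])
      show "\<forall>\<^sub>F k in sequentially. 0 \<le> (LINT x:U|lebesgue. (F k x $ i - g x $ i)\<^sup>2)"
        unfolding set_lebesgue_integral_def by (intro always_eventually allI Bochner_Integration.integral_nonneg) simp
      have "(LINT x:U|lebesgue. (F k x $ i - g x $ i)\<^sup>2) \<le> (LINT x:U|lebesgue. (norm (F k x - g x))\<^sup>2)" for k
      proof (rule set_integral_mono)
        show "set_integrable lebesgue U (\<lambda>x. (F k x $ i - g x $ i)\<^sup>2)"
          using L2_diff[OF FL g] by (simp add: L2_def)
        show "set_integrable lebesgue U (\<lambda>x. (norm (F k x - g x))\<^sup>2)"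
          by (rule L2_norm_square_integrable) (simp add: L2_diff FL g)
        fix x
        have "\<bar>(F k x - g x) $ i\<bar> \<le> norm (F k x - g x)" by (rule component_le_norm_cart)
        then have "((F k x - g x) $ i)\<^sup>2 \<le> (norm (F k x - g x))\<^sup>2"
          by (simp add: abs_le_square_iff[symmetric])
        then show "(F k x $ i - g x $ i)\<^sup>2 \<le> (norm (F k x - g x))\<^sup>2" by simp
      qed
      then show "\<forall>\<^sub>F k in sequentially. (LINT x:U|lebesgue. (F k x $ i - g x $ i)\<^sup>2) \<le> (LINT x:U|lebesgue. (norm (F k x - g x))\<^sup>2)"
        by simp
    qed
    then have "(\<lambda>k. LINT x:U|lebesgue. (F k x $ i - g x $ i) * \<psi> x) \<longlonglongrightarrow> 0"
      by (rule L2_tendsto_mult[OF _ T(1), rotated]) (intro L2_diff FL g)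
    moreover have "(LINT x:U|lebesgue. (F k x $ i - g x $ i) * \<psi> x) = (LINT x:U|lebesgue. F k x $ i * \<psi> x) - (LINT x:U|lebesgue. g x $ i * \<psi> x)" for k
      unfolding left_diff_distrib by (rule set_integral_diff) (auto intro!: L2_mult_integrable FL g T)
    ultimately have "(\<lambda>k. LINT x:U|lebesgue. F k x $ i * \<psi> x) \<longlonglongrightarrow> (LINT x:U|lebesgue. g x $ i * \<psi> x)"
      by (simp add: LIM_zero_cancel)
    then have "(\<lambda>k. - (LINT x:U|lebesgue. F k x $ i * \<psi> x)) \<longlonglongrightarrow> - (LINT x:U|lebesgue. g x $ i * \<psi> x)"
      by (rule tendsto_minus)
    moreover have "- (LINT x:U|lebesgue. F k x $ i * \<psi> x) = (LINT x:U|lebesgue. f k x * partial i \<psi> x)" for k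
      using f[of k] t by (simp add: has_wgrad_def weak_grad_def)
    ultimately show "(LINT x:U|lebesgue. v x * partial i \<psi> x) = - (LINT x:U|lebesgue. g x $ i * \<psi> x)"
      using 1 LIMSEQ_unique by simp
  qed
qed

section \<open>Cylinders\<close>

lemma lborel_nn_integral_translate:
  fixes c :: "'a::euclidean_space"
  assumes "f \<in> borel_measurable borel"
  shows "(\<integral>\<^sup>+x. f (c + x) \<partial>lborel) = (\<integral>\<^sup>+x. f x \<partial>lborel)"
proof -
  have "(\<integral>\<^sup>+x. f x \<partial>distr lborel borel ((+) c)) = (\<integral>\<^sup>+x. f (c + x) \<partial>lborel)"
    by (rule nn_integral_distr) (use assms in auto)
  then show ?thesis by (simp add: lborel_distr_plus)
qed

text \<open>The image measure is translation invariant. Comparing it with Lebesgue measure through Fubini, against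
  the indicator of a ball, shows that the two are proportional, and they agree on balls.\<close>

lemma lborel_isometry:
  fixes L :: "'a::euclidean_space \<Rightarrow> 'b::euclidean_space"
  assumes lin: "linear L" and iso: "\<And>x. norm (L x) = norm x" and onto: "range L = UNIV"
  shows "distr lborel borel L = lborel"
proof (rule measure_eqI)
  have inj: "inj L"
    using iso linear_injective_0[OF lin] by (metis norm_eq_zero)
  have dim: "DIM('a) = DIM('b)"
    using dim_image_eq[OF lin, of UNIV] inj onto by simp
  have Lm [measurable]: "L \<in> borel_measurable borel"
    using linear_continuous_on[OF lin[unfolded linear_conv_bounded_linear]] by (rule borel_measurable_continuous_onI)
  fix B assume "B \<in> sets (distr lborel borel L)"
  then have B [measurable]: "B \<in> sets borel" by simp
  define c where "c = emeasure lborel (ball (0::'b) 1)"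
  \<comment> \<open>The volume of a unit ball depends on the dimension alone, which L preserves;
    being positive and finite, it can be cancelled at the end.\<close>
  have c: "c \<noteq> 0" "c \<noteq> \<top>" and ball: "emeasure lborel (ball (z::'a) 1) = c" for z
    unfolding c_def by (simp_all add: emeasure_ball dim ennreal_eq_0_iff not_le)
  let ?A = "ball (0::'b) 1"
  have [measurable]: "?A \<in> sets borel" by simp
  have "c * emeasure (distr lborel borel L) B = (\<integral>\<^sup>+x. indicator ?A x * (\<integral>\<^sup>+y. indicator B (L y) \<partial>lborel) \<partial>lborel)"
  proof -
    have "emeasure (distr lborel borel L) B = (\<integral>\<^sup>+x. indicator B x \<partial>distr lborel borel L)" by simp
    also have "\<dots> = (\<integral>\<^sup>+y. indicator B (L y) \<partial>lborel)" by (rule nn_integral_distr) auto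
    finally show ?thesis by (subst nn_integral_multc) (simp_all add: c_def borel_measurable_indicator)
  qed
  also have "\<dots> = (\<integral>\<^sup>+x. (\<integral>\<^sup>+y. indicator ?A x * indicator B (x + L y) \<partial>lborel) \<partial>lborel)"
  proof (rule nn_integral_cong)
    fix x :: 'b
    \<comment> \<open>Surjectivity turns the translation by x in the target into the translation by
      z in the source, where Lebesgue measure is invariant.\<close>
    obtain z where z: "x = L z" using onto by auto
    have "(\<integral>\<^sup>+y. indicator B (L y) \<partial>lborel) = (\<integral>\<^sup>+y. indicator B (L (z + y)) \<partial>lborel :: ennreal)"
      by (rule lborel_nn_integral_translate[symmetric]) measurable
    also have "\<dots> = (\<integral>\<^sup>+y. indicator B (x + L y) \<partial>lborel)"
      by (simp add: z linear_add[OF lin])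
    finally show "indicator ?A x * (\<integral>\<^sup>+y. indicator B (L y) \<partial>lborel) = (\<integral>\<^sup>+y. indicator ?A x * indicator B (x + L y) \<partial>lborel)"
      by (simp add: nn_integral_cmult)
  qed
  also have "\<dots> = (\<integral>\<^sup>+y. (\<integral>\<^sup>+x. indicator ?A x * indicator B (x + L y) \<partial>lborel) \<partial>lborel)"
    by (rule lborel_pair.Fubini') measurable
  also have "\<dots> = (\<integral>\<^sup>+y. (\<integral>\<^sup>+x. indicator ?A (x - L y) * indicator B x \<partial>lborel) \<partial>lborel)"
  proof (rule nn_integral_cong)
    fix y
    have "(\<integral>\<^sup>+x. indicator ?A (x - L y) * indicator B x \<partial>lborel) = (\<integral>\<^sup>+x. indicator ?A (L y + x - L y) * indicator B (L y + x) \<partial>lborel :: ennreal)"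
      by (rule lborel_nn_integral_translate[symmetric]) measurable
    then show "(\<integral>\<^sup>+x. indicator ?A x * indicator B (x + L y) \<partial>lborel) = (\<integral>\<^sup>+x. indicator ?A (x - L y) * indicator B x \<partial>lborel :: ennreal)"
      by (simp add: add.commute)
  qed
  also have "\<dots> = (\<integral>\<^sup>+x. (\<integral>\<^sup>+y. indicator ?A (x - L y) * indicator B x \<partial>lborel) \<partial>lborel)"
    by (rule lborel_pair.Fubini') measurable
  also have "\<dots> = (\<integral>\<^sup>+x. c * indicator B x \<partial>lborel)"
  proof (rule nn_integral_cong)
    fix x :: 'b
    obtain z where z: "x = L z" using onto by auto
    have "norm (x - L y) = dist z y" for y
      using iso[of "z - y"] by (simp add: z linear_diff[OF lin] dist_norm)
    then have "indicator ?A (x - L y) = (indicator (ball z 1) y :: ennreal)" for y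
      by (simp add: indicator_def)
    then show "(\<integral>\<^sup>+y. indicator ?A (x - L y) * indicator B x \<partial>lborel) = c * indicator B x"
      by (simp add: nn_integral_multc ball borel_measurable_indicator)
  qed
  also have "\<dots> = c * emeasure lborel B"
    by (simp add: nn_integral_cmult)
  finally show "emeasure (distr lborel borel L) B = emeasure lborel B"
    using c by (simp add: ennreal_mult_cancel_left)
qed simp

section \<open>One-dimensional plateaus\<close>

definition plateau :: "real \<Rightarrow> real \<Rightarrow> real \<Rightarrow> real" where
  "plateau \<kappa> a t = smooth_step (\<kappa> * (a - t) + 1) * smooth_step (\<kappa> * (a + t) + 1)"

lemma plateau_bounds: "0 \<le> plateau \<kappa> a t" "plateau \<kappa> a t \<le> 1"
  by (auto simp: plateau_def smooth_step_bounds intro!: mult_nonneg_nonneg mult_le_one)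

lemma plateau_eq_1: "0 < \<kappa> \<Longrightarrow> \<bar>t\<bar> \<le> a \<Longrightarrow> plateau \<kappa> a t = 1"
  by (simp add: plateau_def smooth_step_ge1)

lemma plateau_eq_0:
  assumes "0 < \<kappa>" "a + 1 / \<kappa> \<le> \<bar>t\<bar>" shows "plateau \<kappa> a t = 0"
proof -
  have "\<kappa> * (a - t) + 1 \<le> 0 \<or> \<kappa> * (a + t) + 1 \<le> 0"
    using assms by (cases "0 \<le> t") (auto simp: field_simps)
  then show ?thesis by (auto simp: plateau_def smooth_step_le0)
qed

lemma abs_mult_diff_le:
  fixes p q :: real
  assumes "\<bar>q\<bar> \<le> 1" "\<bar>p'\<bar> \<le> 1"
  shows "\<bar>p * q - p' * q'\<bar> \<le> \<bar>p - p'\<bar> + \<bar>q - q'\<bar>"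
proof -
  have "p * q - p' * q' = (p - p') * q + p' * (q - q')" by (simp add: algebra_simps)
  then have "\<bar>p * q - p' * q'\<bar> \<le> \<bar>p - p'\<bar> * \<bar>q\<bar> + \<bar>p'\<bar> * \<bar>q - q'\<bar>"
    by (metis abs_mult abs_triangle_ineq)
  also have "\<dots> \<le> \<bar>p - p'\<bar> * 1 + 1 * \<bar>q - q'\<bar>"
    by (intro add_mono mult_left_mono mult_right_mono assms) auto
  finally show ?thesis by simp
qed

lemma plateau_Lipschitz:
  assumes c: "\<And>s t. \<bar>smooth_step s - smooth_step t\<bar> \<le> c * \<bar>s - t\<bar>" and "0 < \<kappa>"
  shows "\<bar>plateau \<kappa> a s - plateau \<kappa> a t\<bar> \<le> 2 * c * \<kappa> * \<bar>s - t\<bar>"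
proof -
  have "\<bar>plateau \<kappa> a s - plateau \<kappa> a t\<bar> \<le> \<bar>smooth_step (\<kappa> * (a - s) + 1) - smooth_step (\<kappa> * (a - t) + 1)\<bar>
      + \<bar>smooth_step (\<kappa> * (a + s) + 1) - smooth_step (\<kappa> * (a + t) + 1)\<bar>"
    unfolding plateau_def by (rule abs_mult_diff_le) (auto simp: smooth_step_bounds abs_le_iff intro: order_trans[OF _ smooth_step_bounds(1)])
  also have "\<dots> \<le> c * \<bar>\<kappa> * (a - s) + 1 - (\<kappa> * (a - t) + 1)\<bar> + c * \<bar>\<kappa> * (a + s) + 1 - (\<kappa> * (a + t) + 1)\<bar>"
    by (intro add_mono c)
  also have "\<kappa> * (a - s) + 1 - (\<kappa> * (a - t) + 1) = \<kappa> * (t - s)" by (simp add: algebra_simps)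
  also have "\<kappa> * (a + s) + 1 - (\<kappa> * (a + t) + 1) = \<kappa> * (s - t)" by (simp add: algebra_simps)
  finally show ?thesis using \<open>0 < \<kappa>\<close> by (simp add: abs_mult abs_minus_commute[of t s] mult_ac)
qed

lemma smooth_fun_plateau: "smooth_fun (\<lambda>y::real^'n. plateau \<kappa> a (y \<bullet> v))"
proof -
  have "smooth_fun (\<lambda>y::real^'n. smooth_step (y \<bullet> (- \<kappa> *\<^sub>R v) + (\<kappa> * a + 1)) * smooth_step (y \<bullet> (\<kappa> *\<^sub>R v) + (\<kappa> * a + 1)))"
    by (rule smooth_fun_mult[OF smooth_fun_smooth_step[OF smooth_fun_affine] smooth_fun_smooth_step[OF smooth_fun_affine]])
  then show ?thesis by (simp add: plateau_def algebra_simps)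
qed

section \<open>Orthonormal frames and coordinate cylinders\<close>

locale frame =
  fixes T :: "real^'m \<Rightarrow> real^'n" and e :: "real^'n" and bs :: "'m \<Rightarrow> real^'m"
  assumes T_lin: "linear T" and T_iso: "\<And>a. norm (T a) = norm a"
    and T_onto: "range T = {x. x \<bullet> e = 0}"
    and bs_orth: "\<And>i j. bs i \<bullet> bs j = (if i = j then 1 else 0)"
    and e1: "norm e = 1"
begin

lemma T_inner: "T a \<bullet> T b = a \<bullet> b"
  using T_iso[of "a + b"] T_iso[of a] T_iso[of b] by (simp add: dot_norm linear_add[OF T_lin, symmetric])

lemma T_e [simp]: "T a \<bullet> e = 0"
  using T_onto by auto

lemma e_T [simp]: "e \<bullet> T a = 0"
  by (simp add: inner_commute[of e])

lemma e_e [simp]: "e \<bullet> e = 1"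
  using e1 by (simp add: dot_square_norm)

lemma frame_coords [simp]: "(T a + b *\<^sub>R e) \<bullet> e = b" "(T a + b *\<^sub>R e) \<bullet> T (bs i) = a \<bullet> bs i"
  by (simp_all add: inner_add_left T_inner)

lemma frame_decomp: obtains a where "y = T a + (y \<bullet> e) *\<^sub>R e"
proof -
  have "y - (y \<bullet> e) *\<^sub>R e \<in> range T"
    unfolding T_onto by (simp add: inner_diff_left)
  then show ?thesis using that by (metis add.commute diff_add_cancel imageE add_diff_cancel_left')
qed

lemma bs_norm: "norm (bs i) = 1"
  using bs_orth[of i i] by (simp add: norm_eq_1)

lemma bs_inj: "inj bs"
  using bs_orth by (intro injI) (metis zero_neq_one)

text \<open>An orthonormal family is independent, and by its cardinality it spans, so the
  orthonormal expansion is available.\<close>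

lemma bs_expand: "(\<Sum>i\<in>UNIV. (a \<bullet> bs i) *\<^sub>R bs i) = a"
proof -
  have orth: "pairwise orthogonal (range bs)"
    by (auto simp: pairwise_def orthogonal_def bs_orth)
  have "0 \<notin> range bs" using bs_norm by (metis imageE norm_zero zero_neq_one)
  then have "independent (range bs)" by (rule pairwise_orthogonal_independent[OF orth])
  moreover have "card (range bs) = DIM(real^'m)" by (simp add: card_image bs_inj)
  ultimately have "UNIV \<subseteq> span (range bs)"
    by (intro card_ge_dim_independent) auto
  then have "(\<Sum>v\<in>range bs. (a \<bullet> v) *\<^sub>R v) = a"
    by (intro orthonormal_basis_expand orth) (auto simp: bs_norm)
  then show ?thesis by (simp add: sum.reindex bs_inj)
qed

lemma norm_le_coords:
  assumes "\<And>i. \<bar>a \<bullet> bs i\<bar> \<le> r" shows "norm a \<le> real CARD('m) * r"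
proof -
  have "norm a = norm (\<Sum>i\<in>UNIV. (a \<bullet> bs i) *\<^sub>R bs i)" by (simp add: bs_expand)
  also have "\<dots> \<le> (\<Sum>i\<in>UNIV. \<bar>a \<bullet> bs i\<bar>)"
    by (rule order_trans[OF norm_sum]) (simp add: bs_norm)
  also have "\<dots> \<le> (\<Sum>i\<in>(UNIV :: 'm set). r)" by (intro sum_mono assms)
  finally show ?thesis by simp
qed

lemma inner_T_bs_le: "\<bar>z \<bullet> T (bs i)\<bar> \<le> norm z" and inner_e_le: "\<bar>z \<bullet> e\<bar> \<le> norm z"
  using Cauchy_Schwarz_ineq2[of z "T (bs i)"] Cauchy_Schwarz_ineq2[of z e] by (simp_all add: T_iso bs_norm e1)

text \<open>Coordinates of the ambient space are used instead of an image: openness, boundedness and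
  the effect of a translation become statements about finitely many inner products.\<close>

definition cyl :: "real \<Rightarrow> (real^'n) set" where
  "cyl R = {y. (\<forall>i. \<bar>y \<bullet> T (bs i)\<bar> < R / 2) \<and> \<bar>y \<bullet> e\<bar> < R}"

lemma cyl_eq: "cyl R = {T a + b *\<^sub>R e | a b. a \<in> cube bs 0 R \<and> b \<in> {-R<..<R}}"
proof (intro set_eqI iffI)
  fix y assume y: "y \<in> cyl R"
  obtain a where a: "y = T a + (y \<bullet> e) *\<^sub>R e" by (rule frame_decomp)
  have "a \<bullet> bs i = y \<bullet> T (bs i)" for i by (subst a) simp
  then have "a \<in> cube bs 0 R" "y \<bullet> e \<in> {-R<..<R}" using y by (auto simp: cyl_def cube_def abs_less_iff)
  then show "y \<in> {T a + b *\<^sub>R e | a b. a \<in> cube bs 0 R \<and> b \<in> {-R<..<R}}" using a by blast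
next
  fix y assume "y \<in> {T a + b *\<^sub>R e | a b. a \<in> cube bs 0 R \<and> b \<in> {-R<..<R}}"
  then show "y \<in> cyl R" by (auto simp: cyl_def cube_def abs_less_iff)
qed

lemma open_cyl: "open (cyl R)"
proof -
  have "cyl R = (\<Inter>i\<in>UNIV. {y. \<bar>y \<bullet> T (bs i)\<bar> < R / 2}) \<inter> {y. \<bar>y \<bullet> e\<bar> < R}"
    by (auto simp: cyl_def)
  then show ?thesis
    by (auto intro!: open_Int open_INT open_Collect_less continuous_intros)
qed

lemma bounded_coords:
  "bounded {y. (\<forall>i. \<bar>y \<bullet> T (bs i)\<bar> \<le> r) \<and> \<bar>y \<bullet> e\<bar> \<le> s}"
  unfolding bounded_iff
proof (intro exI ballI)
  fix y assume y: "y \<in> {y. (\<forall>i. \<bar>y \<bullet> T (bs i)\<bar> \<le> r) \<and> \<bar>y \<bullet> e\<bar> \<le> s}"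
  obtain a where a: "y = T a + (y \<bullet> e) *\<^sub>R e" by (rule frame_decomp)
  have ai: "a \<bullet> bs i = y \<bullet> T (bs i)" for i by (subst a) simp
  have "norm a \<le> real CARD('m) * r" using y by (intro norm_le_coords) (simp add: ai)
  moreover have "norm y \<le> norm (T a) + norm ((y \<bullet> e) *\<^sub>R e)" by (subst a) (rule norm_triangle_ineq)
  ultimately show "norm y \<le> real CARD('m) * r + s" using y by (simp add: T_iso e1)
qed

lemma bounded_cyl: "bounded (cyl R)"
  by (rule bounded_subset[OF bounded_coords[of "R / 2" R]]) (auto simp: cyl_def less_imp_le)

lemma bounded_cube: "bounded (cube bs 0 R)"
  unfolding bounded_iff
  by (intro exI[of _ "real CARD('m) * (R / 2)"] ballI norm_le_coords) (simp add: cube_def less_imp_le)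

lemma cube_borel [measurable]: "cube bs c R \<in> sets borel"
proof -
  have "cube bs c R = (\<Inter>i\<in>UNIV. {x. \<bar>(x - c) \<bullet> bs i\<bar> < R / 2})"
    by (auto simp: cube_def)
  then have "open (cube bs c R)"
    by (auto intro!: open_INT open_Collect_less continuous_intros)
  then show ?thesis by simp
qed

text \<open>Scaling alone gives the power of R; the volume of the unit cube is carried along as a
  constant because only the growth rate matters.\<close>

lemma emeasure_cube:
  assumes "0 < R"
  shows "emeasure lborel (cube bs c R) = ennreal (measure lborel (cube bs 0 1) * R ^ CARD('m))"
proof -
  have fin: "emeasure lborel (cube bs 0 1) = ennreal (measure lborel (cube bs 0 1))"
    using emeasure_bounded_finite[OF bounded_cube[of 1]] by (intro emeasure_eq_ennreal_measure) auto
  have "{x. c + R *\<^sub>R x \<in> cube bs c R} = cube bs 0 1"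
    using assms by (auto simp: cube_def abs_mult field_simps)
  then have "emeasure (density (distr lborel borel (\<lambda>x. c + R *\<^sub>R x)) (\<lambda>_. \<bar>R\<bar>^DIM(real^'m))) (cube bs c R)
      = ennreal (R ^ CARD('m)) * emeasure lborel (cube bs 0 1)"
    using assms by (subst emeasure_density_const) (auto simp: emeasure_distr vimage_def)
  then show ?thesis
    using lborel_affine[of R c] assms by (simp add: fin ennreal_mult' mult.commute)
qed

text \<open>The map (a,b) to T a + b e is a linear isometry of the product onto the whole space, so
  it preserves Lebesgue measure. This allows integration along lines parallel to e.\<close>

lemma nn_integral_frame:
  assumes F: "F \<in> borel_measurable borel"
  shows "(\<integral>\<^sup>+y. F y \<partial>lborel) = (\<integral>\<^sup>+a. \<integral>\<^sup>+b. F (T a + b *\<^sub>R e) \<partial>lborel \<partial>lborel)"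
proof -
  define L where "L = (\<lambda>(a, b). T a + b *\<^sub>R e)"
  have lin: "linear L"
    unfolding L_def
    by (intro linearI) (auto simp: linear_add[OF T_lin] linear_scale[OF T_lin] algebra_simps)
  have iso: "norm (L x) = norm x" for x
  proof -
    obtain a b where x: "x = (a, b)" by (cases x)
    have "L x \<bullet> L x = a \<bullet> a + b * b"
      by (simp add: L_def x inner_add_left inner_add_right T_inner)
    then show ?thesis by (simp add: norm_eq_sqrt_inner x)
  qed
  have onto: "range L = UNIV"
  proof -
    have "y \<in> range L" for y
      by (rule frame_decomp[of y]) (auto simp: L_def intro: range_eqI[of _ _ "(_, y \<bullet> e)"])
    then show ?thesis by auto
  qed
  have Lm: "L \<in> borel_measurable borel"
    using linear_continuous_on[OF lin[unfolded linear_conv_bounded_linear]] by (rule borel_measurable_continuous_onI)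
  have "(\<integral>\<^sup>+y. F y \<partial>lborel) = (\<integral>\<^sup>+x. F (L x) \<partial>lborel)"
    using nn_integral_distr[of L lborel borel F] Lm F lborel_isometry[OF lin iso onto] by simp
  also have "\<dots> = (\<integral>\<^sup>+x. F (L x) \<partial>(lborel \<Otimes>\<^sub>M lborel))"
    by (simp add: lborel_prod)
  also have "\<dots> = (\<integral>\<^sup>+a. \<integral>\<^sup>+b. F (L (a, b)) \<partial>lborel \<partial>lborel)"
  proof (rule lborel.nn_integral_fst[symmetric])
    have "(\<lambda>x. F (L x)) \<in> borel_measurable borel" by (rule measurable_compose[OF Lm F])
    then show "(\<lambda>x. F (L x)) \<in> borel_measurable (lborel \<Otimes>\<^sub>M lborel)" by (simp add: lborel_prod)
  qed
  finally show ?thesis by (simp add: L_def)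
qed

definition cutoff :: "real \<Rightarrow> real \<Rightarrow> real \<Rightarrow> real^'n \<Rightarrow> real" where
  "cutoff \<kappa> r s y = (\<Prod>i\<in>UNIV. plateau \<kappa> r (y \<bullet> T (bs i))) * plateau \<kappa> s (y \<bullet> e)"

lemma smooth_cutoff: "smooth_fun (cutoff \<kappa> r s)"
  unfolding cutoff_def[abs_def]
  by (rule smooth_fun_mult[OF smooth_fun_prod smooth_fun_plateau], rule smooth_fun_plateau)

lemma cutoff_bounds: "0 \<le> cutoff \<kappa> r s y" "cutoff \<kappa> r s y \<le> 1"
  unfolding cutoff_def
  by (auto intro!: mult_nonneg_nonneg mult_le_one prod_nonneg prod_le_1 simp: plateau_bounds)

lemma cutoff_eq_1:
  "0 < \<kappa> \<Longrightarrow> (\<And>i. \<bar>y \<bullet> T (bs i)\<bar> \<le> r) \<Longrightarrow> \<bar>y \<bullet> e\<bar> \<le> s \<Longrightarrow> cutoff \<kappa> r s y = 1"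
  unfolding cutoff_def by (simp add: plateau_eq_1)

lemma cutoff_eq_0:
  assumes "0 < \<kappa>" and "(\<exists>i. r + 1 / \<kappa> \<le> \<bar>y \<bullet> T (bs i)\<bar>) \<or> s + 1 / \<kappa> \<le> \<bar>y \<bullet> e\<bar>"
  shows "cutoff \<kappa> r s y = 0"
proof -
  have "(\<Prod>i\<in>UNIV. plateau \<kappa> r (y \<bullet> T (bs i))) = 0 \<or> plateau \<kappa> s (y \<bullet> e) = 0"
    using assms plateau_eq_0 by (auto intro!: prod_zero)
  then show ?thesis by (auto simp: cutoff_def)
qed

text \<open>For products of factors in [0,1] the Lipschitz constants add up:
  \<open>2 * c * \<kappa>\<close> for each lateral direction and once more for e.\<close>

lemma cutoff_Lipschitz:
  assumes c: "\<And>s t. \<bar>smooth_step s - smooth_step t\<bar> \<le> c * \<bar>s - t\<bar>" "0 < c" and \<kappa>: "0 < \<kappa>"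
  shows "\<bar>cutoff \<kappa> r s y - cutoff \<kappa> r s z\<bar> \<le> 2 * (real CARD('m) + 1) * c * \<kappa> * norm (y - z)"
proof -
  have v: "\<bar>plateau \<kappa> a (y \<bullet> v) - plateau \<kappa> a (z \<bullet> v)\<bar> \<le> 2 * c * \<kappa> * norm (y - z)" if "norm v = 1" for a v
  proof -
    have "\<bar>y \<bullet> v - z \<bullet> v\<bar> \<le> norm (y - z)"
      using Cauchy_Schwarz_ineq2[of "y - z" v] that by (simp add: inner_diff_left)
    then have "2 * c * \<kappa> * \<bar>y \<bullet> v - z \<bullet> v\<bar> \<le> 2 * c * \<kappa> * norm (y - z)"
      using c(2) \<kappa> by (intro mult_left_mono) auto
    then show ?thesis using plateau_Lipschitz[OF c(1) \<kappa>] order_trans by blast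
  qed
  let ?P = "\<lambda>y. \<Prod>i\<in>UNIV. plateau \<kappa> r (y \<bullet> T (bs i))"
  have "\<bar>cutoff \<kappa> r s y - cutoff \<kappa> r s z\<bar> \<le> \<bar>?P y - ?P z\<bar> + \<bar>plateau \<kappa> s (y \<bullet> e) - plateau \<kappa> s (z \<bullet> e)\<bar>"
    unfolding cutoff_def
    by (rule abs_mult_diff_le) (auto simp: plateau_bounds abs_prod intro!: prod_le_1)
  also have "\<bar>?P y - ?P z\<bar> \<le> (\<Sum>i\<in>UNIV. \<bar>plateau \<kappa> r (y \<bullet> T (bs i)) - plateau \<kappa> r (z \<bullet> T (bs i))\<bar>)"
    using norm_prod_diff[of UNIV "\<lambda>i. plateau \<kappa> r (y \<bullet> T (bs i))" "\<lambda>i. plateau \<kappa> r (z \<bullet> T (bs i))"]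
    by (simp add: plateau_bounds)
  also have "\<dots> \<le> (\<Sum>i\<in>(UNIV :: 'm set). 2 * c * \<kappa> * norm (y - z))"
    by (intro sum_mono v) (simp add: T_iso bs_norm)
  also have "\<bar>plateau \<kappa> s (y \<bullet> e) - plateau \<kappa> s (z \<bullet> e)\<bar> \<le> 2 * c * \<kappa> * norm (y - z)"
    by (rule v[OF e1])
  finally show ?thesis by (simp add: algebra_simps)
qed

end

section \<open>Measurability of the energy\<close>

lemma hom_ext_nonneg: "0 < lam \<Longrightarrow> f \<in> Fd lam Lam \<Longrightarrow> 0 \<le> hom_ext f p"
proof -
  assume lam: "0 < lam" and f: "f \<in> Fd lam Lam"
  show ?thesis
  proof (cases "p = 0")
    case False
    then have "sqrt lam \<le> f (p /\<^sub>R norm p)" using f by (simp add: Fd_def)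
    then have "0 \<le> f (p /\<^sub>R norm p)" using lam by (meson order_trans real_sqrt_ge_zero less_imp_le)
    then show ?thesis by (simp add: hom_ext_def)
  qed (simp add: hom_ext_def)
qed

lemma hom_ext_le:
  assumes f: "f \<in> Fd lam Lam" shows "hom_ext f p \<le> sqrt Lam * norm p"
proof (cases "p = 0")
  case False
  then have "f (p /\<^sub>R norm p) \<le> sqrt Lam" using f by (simp add: Fd_def)
  then show ?thesis using False by (simp add: hom_ext_def mult.commute mult_left_mono)
qed (simp add: hom_ext_def)

lemma hom_ext_scale: "0 < c \<Longrightarrow> hom_ext f (c *\<^sub>R p) = c * hom_ext f p"
proof -
  assume c: "0 < c"
  then have "(c *\<^sub>R p) /\<^sub>R norm (c *\<^sub>R p) = p /\<^sub>R norm p" by simp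
  then show ?thesis unfolding hom_ext_def using c by (simp del: scaleR_scaleR)
qed

text \<open>Convexity is applied at the midpoint of 2p and 2r; homogeneity absorbs the
  factors.\<close>

lemma hom_ext_triangle:
  assumes f: "f \<in> Fd lam Lam" shows "hom_ext f (p + r) \<le> hom_ext f p + hom_ext f r"
proof -
  have "convex_on UNIV (hom_ext f)" using f by (simp add: Fd_def)
  from convex_onD[OF this, of "1/2" "2 *\<^sub>R p" "2 *\<^sub>R r"]
  have "hom_ext f (p + r) \<le> (1/2) * hom_ext f (2 *\<^sub>R p) + (1/2) * hom_ext f (2 *\<^sub>R r)" by simp
  then show ?thesis by (simp add: hom_ext_scale)
qed

text \<open>Subadditivity bounds the increment by the value at the difference. The constant is
  common to the whole class \<open>Fd\<close>, which makes later estimates uniform in the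
  medium.\<close>

lemma hom_ext_Lipschitz:
  assumes f: "f \<in> Fd lam Lam" shows "\<bar>hom_ext f p - hom_ext f r\<bar> \<le> sqrt Lam * norm (p - r)"
proof -
  have "hom_ext f p \<le> hom_ext f r + sqrt Lam * norm (p - r)" for p r
    using hom_ext_triangle[OF f, of r "p - r"] hom_ext_le[OF f, of "p - r"] by simp
  from this[of p r] this[of r p] show ?thesis by (simp add: norm_minus_commute)
qed

text \<open>A countable infimum of functions that are measurable in f and continuous in p: this is what gives joint
  measurability.\<close>

lemma hom_ext_eq_INF:
  fixes D :: "(real^'n) set"
  assumes f: "f \<in> Fd lam Lam" and Lam: "0 < Lam"
    and D: "\<And>X. open X \<Longrightarrow> X \<noteq> {} \<Longrightarrow> \<exists>d\<in>D. d \<in> X"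
  shows "hom_ext f p = (INF r\<in>D. hom_ext f r + sqrt Lam * norm (p - r))"
proof (rule antisym)
  have ne: "D \<noteq> {}" using D[of UNIV] by auto
  have lb: "hom_ext f p \<le> hom_ext f r + sqrt Lam * norm (p - r)" for r
    using hom_ext_Lipschitz[OF f, of p r] by (simp add: abs_le_iff)
  then show "hom_ext f p \<le> (INF r\<in>D. hom_ext f r + sqrt Lam * norm (p - r))"
    by (intro cINF_greatest ne)
  show "(INF r\<in>D. hom_ext f r + sqrt Lam * norm (p - r)) \<le> hom_ext f p"
  proof (rule field_le_epsilon)
    fix \<epsilon> :: real assume \<epsilon>: "0 < \<epsilon>"
    define \<delta> where "\<delta> = \<epsilon> / (2 * sqrt Lam)"
    have "0 < \<delta>" using \<epsilon> Lam by (simp add: \<delta>_def)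
    then obtain r where r: "r \<in> D" "norm (p - r) < \<delta>"
      using D[of "ball p \<delta>"] by (auto simp: dist_norm)
    have "(INF r\<in>D. hom_ext f r + sqrt Lam * norm (p - r)) \<le> hom_ext f r + sqrt Lam * norm (p - r)"
      by (rule cINF_lower[OF bdd_belowI2[of _ "hom_ext f p"]]) (use lb r in auto)
    also have "\<dots> \<le> hom_ext f p + 2 * (sqrt Lam * norm (p - r))"
      using hom_ext_Lipschitz[OF f, of p r] by (simp add: abs_le_iff)
    also have "sqrt Lam * norm (p - r) \<le> sqrt Lam * \<delta>"
      using r Lam by (intro mult_left_mono) auto
    also have "2 * (sqrt Lam * \<delta>) = \<epsilon>" using Lam by (simp add: \<delta>_def)
    finally show "(INF r\<in>D. hom_ext f r + sqrt Lam * norm (p - r)) \<le> hom_ext f p + \<epsilon>" by simp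
  qed
qed

lemma space_Fd_borel: "space (Fd_borel lam Lam) = Fd lam Lam"
  unfolding Fd_borel_def by (simp add: space_measure_of_conv)

lemma sets_Fd_borel: "sets (Fd_borel lam Lam) = sigma_sets (Fd lam Lam) (Fd_open_sets lam Lam)"
  unfolding Fd_borel_def by (rule sets_measure_of) (auto simp: Fd_open_sets_def)

text \<open>Evaluation at a point of the sphere is 1-Lipschitz for \<open>sup_dist\<close>, so
  preimages of open sets are among the generating sets.\<close>

lemma eval_measurable:
  assumes p: "p \<in> sphere 0 1"
  shows "(\<lambda>f. f p) \<in> borel_measurable (Fd_borel lam Lam)"
proof (rule borel_measurableI)
  fix S :: "real set" assume S: "open S"
  have "{f \<in> Fd lam Lam. f p \<in> S} \<in> Fd_open_sets lam Lam"
    unfolding Fd_open_sets_def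
  proof (clarify, intro conjI ballI)
    fix f assume "f \<in> {f \<in> Fd lam Lam. f p \<in> S}"
    then have f: "f \<in> Fd lam Lam" "f p \<in> S" by auto
    obtain \<epsilon> where \<epsilon>: "0 < \<epsilon>" "\<And>y. dist y (f p) < \<epsilon> \<Longrightarrow> y \<in> S"
      using S f(2) unfolding open_dist by blast
    have "g \<in> {f \<in> Fd lam Lam. f p \<in> S}" if g: "g \<in> Fd lam Lam" and d: "sup_dist f g < \<epsilon>" for g
    proof -
      \<comment> \<open>A supremum of reals dominates its members only when it is taken over a set
        bounded above; the common bounds of the class supply this.\<close>
      have "\<bar>f x - g x\<bar> \<le> sqrt Lam - sqrt lam" if "x \<in> sphere 0 1" for x
      proof -
        have "sqrt lam \<le> f x" "f x \<le> sqrt Lam" "sqrt lam \<le> g x" "g x \<le> sqrt Lam"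
          using f(1) g that unfolding Fd_def by blast+
        then show ?thesis by (simp add: abs_le_iff)
      qed
      then have "\<bar>f p - g p\<bar> \<le> sup_dist f g"
        unfolding sup_dist_def by (intro cSUP_upper p bdd_aboveI2)
      then have "dist (g p) (f p) < \<epsilon>" using d by (simp add: dist_real_def)
      then show ?thesis using g \<epsilon>(2) by auto
    qed
    then show "\<exists>\<epsilon>>0. \<forall>g\<in>Fd lam Lam. sup_dist f g < \<epsilon> \<longrightarrow> g \<in> {f \<in> Fd lam Lam. f p \<in> S}"
      using \<epsilon>(1) by blast
  qed auto
  then show "(\<lambda>f. f p) -` S \<inter> space (Fd_borel lam Lam) \<in> sets (Fd_borel lam Lam)"
    unfolding space_Fd_borel sets_Fd_borel by (auto intro!: sigma_sets.Basic simp: vimage_def Int_def conj_commute)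
qed

lemma hom_ext_measurable:
  "(\<lambda>f. hom_ext f r) \<in> borel_measurable (Fd_borel lam Lam)"
proof (cases "r = 0")
  case False
  then have "(\<lambda>f. f (r /\<^sub>R norm r)) \<in> borel_measurable (Fd_borel lam Lam)"
    by (intro eval_measurable) simp
  with False show ?thesis by (simp add: hom_ext_def)
qed (simp add: hom_ext_def)

lemma hom_ext_joint_measurable:
  assumes Lam: "0 < Lam"
  shows "(\<lambda>(f, p). hom_ext f p) \<in> borel_measurable (Fd_borel lam Lam \<Otimes>\<^sub>M (borel :: (real^'n) measure))"
proof -
  obtain D :: "(real^'n) set" where D: "countable D" "\<And>X. open X \<Longrightarrow> X \<noteq> {} \<Longrightarrow> \<exists>d\<in>D. d \<in> X"
    using countable_dense_exists by blast
  have m: "(\<lambda>z. INF r\<in>D. hom_ext (fst z) r + sqrt Lam * norm (snd z - r)) \<in> borel_measurable (Fd_borel lam Lam \<Otimes>\<^sub>M (borel :: (real^'n) measure))"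
  proof (rule borel_measurable_cINF_real[OF D(1)])
    fix r assume "r \<in> D"
    have "(\<lambda>z. hom_ext (fst z) r) \<in> borel_measurable (Fd_borel lam Lam \<Otimes>\<^sub>M (borel :: (real^'n) measure))"
      by (rule measurable_compose[OF measurable_fst hom_ext_measurable])
    then show "(\<lambda>z. hom_ext (fst z) r + sqrt Lam * norm (snd z - r)) \<in> borel_measurable (Fd_borel lam Lam \<Otimes>\<^sub>M (borel :: (real^'n) measure))"
      by measurable
  qed
  show ?thesis
  proof (rule measurable_cong[THEN iffD1, OF _ m])
    fix z :: "(real^'n \<Rightarrow> real) \<times> (real^'n)" assume "z \<in> space (Fd_borel lam Lam \<Otimes>\<^sub>M (borel :: (real^'n) measure))"
    then have "fst z \<in> Fd lam Lam" by (auto simp: space_pair_measure space_Fd_borel)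
    from hom_ext_eq_INF[OF this Lam D(2)]
    show "(INF r\<in>D. hom_ext (fst z) r + sqrt Lam * norm (snd z - r)) = (case z of (f, p) \<Rightarrow> hom_ext f p)"
      unfolding case_prod_beta by (rule sym)
  qed
qed

lemma L2_vector_measurable:
  assumes "\<And>i. L2 U (\<lambda>x. g x $ i)"
  shows "(\<lambda>x. indicator U x *\<^sub>R (g x :: real^'k)) \<in> borel_measurable lebesgue"
proof -
  have "(\<lambda>x. (indicator U x *\<^sub>R g x) \<bullet> b) \<in> borel_measurable lebesgue" if "b \<in> Basis" for b
    using that L2_measurable[OF assms] by (auto simp: Basis_vec_def inner_axis)
  then show ?thesis by (subst borel_measurable_euclidean_space) blast
qed

lemma H1_measurable:
  assumes "u \<in> H1 U"
  shows "(\<lambda>x. indicator U x *\<^sub>R u x) \<in> borel_measurable lebesgue"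
    "(\<lambda>x. indicator U x *\<^sub>R Dw U u x) \<in> borel_measurable lebesgue"
  using has_wgrad_Dw[OF assms] unfolding has_wgrad_def
  by (blast intro: L2_measurable L2_vector_measurable)+

section \<open>The random medium and measurability in the medium\<close>

locale random_medium =
  fixes lam Lam :: real and M :: "'w measure" and \<Phi> :: "'w \<Rightarrow> real^'n \<Rightarrow> real"
    and \<tau> :: "real^'n \<Rightarrow> 'w \<Rightarrow> 'w" and W :: "real \<Rightarrow> real"
  assumes lam: "0 < lam" and Lam: "0 < Lam"
    and Phi_meas: "\<Phi> \<in> measurable M (Fd_borel lam Lam)"
    and tau_meas: "(\<lambda>(x, \<omega>). \<tau> x \<omega>) \<in> measurable (borel \<Otimes>\<^sub>M M) M"
    and tau_zero: "\<And>\<omega>. \<omega> \<in> space M \<Longrightarrow> \<tau> 0 \<omega> = \<omega>"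
    and tau_add: "\<And>x y \<omega>. \<omega> \<in> space M \<Longrightarrow> \<tau> (x + y) \<omega> = \<tau> x (\<tau> y \<omega>)"
    and W_cont: "continuous_on {-1..1} W"
    and W_nonneg: "\<And>s. s \<in> {-1..1} \<Longrightarrow> 0 \<le> W s"
begin

lemma tau_space: "\<omega> \<in> space M \<Longrightarrow> \<tau> x \<omega> \<in> space M"
  using measurable_space[OF tau_meas, of "(x, \<omega>)"] by (simp add: space_pair_measure)

lemma Phi_Fd: "\<omega> \<in> space M \<Longrightarrow> \<Phi> \<omega> \<in> Fd lam Lam"
  using measurable_space[OF Phi_meas] by (simp add: space_Fd_borel)

lemma phiw_eq: "phiw \<Phi> \<tau> \<omega> x p = hom_ext (\<Phi> (\<tau> x \<omega>)) p"
  by (simp add: phiw_def hom_ext_def)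

lemma phiw_shift: "\<omega> \<in> space M \<Longrightarrow> phiw \<Phi> \<tau> (\<tau> x \<omega>) z p = phiw \<Phi> \<tau> \<omega> (z + x) p"
  by (simp add: phiw_eq tau_add)

lemma phiw_square_le:
  assumes "\<omega> \<in> space M" shows "(phiw \<Phi> \<tau> \<omega> x p)\<^sup>2 \<le> Lam * (norm p)\<^sup>2"
proof -
  have "\<Phi> (\<tau> x \<omega>) \<in> Fd lam Lam" using assms by (simp add: Phi_Fd tau_space)
  then have "(phiw \<Phi> \<tau> \<omega> x p)\<^sup>2 \<le> (sqrt Lam * norm p)\<^sup>2"
    unfolding phiw_eq by (intro power_mono hom_ext_le hom_ext_nonneg[OF lam])
  then show ?thesis using Lam by (simp add: power_mult_distrib)
qed

text \<open>The source N is left open for two uses: \<open>lebesgue\<close> when the medium is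
  fixed, and the product of M with \<open>lborel\<close> when the energy is regarded as a function
  of the medium.\<close>

lemma phiw_joint_measurable:
  assumes p: "p \<in> borel_measurable N" and x: "x \<in> borel_measurable N" and w: "w \<in> measurable N M"
  shows "(\<lambda>z. phiw \<Phi> \<tau> (w z) (x z) (p z)) \<in> borel_measurable N"
proof -
  have "(\<lambda>z. (x z, w z)) \<in> measurable N (borel \<Otimes>\<^sub>M M)" using x w by measurable
  from measurable_compose[OF measurable_compose[OF this tau_meas] Phi_meas]
  have "(\<lambda>z. \<Phi> (\<tau> (x z) (w z))) \<in> measurable N (Fd_borel lam Lam)" by simp
  then have "(\<lambda>z. (\<Phi> (\<tau> (x z) (w z)), p z)) \<in> measurable N (Fd_borel lam Lam \<Otimes>\<^sub>M borel)"
    using p by measurable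
  from measurable_compose[OF this hom_ext_joint_measurable[OF Lam]]
  show ?thesis by (simp add: phiw_eq)
qed

text \<open>W is only controlled on [-1,1]; clamping the argument gives a Borel function on the whole line.\<close>

definition W' :: "real \<Rightarrow> real" where "W' s = W (max (-1) (min 1 s))"

lemma W'_eq: "-1 \<le> s \<Longrightarrow> s \<le> 1 \<Longrightarrow> W' s = W s"
  by (simp add: W'_def)

lemma W'_measurable [measurable]: "W' \<in> borel_measurable borel"
proof -
  have "continuous_on UNIV W'"
    unfolding W'_def by (rule continuous_on_compose2[OF W_cont]) (auto intro!: continuous_intros)
  then show ?thesis by (rule borel_measurable_continuous_onI)
qed

abbreviation edens :: "'w \<Rightarrow> real^'n \<Rightarrow> real^'n \<Rightarrow> real \<Rightarrow> real" where
  "edens \<omega> x p s \<equiv> 1/2 * (phiw \<Phi> \<tau> \<omega> x p)\<^sup>2 + W s"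

lemma edens_measurable:
  assumes w: "\<omega> \<in> space M"
    and g: "(\<lambda>x. indicator U x *\<^sub>R g x) \<in> borel_measurable lebesgue"
    and u: "(\<lambda>x. indicator U x *\<^sub>R u x) \<in> borel_measurable lebesgue"
    and U: "U \<in> sets lebesgue" and r: "\<And>x. x \<in> U \<Longrightarrow> -1 \<le> u x \<and> u x \<le> 1"
  shows "(\<lambda>x. ennreal (edens \<omega> x (g x) (u x)) * indicator U x) \<in> borel_measurable lebesgue"
proof -
  have id: "(\<lambda>x. x) \<in> borel_measurable lebesgue" by (rule measurable_completion) simp
  have 1: "(\<lambda>x. phiw \<Phi> \<tau> \<omega> x (indicator U x *\<^sub>R g x)) \<in> borel_measurable lebesgue"
    using w by (intro phiw_joint_measurable[OF g id]) simp
  have 2: "(\<lambda>x. W' (indicator U x *\<^sub>R u x)) \<in> borel_measurable lebesgue"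
    by (rule measurable_compose[OF u W'_measurable])
  have "(\<lambda>x. ennreal (1/2 * (phiw \<Phi> \<tau> \<omega> x (indicator U x *\<^sub>R g x))\<^sup>2 + W' (indicator U x *\<^sub>R u x)) * indicator U x) \<in> borel_measurable lebesgue"
    using 1 2 U by measurable
  also have "(\<lambda>x. ennreal (1/2 * (phiw \<Phi> \<tau> \<omega> x (indicator U x *\<^sub>R g x))\<^sup>2 + W' (indicator U x *\<^sub>R u x)) * indicator U x) = (\<lambda>x. ennreal (edens \<omega> x (g x) (u x)) * indicator U x)"
    using r by (auto simp: fun_eq_iff indicator_def W'_eq)
  finally show ?thesis .
qed

text \<open>The function u and its gradient are merely Lebesgue measurable, while joint
  measurability of the medium is Borel in x. Replacing both by Borel representatives leaves the
  energy unchanged for every medium, after which the integral over x is a measurable parameter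
  integral.\<close>

lemma energy_measurable:
  assumes U: "U \<in> sets borel" and u: "u \<in> H1 U" and r: "\<And>x. x \<in> U \<Longrightarrow> -1 \<le> u x \<and> u x \<le> 1"
  shows "(\<lambda>\<omega>. energy \<Phi> \<tau> W \<omega> u U) \<in> borel_measurable M"
proof -
  let ?g = "\<lambda>x. indicator U x *\<^sub>R Dw U u x"
  have "(\<lambda>x. ?g x $ i) \<in> borel_measurable lebesgue" for i
    using measurable_compose[OF H1_measurable(2)[OF u], of "\<lambda>v. v $ i" borel]
      borel_measurable_continuous_onI[OF continuous_on_component[OF continuous_on_id, of UNIV i]] by simp
  then have "\<forall>i. \<exists>g'. g' \<in> borel_measurable lborel \<and> (AE x in lborel. ?g x $ i = g' x)"
    using completion_ex_borel_measurable_real by blast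
  from choice[OF this] obtain g'
    where g': "\<And>i. g' i \<in> borel_measurable lborel" "\<And>i. AE x in lborel. ?g x $ i = g' i x"
    by blast
  define G where "G x = (\<chi> i. g' i x)" for x
  have G: "G \<in> borel_measurable borel"
  proof (subst borel_measurable_euclidean_space, intro ballI)
    fix b :: "real^'n" assume "b \<in> Basis"
    then obtain i where "b = axis i 1" by (auto simp: Basis_vec_def)
    then show "(\<lambda>x. G x \<bullet> b) \<in> borel_measurable borel"
      using g'(1)[of i] by (simp add: G_def inner_axis)
  qed
  have "AE x in lborel. \<forall>i\<in>UNIV. ?g x $ i = g' i x"
    using g'(2) by (subst AE_ball_countable) auto
  then have Gae: "AE x in lborel. ?g x = G x"
    by eventually_elim (simp add: vec_eq_iff G_def)
  obtain v where v: "v \<in> borel_measurable lborel" "AE x in lborel. indicator U x *\<^sub>R u x = v x"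
    using completion_ex_borel_measurable_real[OF H1_measurable(1)[OF u]] by blast
  have eq: "energy \<Phi> \<tau> W \<omega> u U = (\<integral>\<^sup>+x. ennreal (1/2 * (phiw \<Phi> \<tau> \<omega> x (G x))\<^sup>2 + W' (v x)) * indicator U x \<partial>lborel)" for \<omega>
    unfolding energy_def nn_integral_completion
  proof (rule nn_integral_cong_AE)
    show "AE x in lborel. ennreal (edens \<omega> x (Dw U u x) (u x)) * indicator U x = ennreal (1/2 * (phiw \<Phi> \<tau> \<omega> x (G x))\<^sup>2 + W' (v x)) * indicator U x"
      using Gae v(2)
    proof eventually_elim
      case (elim x)
      \<comment> \<open>Inside U the representatives take the values of u and of its gradient, so W'
        may be read as W; outside U the indicator removes both sides.\<close>
      then show ?case using r[of x] W'_eq[of "v x"] by (cases "x \<in> U") auto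
    qed
  qed
  have "(\<lambda>z. ennreal (1/2 * (phiw \<Phi> \<tau> (fst z) (snd z) (G (snd z)))\<^sup>2 + W' (v (snd z))) * indicator U (snd z)) \<in> borel_measurable (M \<Otimes>\<^sub>M lborel)"
  proof -
    have snd: "snd \<in> measurable (M \<Otimes>\<^sub>M lborel) borel"
      using measurable_snd[of M lborel] by simp
    have "(\<lambda>z. phiw \<Phi> \<tau> (fst z) (snd z) (G (snd z))) \<in> borel_measurable (M \<Otimes>\<^sub>M lborel)"
      by (rule phiw_joint_measurable[OF measurable_compose[OF snd G] snd measurable_fst])
    moreover have "(\<lambda>z. W' (v (snd z))) \<in> borel_measurable (M \<Otimes>\<^sub>M lborel)"
      using v(1) by measurable
    moreover have "(\<lambda>z. indicator U (snd z) :: ennreal) \<in> borel_measurable (M \<Otimes>\<^sub>M lborel)"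
      using U by measurable
    ultimately show ?thesis by measurable
  qed
  then show ?thesis
    unfolding eq by (intro lborel.borel_measurable_nn_integral) (simp add: case_prod_beta')
qed

end

section \<open>Shifting and gluing\<close>

lemma lebesgue_distr_plus: "distr lebesgue lebesgue ((+) (c::'a::euclidean_space)) = lebesgue"
  and lebesgue_measurable_plus: "(+) (c::'a::euclidean_space) \<in> measurable lebesgue lebesgue"
proof -
  \<comment> \<open>The translation is put in the shape of a diagonal affine map with unit
    entries.\<close>
  have T: "(\<lambda>x. c + (\<Sum>j\<in>Basis. (1 * (x \<bullet> j)) *\<^sub>R j)) = (+) c"
    by (simp add: euclidean_representation fun_eq_iff)
  show "(+) c \<in> measurable lebesgue lebesgue"
    using lebesgue_affine_measurable[of "\<lambda>_. 1" c] unfolding T by simp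
  show "distr lebesgue lebesgue ((+) c) = lebesgue"
    using lebesgue_affine_euclidean[of "\<lambda>_. 1" c] unfolding T by (simp add: density_1)
qed

context
  fixes x :: "'a::euclidean_space"
begin

lemma lebesgue_minus: "(\<lambda>y. y - x) \<in> measurable lebesgue lebesgue" "distr lebesgue lebesgue (\<lambda>y. y - x) = lebesgue"
proof -
  have "(+) (- x) = (\<lambda>y. y - x)" by auto
  then show "(\<lambda>y. y - x) \<in> measurable lebesgue lebesgue" "distr lebesgue lebesgue (\<lambda>y. y - x) = lebesgue"
    using lebesgue_measurable_plus[of "- x"] lebesgue_distr_plus[of "- x"] by simp_all
qed

lemma borel_measurable_lebesgue_translate:
  "f \<in> measurable lebesgue N \<Longrightarrow> (\<lambda>y. f (y - x)) \<in> measurable lebesgue N"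
  by (rule measurable_compose[OF lebesgue_minus(1)])

lemma nn_integral_lebesgue_translate:
  "f \<in> borel_measurable lebesgue \<Longrightarrow> (\<integral>\<^sup>+y. f (y - x) \<partial>lebesgue) = (\<integral>\<^sup>+y. f y \<partial>lebesgue)"
  using nn_integral_distr[OF lebesgue_minus(1), of f] by (simp add: lebesgue_minus(2))

lemma integrable_lebesgue_translate:
  fixes f :: "'a \<Rightarrow> 'b::{banach, second_countable_topology}"
  shows "integrable lebesgue f \<Longrightarrow> integrable lebesgue (\<lambda>y. f (y - x))"
  using integrable_distr_eq[OF lebesgue_minus(1), of f] by (simp add: lebesgue_minus(2) borel_measurable_integrable)

lemma integral_lebesgue_translate:
  fixes f :: "'a \<Rightarrow> 'b::{banach, second_countable_topology}"
  shows "f \<in> borel_measurable lebesgue \<Longrightarrow> (\<integral>y. f (y - x) \<partial>lebesgue) = (\<integral>y. f y \<partial>lebesgue)"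
  using integral_distr[OF lebesgue_minus(1), of f] by (simp add: lebesgue_minus(2))

lemma AE_lebesgue_translate:
  assumes "AE y in lebesgue. P y" shows "AE y in lebesgue. P (y - x)"
proof -
  obtain N where N: "{y. \<not> P y} \<subseteq> N" "N \<in> null_sets lebesgue"
    using assms unfolding eventually_ae_filter by auto
  have s: "(\<lambda>y. y - x) -` N \<in> sets lebesgue"
    using measurable_sets[OF lebesgue_minus(1), of N] N(2) by auto
  moreover have "emeasure lebesgue ((\<lambda>y. y - x) -` N) = emeasure lebesgue N"
    using emeasure_distr[OF lebesgue_minus(1), of N] N(2) by (auto simp: lebesgue_minus(2) null_sets_def)
  ultimately have "(\<lambda>y. y - x) -` N \<in> null_sets lebesgue" using N(2) by (auto simp: null_sets_def)
  then show ?thesis by (rule AE_I') (use N(1) in auto)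
qed

end

text \<open>The squared distance is a sum of two nonnegative terms, so each tends to 0. In the
  second, uniqueness replaces the chosen weak gradient of the test function by the classical
  one.\<close>

lemma H1_dist_tendsto_0D:
  fixes U :: "(real^'n) set"
  assumes U: "open U" "bounded U" and t: "\<And>k::nat. test_fun U (\<psi> k)" and v: "v \<in> H1 U"
    and lim: "(\<lambda>k. H1_dist U (\<psi> k) v) \<longlonglongrightarrow> 0"
  shows "(\<lambda>k. LINT x:U|lebesgue. (\<psi> k x - v x)\<^sup>2) \<longlonglongrightarrow> 0"
    and "(\<lambda>k. LINT x:U|lebesgue. (norm (grad (\<psi> k) x - Dw U v x))\<^sup>2) \<longlonglongrightarrow> 0"
proof -
  have Um: "U \<in> sets lebesgue" using U(1) by simp
  define a where "a k = (LINT x:U|lebesgue. (\<psi> k x - v x)\<^sup>2)" for k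
  define b where "b k = (LINT x:U|lebesgue. (norm (Dw U (\<psi> k) x - Dw U v x))\<^sup>2)" for k
  have a: "0 \<le> a k" and b: "0 \<le> b k" for k
    unfolding a_def b_def set_lebesgue_integral_def by (auto intro!: Bochner_Integration.integral_nonneg)
  have "(\<lambda>k. (H1_dist U (\<psi> k) v)\<^sup>2) \<longlonglongrightarrow> 0\<^sup>2" by (intro tendsto_power lim)
  moreover have "(H1_dist U (\<psi> k) v)\<^sup>2 = a k + b k" for k
    using a b by (simp add: H1_dist_def a_def[symmetric] b_def[symmetric])
  ultimately have ab: "(\<lambda>k. a k + b k) \<longlonglongrightarrow> 0" by simp
  show "(\<lambda>k. LINT x:U|lebesgue. (\<psi> k x - v x)\<^sup>2) \<longlonglongrightarrow> 0"
    unfolding a_def[symmetric] by (rule tendsto_sandwich[OF _ _ tendsto_const ab]) (use a b in auto)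
  have b0: "b \<longlonglongrightarrow> 0"
    by (rule tendsto_sandwich[OF _ _ tendsto_const ab]) (use a b in auto)
  have "b = (\<lambda>k. LINT x:U|lebesgue. (norm (grad (\<psi> k) x - Dw U v x))\<^sup>2)"
  proof
    fix k
    have g: "has_wgrad U (\<psi> k) (grad (\<psi> k))"
      by (rule has_wgrad_smooth[OF Um U(2) test_fun_smooth[OF t]])
    have D: "has_wgrad U (\<psi> k) (Dw U (\<psi> k))" by (rule has_wgrad_Dw) (use g in \<open>auto simp: H1_iff\<close>)
    have V: "has_wgrad U v (Dw U v)" by (rule has_wgrad_Dw[OF v])
    show "b k = (LINT x:U|lebesgue. (norm (grad (\<psi> k) x - Dw U v x))\<^sup>2)"
      unfolding b_def set_lebesgue_integral_def
    proof (rule integral_cong_AE)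
      show "(\<lambda>x. indicator U x *\<^sub>R (norm (Dw U (\<psi> k) x - Dw U v x))\<^sup>2) \<in> borel_measurable lebesgue"
        by (rule borel_measurable_integrable[OF L2_norm_square_integrable[unfolded set_integrable_def]])
          (use D V in \<open>auto simp: has_wgrad_def intro!: L2_diff\<close>)
      show "(\<lambda>x. indicator U x *\<^sub>R (norm (grad (\<psi> k) x - Dw U v x))\<^sup>2) \<in> borel_measurable lebesgue"
        by (rule borel_measurable_integrable[OF L2_norm_square_integrable[unfolded set_integrable_def]])
          (use g V in \<open>auto simp: has_wgrad_def intro!: L2_diff\<close>)
      show "AE x in lebesgue. indicator U x *\<^sub>R (norm (Dw U (\<psi> k) x - Dw U v x))\<^sup>2 = indicator U x *\<^sub>R (norm (grad (\<psi> k) x - Dw U v x))\<^sup>2"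
        using has_wgrad_unique[OF U D g] by eventually_elim (auto simp: indicator_def)
    qed
  qed
  then show "(\<lambda>k. LINT x:U|lebesgue. (norm (grad (\<psi> k) x - Dw U v x))\<^sup>2) \<longlonglongrightarrow> 0"
    using b0 by simp
qed

text \<open>The codomain is left polymorphic so that the same extension by zero serves for a
  function and for its gradient.\<close>

definition shift_extend :: "(real^'n) set \<Rightarrow> real^'n \<Rightarrow> (real^'n \<Rightarrow> 'b::zero) \<Rightarrow> real^'n \<Rightarrow> 'b" where
  "shift_extend U x v y = (if y - x \<in> U then v (y - x) else 0)"

lemma shift_extend_component: "shift_extend U x g y $ i = shift_extend U x (\<lambda>z. g z $ i) y"
  by (simp add: shift_extend_def)

lemma shift_extend_indicator:
  assumes "(+) x ` U \<subseteq> V"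
  shows "indicator V y *\<^sub>R shift_extend U x v y = indicator U (y - x) *\<^sub>R (v (y - x) :: 'b::real_vector)"
  using assms by (auto simp: shift_extend_def indicator_def image_subset_iff dest: bspec[of _ _ "y - x"])

lemma L2_shift_extend:
  assumes UV: "(+) x ` U \<subseteq> V" and v: "L2 U v"
  shows "L2 V (shift_extend U x v)"
proof -
  have "(\<lambda>y. indicator V y *\<^sub>R shift_extend U x v y) \<in> borel_measurable lebesgue"
    unfolding shift_extend_indicator[OF UV]
    by (rule borel_measurable_lebesgue_translate[OF L2_measurable[OF v]])
  moreover have "integrable lebesgue (\<lambda>y. indicator V y *\<^sub>R (shift_extend U x v y)\<^sup>2)"
  proof -
    have "(\<lambda>y. indicator V y *\<^sub>R (shift_extend U x v y)\<^sup>2) = (\<lambda>y. indicator U (y - x) *\<^sub>R (v (y - x))\<^sup>2)"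
    proof
      fix y show "indicator V y *\<^sub>R (shift_extend U x v y)\<^sup>2 = indicator U (y - x) *\<^sub>R (v (y - x))\<^sup>2"
        using UV by (auto simp: shift_extend_def indicator_def image_subset_iff dest: bspec[of _ _ "y - x"])
    qed
    then show ?thesis
      using integrable_lebesgue_translate[OF L2_integrable_square[OF v], of x] by simp
  qed
  ultimately show ?thesis by (simp add: L2_def set_borel_measurable_def set_integrable_def)
qed

lemma set_integral_shift_extend:
  fixes F :: "real^'n \<Rightarrow> real"
  assumes UV: "(+) x ` U \<subseteq> V" and F: "set_borel_measurable lebesgue U F"
    and G: "\<And>y. G y = shift_extend U x F y"
  shows "(LINT y:V|lebesgue. G y) = (LINT z:U|lebesgue. F z)"
  unfolding set_lebesgue_integral_def G shift_extend_indicator[OF UV]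
  by (rule integral_lebesgue_translate) (use F in \<open>simp add: set_borel_measurable_def\<close>)

text \<open>Translated test functions are test functions on V and vanish outside the translate of U,
  so their L2 distances to the zero extensions equal the distances on U. Closedness of the weak
  gradient then shows that extension by zero creates no jump. The approximating sequence is returned
  because gluing needs it again.\<close>

lemma H1_0_shift_extend:
  fixes U V :: "(real^'n) set"
  assumes U: "open U" "bounded U" and V: "open V" "bounded V" and UV: "(+) x ` U \<subseteq> V"
    and v: "v \<in> H1_0 U"
  obtains \<psi> where "\<And>k::nat. test_fun V (\<psi> k)"
    "(\<lambda>k. LINT y:V|lebesgue. (\<psi> k y - shift_extend U x v y)\<^sup>2) \<longlonglongrightarrow> 0"
    "(\<lambda>k. LINT y:V|lebesgue. (norm (grad (\<psi> k) y - shift_extend U x (Dw U v) y))\<^sup>2) \<longlonglongrightarrow> 0"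
    "has_wgrad V (shift_extend U x v) (shift_extend U x (Dw U v))"
proof -
  have Um: "U \<in> sets lebesgue" and Vm: "V \<in> sets lebesgue" using U(1) V(1) by simp_all
  obtain \<psi> where t: "\<And>k::nat. test_fun U (\<psi> k)" and lim: "(\<lambda>k. H1_dist U (\<psi> k) v) \<longlonglongrightarrow> 0"
    using v unfolding H1_0_def by blast
  have vH: "v \<in> H1 U" using v by (simp add: H1_0_def)
  note l = H1_dist_tendsto_0D[OF U t vH lim]
  have vD: "L2 U v" "L2 U (\<lambda>x. Dw U v x $ i)" for i
    using has_wgrad_Dw[OF vH] by (auto simp: has_wgrad_def)
  define \<psi>' where "\<psi>' k y = \<psi> k (y - x)" for k y
  have t': "test_fun V (\<psi>' k)" for k
    unfolding \<psi>'_def using test_fun_translate[OF t] by (rule test_fun_mono) (use UV in auto)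
  have g': "grad (\<psi>' k) y = grad (\<psi> k) (y - x)" for k y
    unfolding \<psi>'_def by (rule grad_translate[OF test_fun_smooth[OF t]])
  have z: "\<psi> k z = 0" "grad (\<psi> k) z = 0" if "z \<notin> U" for k z
    using test_fun_eq_0[OF t that] by (auto simp: vec_eq_iff)
  have L: "L2 U (\<psi> k)" "L2 U (partial i (\<psi> k))" for k i
    by (rule test_fun_L2[OF Um U(2) t])+
  have 1: "(LINT y:V|lebesgue. (\<psi>' k y - shift_extend U x v y)\<^sup>2) = (LINT z:U|lebesgue. (\<psi> k z - v z)\<^sup>2)" for k
  proof (rule set_integral_shift_extend[OF UV])
    show "set_borel_measurable lebesgue U (\<lambda>z. (\<psi> k z - v z)\<^sup>2)"
      using L2_integrable_square[OF L2_diff[OF L(1) vD(1)]] unfolding set_borel_measurable_def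
      by (rule borel_measurable_integrable)
    show "(\<psi>' k y - shift_extend U x v y)\<^sup>2 = shift_extend U x (\<lambda>z. (\<psi> k z - v z)\<^sup>2) y" for y
      using z(1) by (simp add: shift_extend_def \<psi>'_def)
  qed
  have 2: "(LINT y:V|lebesgue. (norm (grad (\<psi>' k) y - shift_extend U x (Dw U v) y))\<^sup>2) = (LINT z:U|lebesgue. (norm (grad (\<psi> k) z - Dw U v z))\<^sup>2)" for k
  proof (rule set_integral_shift_extend[OF UV])
    have "set_integrable lebesgue U (\<lambda>z. (norm (grad (\<psi> k) z - Dw U v z))\<^sup>2)"
      by (rule L2_norm_square_integrable) (simp add: L2_diff L vD)
    then show "set_borel_measurable lebesgue U (\<lambda>z. (norm (grad (\<psi> k) z - Dw U v z))\<^sup>2)"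
      unfolding set_borel_measurable_def set_integrable_def by (rule borel_measurable_integrable)
    show "(norm (grad (\<psi>' k) y - shift_extend U x (Dw U v) y))\<^sup>2 = shift_extend U x (\<lambda>z. (norm (grad (\<psi> k) z - Dw U v z))\<^sup>2) y" for y
      using z(2) by (simp add: shift_extend_def g')
  qed
  have l1: "(\<lambda>k. LINT y:V|lebesgue. (\<psi>' k y - shift_extend U x v y)\<^sup>2) \<longlonglongrightarrow> 0"
    and l2: "(\<lambda>k. LINT y:V|lebesgue. (norm (grad (\<psi>' k) y - shift_extend U x (Dw U v) y))\<^sup>2) \<longlonglongrightarrow> 0"
    using l unfolding 1 2 .
  have "has_wgrad V (shift_extend U x v) (shift_extend U x (Dw U v))"
    by (rule has_wgrad_limit[OF Vm V(2) has_wgrad_smooth[OF Vm V(2) test_fun_smooth[OF t']] _ _ l1 l2])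
      (use L2_shift_extend[OF UV] vD in \<open>auto simp: shift_extend_component\<close>)
  with t' l1 l2 show ?thesis by (rule that)
qed

lemma has_wgrad_cong_fun: "has_wgrad U u g \<Longrightarrow> (\<And>x. u x = v x) \<Longrightarrow> has_wgrad U v g"
  by (metis ext)

text \<open>On the translate of U the function w equals the translated profile, so u' is w plus the
  zero extension of the translated u - p. This representation yields the gradient on all of V at
  once, and membership in H1_0 because w - p is itself a test function.\<close>

lemma glue_shifted:
  fixes U V :: "(real^'n) set"
  assumes U: "open U" "bounded U" and V: "open V" "bounded V" and UV: "(+) x ` U \<subseteq> V"
    and p: "smooth_fun p" and w: "smooth_fun w" and \<zeta>: "test_fun V (\<lambda>y. w y - p y)"
    and wU: "\<And>y. y - x \<in> U \<Longrightarrow> w y = p (y - x)"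
    and v: "(\<lambda>z. u z - p z) \<in> H1_0 U"
  defines "u' \<equiv> \<lambda>y. if y - x \<in> U then u (y - x) else w y"
  shows "u' \<in> H1 V" "(\<lambda>y. u' y - p y) \<in> H1_0 V"
    "AE y in lebesgue. y \<in> V \<longrightarrow> Dw V u' y = (if y - x \<in> U then Dw U u (y - x) else grad w y)"
proof -
  have Um: "U \<in> sets lebesgue" and Vm: "V \<in> sets lebesgue" using U(1) V(1) by simp_all
  let ?v = "\<lambda>z. u z - p z" and ?\<zeta> = "\<lambda>y. w y - p y"
  let ?v' = "shift_extend U x ?v" and ?g' = "shift_extend U x (Dw U ?v)"
  obtain \<psi> where t: "\<And>k::nat. test_fun V (\<psi> k)"
    and l1: "(\<lambda>k. LINT y:V|lebesgue. (\<psi> k y - ?v' y)\<^sup>2) \<longlonglongrightarrow> 0"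
    and l2: "(\<lambda>k. LINT y:V|lebesgue. (norm (grad (\<psi> k) y - ?g' y))\<^sup>2) \<longlonglongrightarrow> 0"
    and wg: "has_wgrad V ?v' ?g'"
    using H1_0_shift_extend[OF U V UV v] by blast
  have u': "u' y = w y + ?v' y" for y
    using wU[of y] by (simp add: u'_def shift_extend_def)
  have 1: "has_wgrad V u' (\<lambda>y. grad w y + ?g' y)"
    by (rule has_wgrad_cong_fun[OF has_wgrad_add[OF Vm V(2) has_wgrad_smooth[OF Vm V(2) w] wg]]) (simp add: u')
  then show H: "u' \<in> H1 V" by (auto simp: H1_iff)
  have vH: "?v \<in> H1 U" using v by (simp add: H1_0_def)
  have "has_wgrad U u (\<lambda>z. Dw U ?v z + grad p z)"
    by (rule has_wgrad_cong_fun[OF has_wgrad_add[OF Um U(2) has_wgrad_Dw[OF vH] has_wgrad_smooth[OF Um U(2) p]]]) simp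
  then have "AE z in lebesgue. z \<in> U \<longrightarrow> Dw U u z = Dw U ?v z + grad p z"
    by (rule Dw_AE_eq[OF U])
  then have ae1: "AE y in lebesgue. y - x \<in> U \<longrightarrow> Dw U u (y - x) = Dw U ?v (y - x) + grad p (y - x)"
    by (rule AE_lebesgue_translate)
  have ae2: "AE y in lebesgue. y \<in> V \<longrightarrow> Dw V u' y = grad w y + ?g' y"
    by (rule Dw_AE_eq[OF V 1])
  \<comment> \<open>The two functions agree on an open neighbourhood of y, so their derivatives
    agree there.\<close>
  have gw: "grad w y = grad p (y - x)" if y: "y - x \<in> U" for y
  proof (rule grad_eqI)
    have "((\<lambda>y. p (y - x)) has_derivative (\<lambda>h. grad (\<lambda>y. p (y - x)) y \<bullet> h)) (at y)"
      by (rule smooth_fun_has_derivative[OF smooth_fun_translate(1)[OF p]])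
    then have "((\<lambda>y. p (y - x)) has_derivative (\<lambda>h. grad p (y - x) \<bullet> h)) (at y)"
      by (simp add: grad_translate[OF p])
    then show "(w has_derivative (\<lambda>h. grad p (y - x) \<bullet> h)) (at y)"
    proof (rule has_derivative_transform_within_open)
      show "open ((\<lambda>y. y - x) -` U)" using U(1) by (intro open_vimage continuous_intros)
    qed (use y wU in auto)
  qed
  from ae1 ae2 show "AE y in lebesgue. y \<in> V \<longrightarrow> Dw V u' y = (if y - x \<in> U then Dw U u (y - x) else grad w y)"
    by eventually_elim (auto simp: shift_extend_def gw)
  show "(\<lambda>y. u' y - p y) \<in> H1_0 V"
  proof -
    let ?d = "\<lambda>y. u' y - p y"
    have \<zeta>s: "smooth_fun ?\<zeta>" by (rule test_fun_smooth[OF \<zeta>])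
    have 2: "has_wgrad V ?d (\<lambda>y. grad ?\<zeta> y + ?g' y)"
      by (rule has_wgrad_cong_fun[OF has_wgrad_add[OF Vm V(2) has_wgrad_smooth[OF Vm V(2) \<zeta>s] wg]]) (simp add: u')
    \<comment> \<open>The approximants are the translated test functions corrected by w - p; this
      summand cancels in both terms of the H1 distance.\<close>
    have tk: "test_fun V (\<lambda>y. \<psi> k y + ?\<zeta> y)" for k by (rule test_fun_add[OF t \<zeta>])
    have e1: "(LINT y:V|lebesgue. (\<psi> k y + ?\<zeta> y - ?d y)\<^sup>2) = (LINT y:V|lebesgue. (\<psi> k y - ?v' y)\<^sup>2)" for k
      by (simp add: u' algebra_simps)
    have e2: "(LINT y:V|lebesgue. (norm (Dw V (\<lambda>y. \<psi> k y + ?\<zeta> y) y - Dw V ?d y))\<^sup>2) = (LINT y:V|lebesgue. (norm (grad (\<psi> k) y - ?g' y))\<^sup>2)" for k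
    proof -
      have g: "has_wgrad V (\<lambda>y. \<psi> k y + ?\<zeta> y) (\<lambda>y. grad (\<psi> k) y + grad ?\<zeta> y)"
        by (rule has_wgrad_add[OF Vm V(2) has_wgrad_smooth[OF Vm V(2) test_fun_smooth[OF t]] has_wgrad_smooth[OF Vm V(2) \<zeta>s]])
      have D1: "has_wgrad V (\<lambda>y. \<psi> k y + ?\<zeta> y) (Dw V (\<lambda>y. \<psi> k y + ?\<zeta> y))"
        by (rule has_wgrad_Dw) (use g in \<open>auto simp: H1_iff\<close>)
      have D2: "has_wgrad V ?d (Dw V ?d)" by (rule has_wgrad_Dw) (use 2 in \<open>auto simp: H1_iff\<close>)
      have D3: "has_wgrad V (\<psi> k) (grad (\<psi> k))" by (rule has_wgrad_smooth[OF Vm V(2) test_fun_smooth[OF t]])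
      show ?thesis
        unfolding set_lebesgue_integral_def
      proof (rule integral_cong_AE)
        have "set_integrable lebesgue V (\<lambda>y. (norm (Dw V (\<lambda>y. \<psi> k y + ?\<zeta> y) y - Dw V ?d y))\<^sup>2)"
          by (rule L2_norm_square_integrable) (use D1 D2 in \<open>auto simp: has_wgrad_def intro!: L2_diff\<close>)
        then show "(\<lambda>y. indicator V y *\<^sub>R (norm (Dw V (\<lambda>y. \<psi> k y + ?\<zeta> y) y - Dw V ?d y))\<^sup>2) \<in> borel_measurable lebesgue"
          unfolding set_integrable_def by (rule borel_measurable_integrable)
        have "set_integrable lebesgue V (\<lambda>y. (norm (grad (\<psi> k) y - ?g' y))\<^sup>2)"
          by (rule L2_norm_square_integrable) (use D3 wg in \<open>auto simp: has_wgrad_def intro!: L2_diff\<close>)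
        then show "(\<lambda>y. indicator V y *\<^sub>R (norm (grad (\<psi> k) y - ?g' y))\<^sup>2) \<in> borel_measurable lebesgue"
          unfolding set_integrable_def by (rule borel_measurable_integrable)
        show "AE y in lebesgue. indicator V y *\<^sub>R (norm (Dw V (\<lambda>y. \<psi> k y + ?\<zeta> y) y - Dw V ?d y))\<^sup>2 = indicator V y *\<^sub>R (norm (grad (\<psi> k) y - ?g' y))\<^sup>2"
          using Dw_AE_eq[OF V g] Dw_AE_eq[OF V 2] by eventually_elim (auto simp: indicator_def)
      qed
    qed
    have "(\<lambda>k. H1_dist V (\<lambda>y. \<psi> k y + ?\<zeta> y) ?d) \<longlonglongrightarrow> sqrt (0 + 0)"
      unfolding H1_dist_def e1 e2 by (intro tendsto_intros l1 l2)
    then show ?thesis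
      unfolding H1_0_def using tk 2 by (auto simp: H1_iff intro!: exI[of _ "\<lambda>k y. \<psi> k y + ?\<zeta> y"])
  qed
qed

section \<open>Comparison of cell problems\<close>

text \<open>Since 1 is at most 2 g', inserting this factor makes the substitution formula applicable
  on compact intervals. Their images are parts of the line, and monotone convergence removes the
  truncation.\<close>

lemma nn_integral_substitution_le:
  fixes g g' :: "real \<Rightarrow> real" and f :: "real \<Rightarrow> ennreal"
  assumes f: "f \<in> borel_measurable borel"
    and g: "\<And>x. (g has_real_derivative g' x) (at x)" and g': "continuous_on UNIV g'" "\<And>x. 1/2 \<le> g' x"
  shows "(\<integral>\<^sup>+x. f (g x) \<partial>lborel) \<le> 2 * (\<integral>\<^sup>+x. f x \<partial>lborel)"
proof -
  have gc: "continuous_on S g" for S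
    using g DERIV_isCont continuous_at_imp_continuous_on by blast
  have fg: "(\<lambda>x. f (g x)) \<in> borel_measurable borel"
    by (rule measurable_compose[OF borel_measurable_continuous_onI[OF gc] f])
  have g'm: "g' \<in> borel_measurable borel" by (rule borel_measurable_continuous_onI[OF g'(1)])
  have gm: "g \<in> borel_measurable borel" by (rule borel_measurable_continuous_onI[OF gc])
  \<comment> \<open>\<open>Suc n\<close> keeps the endpoints distinct also for n = 0.\<close>
  have n: "(\<integral>\<^sup>+x. f (g x) * indicator {- real (Suc n)..real (Suc n)} x \<partial>lborel) \<le> 2 * (\<integral>\<^sup>+x. f x \<partial>lborel)" for n :: nat
  proof -
    have two: "1 \<le> 2 * ennreal (g' x)" for x
    proof -
      have "1 \<le> ennreal (2 * g' x)" using g'(2)[of x] by simp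
      also have "\<dots> = 2 * ennreal (g' x)" using g'(2)[of x] by (simp add: ennreal_mult)
      finally show ?thesis .
    qed
    have "(\<integral>\<^sup>+x. f (g x) * indicator {- real (Suc n)..real (Suc n)} x \<partial>lborel)
        \<le> (\<integral>\<^sup>+x. 2 * (f (g x) * ennreal (g' x) * indicator {- real (Suc n)..real (Suc n)} x) \<partial>lborel)"
    proof (rule nn_integral_mono)
      fix x
      have "f (g x) * indicator {- real (Suc n)..real (Suc n)} x * 1 \<le> f (g x) * indicator {- real (Suc n)..real (Suc n)} x * (2 * ennreal (g' x))"
        by (rule mult_left_mono[OF two]) simp
      then show "f (g x) * indicator {- real (Suc n)..real (Suc n)} x \<le> 2 * (f (g x) * ennreal (g' x) * indicator {- real (Suc n)..real (Suc n)} x)"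
        by (simp add: mult_ac)
    qed
    also have "\<dots> = 2 * (\<integral>\<^sup>+x. f (g x) * ennreal (g' x) * indicator {- real (Suc n)..real (Suc n)} x \<partial>lborel)"
      by (rule nn_integral_cmult) (use fg g'm in measurable)
    also have "(\<integral>\<^sup>+x. f (g x) * ennreal (g' x) * indicator {- real (Suc n)..real (Suc n)} x \<partial>lborel) = (\<integral>\<^sup>+x. f x * indicator {g (- real (Suc n))..g (real (Suc n))} x \<partial>lborel)"
      by (rule nn_integral_substitution_aux[symmetric])
        (use f g continuous_on_subset[OF g'(1)] g'(2) in \<open>auto intro: order_trans[of 0 "1/2"]\<close>)
    also have "\<dots> \<le> (\<integral>\<^sup>+x. f x \<partial>lborel)"
      by (rule nn_integral_mono) (simp add: indicator_def)
    finally show ?thesis by (simp add: mult_left_mono)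
  qed
  have "(\<integral>\<^sup>+x. f (g x) \<partial>lborel) = (\<integral>\<^sup>+x. (SUP n::nat. f (g x) * indicator {- real (Suc n)..real (Suc n)} x) \<partial>lborel)"
  proof (rule nn_integral_cong)
    fix x
    obtain n :: nat where "\<bar>x\<bar> \<le> real n" using real_arch_simple by blast
    then have "f (g x) \<le> f (g x) * indicator {- real (Suc n)..real (Suc n)} x" by (simp add: indicator_def abs_le_iff)
    then have "f (g x) \<le> (SUP n::nat. f (g x) * indicator {- real (Suc n)..real (Suc n)} x)" by (rule SUP_upper2[OF UNIV_I])
    moreover have "(SUP n::nat. f (g x) * indicator {- real (Suc n)..real (Suc n)} x) \<le> f (g x)"
      by (rule SUP_least) (simp add: indicator_def)
    ultimately show "f (g x) = (SUP n::nat. f (g x) * indicator {- real (Suc n)..real (Suc n)} x)" by (rule antisym)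
  qed
  also have "\<dots> = (SUP n::nat. (\<integral>\<^sup>+x. f (g x) * indicator {- real (Suc n)..real (Suc n)} x \<partial>lborel))"
  proof (rule nn_integral_monotone_convergence_SUP)
    show "incseq (\<lambda>n x. f (g x) * indicator {- real (Suc n)..real (Suc n)} x)"
      by (auto simp: incseq_def le_fun_def indicator_def intro!: mult_left_mono)
    show "(\<lambda>x. f (g x) * indicator {- real (Suc n)..real (Suc n)} x) \<in> borel_measurable lborel" for n
      using fg by measurable
  qed
  also have "\<dots> \<le> 2 * (\<integral>\<^sup>+x. f x \<partial>lborel)" by (rule SUP_least) (rule n)
  finally show ?thesis .
qed

section \<open>The planar cell problem\<close>

locale planar_cell = random_medium lam Lam M \<Phi> \<tau> W + frame T e bs
  for lam Lam :: real and M :: "'w measure" and \<Phi> :: "'w \<Rightarrow> real^'n \<Rightarrow> real"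
    and \<tau> :: "real^'n \<Rightarrow> 'w \<Rightarrow> 'w" and W :: "real \<Rightarrow> real"
    and T :: "real^'m \<Rightarrow> real^'n" and e :: "real^'n" and bs :: "'m \<Rightarrow> real^'m" +
  fixes q :: "real \<Rightarrow> real"
  assumes q_range: "\<And>s. -1 \<le> q s \<and> q s \<le> 1" and q_smooth: "smooth1 q"
    and q_energy: "(\<integral>\<^sup>+ s. ennreal (Lam / 2 * (deriv q s)\<^sup>2 + W (q s)) \<partial>lborel) < \<infinity>"
begin

definition admissible :: "real \<Rightarrow> (real^'n \<Rightarrow> real) set" where
  "admissible R = {u. u \<in> H1 (cyl R) \<and> (\<forall>x\<in>cyl R. -1 \<le> u x \<and> u x \<le> 1) \<and> (\<lambda>x. u x - qe q e x) \<in> H1_0 (cyl R)}"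

definition cell_energy :: "'w \<Rightarrow> real \<Rightarrow> ennreal" where
  "cell_energy \<omega> R = (INF u\<in>admissible R. energy \<Phi> \<tau> W \<omega> u (cyl R))"

text \<open>The energy density of the profile q with the upper ellipticity constant; by
  \<open>phiw_square_le\<close> it dominates the density of \<open>qe q e\<close> in every
  medium.\<close>

definition G :: "real \<Rightarrow> real" where "G s = Lam / 2 * (deriv q s)\<^sup>2 + W (q s)"

text \<open>For r at most 0 this is the whole one-dimensional energy of q; \<open>tail 0\<close> is
  used in this sense.\<close>

definition tail :: "real \<Rightarrow> ennreal" where
  "tail r = (\<integral>\<^sup>+s. ennreal (G s) * indicator {s. r \<le> \<bar>s\<bar>} s \<partial>lborel)"

abbreviation V\<^sub>1 :: real where "V\<^sub>1 \<equiv> measure lborel (cube bs 0 1)"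

lemma G_nonneg: "0 \<le> G s"
  using Lam W_nonneg[of "q s"] q_range[of s] by (simp add: G_def)

lemma G_measurable [measurable]: "G \<in> borel_measurable borel"
proof -
  have "continuous_on UNIV G"
    unfolding G_def using q_range
    by (intro continuous_intros continuous_on_compose2[OF W_cont] smooth1_continuous smooth1_deriv q_smooth) auto
  then show ?thesis by (rule borel_measurable_continuous_onI)
qed

lemma smooth_qe: "smooth_fun (qe q e)"
  using smooth_fun_comp[OF q_smooth smooth_fun_affine[of e 0]] by (simp add: qe_def[abs_def])

text \<open>The cutoff switches the vertical shift by x.e on inside the translated cylinder and off outside the larger
  one.\<close>

definition transition_phase :: "real \<Rightarrow> real^'n \<Rightarrow> real \<Rightarrow> real^'n \<Rightarrow> real" where
  "transition_phase \<kappa> x R y = y \<bullet> e - (x \<bullet> e) * cutoff \<kappa> (R/2 + norm x) (R + norm x) y"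

section \<open>Continuing a competitor to a larger cylinder\<close>

context
  fixes x :: "real^'n" and R R' \<kappa> c :: real
  assumes \<kappa>: "0 < \<kappa>" and c: "0 < c" "\<And>s t. \<bar>smooth_step s - smooth_step t\<bar> \<le> c * \<bar>s - t\<bar>"
    and small: "\<bar>x \<bullet> e\<bar> * (2 * (real CARD('m) + 1) * c * \<kappa>) \<le> 1/2"
    and R: "0 < R" and R': "R + 2 * norm x + 2 / \<kappa> + 1 \<le> R'"
begin

abbreviation (input) "\<eta> \<equiv> cutoff \<kappa> (R/2 + norm x) (R + norm x)"
abbreviation (input) "\<theta> \<equiv> transition_phase \<kappa> x R"
abbreviation (input) "w \<equiv> \<lambda>y. q (\<theta> y)"
abbreviation (input) "D \<equiv> {y \<in> cyl R'. y - x \<notin> cyl R}"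

lemma inverse_\<kappa>: "0 < 1 / \<kappa>" "2 / \<kappa> = 2 * (1 / \<kappa>)"
  using \<kappa> by simp_all

lemma smooth_transition_phase: "smooth_fun \<theta>"
proof -
  have "smooth_fun (\<lambda>y. (y \<bullet> e + 0) - (x \<bullet> e) * \<eta> y)"
    by (rule smooth_fun_diff[OF smooth_fun_affine smooth_fun_mult[OF smooth_fun_const smooth_cutoff]])
  then show ?thesis by (simp add: transition_phase_def[abs_def])
qed

lemma smooth_transition: "smooth_fun w"
  by (rule smooth_fun_comp[OF q_smooth smooth_transition_phase])

lemma transition_test_fun: "test_fun (cyl R') (\<lambda>y. w y - qe q e y)"
proof -
  let ?K = "{y. (\<forall>i. \<bar>y \<bullet> T (bs i)\<bar> \<le> R/2 + norm x + 1/\<kappa>) \<and> \<bar>y \<bullet> e\<bar> \<le> R + norm x + 1/\<kappa>}"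
  show ?thesis
  proof (rule test_funI)
    show "smooth_fun (\<lambda>y. w y - qe q e y)" by (rule smooth_fun_diff[OF smooth_transition smooth_qe])
    have "?K = (\<Inter>i\<in>UNIV. {y. \<bar>y \<bullet> T (bs i)\<bar> \<le> R/2 + norm x + 1/\<kappa>}) \<inter> {y. \<bar>y \<bullet> e\<bar> \<le> R + norm x + 1/\<kappa>}"
      by auto
    then have "closed ?K" by (auto intro!: closed_Int closed_INT closed_Collect_le continuous_intros)
    then show "compact ?K" using bounded_coords by (simp add: compact_eq_bounded_closed)
    \<comment> \<open>The margin in \<open>R'\<close> leaves \<open>norm x + 1/\<kappa>\<close> on
      either side laterally, and the extra 1 makes the inequalities strict, so that the compact set
      K fits into the open cylinder.\<close>
    have "R/2 + norm x + 1/\<kappa> < R'/2" "R + norm x + 1/\<kappa> < R'"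
      using R' inverse_\<kappa> norm_ge_zero[of x] by linarith+
    then show "?K \<subseteq> cyl R'" unfolding cyl_def mem_Collect_eq subset_iff by (meson le_less_trans)
    fix y assume "y \<notin> ?K"
    then have "\<eta> y = 0" using \<kappa> by (intro cutoff_eq_0) (auto simp: not_le intro: less_imp_le)
    then show "w y - qe q e y = 0" by (simp add: transition_phase_def qe_def)
  qed
qed

text \<open>The radii of the cutoff exceed those of the cylinder by \<open>norm x\<close>, so it is
  1 on the whole translate, where the phase becomes (y - x).e.\<close>

lemma transition_eq:
  assumes "y - x \<in> cyl R" shows "w y = qe q e (y - x)"
proof -
  have "\<bar>y \<bullet> T (bs i)\<bar> \<le> R/2 + norm x" for i
  proof -
    have "\<bar>y \<bullet> T (bs i)\<bar> \<le> \<bar>(y - x) \<bullet> T (bs i)\<bar> + \<bar>x \<bullet> T (bs i)\<bar>" by (simp add: inner_diff_left)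
    also have "\<dots> \<le> R/2 + norm x"
      using assms inner_T_bs_le[of x i] by (intro add_mono) (auto simp: cyl_def less_imp_le)
    finally show ?thesis .
  qed
  moreover have "\<bar>y \<bullet> e\<bar> \<le> R + norm x"
  proof -
    have "\<bar>y \<bullet> e\<bar> \<le> \<bar>(y - x) \<bullet> e\<bar> + \<bar>x \<bullet> e\<bar>" by (simp add: inner_diff_left)
    also have "\<dots> \<le> R + norm x"
      using assms inner_e_le[of x] by (intro add_mono) (auto simp: cyl_def less_imp_le)
    finally show ?thesis .
  qed
  ultimately have "\<eta> y = 1" by (intro cutoff_eq_1 \<kappa>)
  then show ?thesis by (simp add: transition_phase_def qe_def inner_diff_left)
qed

lemma shift_cyl: "(+) x ` cyl R \<subseteq> cyl R'"
proof
  fix y assume "y \<in> (+) x ` cyl R"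
  then obtain z where z: "z \<in> cyl R" "y = x + z" by auto
  have "\<bar>y \<bullet> T (bs i)\<bar> < R'/2" for i
  proof -
    have "\<bar>y \<bullet> T (bs i)\<bar> \<le> \<bar>x \<bullet> T (bs i)\<bar> + \<bar>z \<bullet> T (bs i)\<bar>" by (simp add: z inner_add_left)
    also have "\<dots> < norm x + R/2"
      using inner_T_bs_le[of x i] z(1) by (intro add_le_less_mono) (auto simp: cyl_def)
    also have "\<dots> \<le> R'/2" using R' inverse_\<kappa> by linarith
    finally show ?thesis .
  qed
  moreover have "\<bar>y \<bullet> e\<bar> < R'"
  proof -
    have "\<bar>y \<bullet> e\<bar> \<le> \<bar>x \<bullet> e\<bar> + \<bar>z \<bullet> e\<bar>" by (simp add: z inner_add_left)
    also have "\<dots> < norm x + R" using inner_e_le[of x] z(1) by (intro add_le_less_mono) (auto simp: cyl_def)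
    also have "\<dots> \<le> R'" using R' inverse_\<kappa> norm_ge_zero[of x] by linarith
    finally show ?thesis .
  qed
  ultimately show "y \<in> cyl R'" by (simp add: cyl_def)
qed

text \<open>The gradient of the phase thus differs from e by a vector of length at most 1/2: its
  norm is at most 3/2 and its component along e at least 1/2.\<close>

lemma grad_cutoff_small: "\<bar>x \<bullet> e\<bar> * norm (grad \<eta> y) \<le> 1/2"
proof -
  have "norm (grad \<eta> y) \<le> 2 * (real CARD('m) + 1) * c * \<kappa>"
    by (rule norm_grad_le_Lipschitz[OF smooth_fun_differentiable[OF smooth_cutoff] cutoff_Lipschitz[OF c(2,1) \<kappa>]])
      (use c \<kappa> in auto)
  then have "\<bar>x \<bullet> e\<bar> * norm (grad \<eta> y) \<le> \<bar>x \<bullet> e\<bar> * (2 * (real CARD('m) + 1) * c * \<kappa>)"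
    by (intro mult_left_mono) auto
  then show ?thesis using small by linarith
qed

lemma transition_phase_has_derivative:
  "(\<theta> has_derivative (\<lambda>h. (e - (x \<bullet> e) *\<^sub>R grad \<eta> y) \<bullet> h)) (at y)"
proof -
  have "((\<lambda>y. y \<bullet> e - (x \<bullet> e) * \<eta> y) has_derivative (\<lambda>h. h \<bullet> e - (x \<bullet> e) * (grad \<eta> y \<bullet> h))) (at y)"
  proof (rule has_derivative_diff)
    show "((\<lambda>y. y \<bullet> e) has_derivative (\<lambda>h. h \<bullet> e)) (at y)" by (auto intro!: derivative_eq_intros)
    show "((\<lambda>y. (x \<bullet> e) * \<eta> y) has_derivative (\<lambda>h. (x \<bullet> e) * (grad \<eta> y \<bullet> h))) (at y)"
      by (rule has_derivative_mult_right[OF smooth_fun_has_derivative[OF smooth_cutoff]])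
  qed
  then show ?thesis
    unfolding transition_phase_def[abs_def] by (simp add: inner_diff_left inner_commute[of e])
qed

lemma norm_grad_transition: "norm (grad w y) \<le> 3/2 * \<bar>deriv q (\<theta> y)\<bar>"
proof -
  let ?v = "e - (x \<bullet> e) *\<^sub>R grad \<eta> y"
  have "((\<lambda>y. q (\<theta> y)) has_derivative (\<lambda>h. deriv q (\<theta> y) * (?v \<bullet> h))) (at y)"
    by (rule has_derivative_compose[OF transition_phase_has_derivative, of q "(*) (deriv q (\<theta> y))"])
      (use smooth1_DERIV[OF q_smooth] in \<open>simp add: has_field_derivative_def\<close>)
  then have "grad w y = deriv q (\<theta> y) *\<^sub>R ?v" by (intro grad_eqI) simp
  then have "norm (grad w y) = \<bar>deriv q (\<theta> y)\<bar> * norm ?v" by simp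
  also have "\<dots> \<le> \<bar>deriv q (\<theta> y)\<bar> * (3/2)"
    using norm_triangle_ineq4[of e "(x \<bullet> e) *\<^sub>R grad \<eta> y"] grad_cutoff_small[of y]
    by (intro mult_left_mono) (simp_all add: e1)
  finally show ?thesis by (simp add: mult.commute)
qed

text \<open>The gradient bound 3/2 enters squared as 9/4; this is rounded up to 3 so that one factor
  serves for the gradient term and for W.\<close>

lemma transition_edens_le:
  assumes \<omega>: "\<omega> \<in> space M" shows "edens \<omega> y (grad w y) (w y) \<le> 3 * G (\<theta> y)"
proof -
  have "(phiw \<Phi> \<tau> \<omega> y (grad w y))\<^sup>2 \<le> Lam * (norm (grad w y))\<^sup>2" by (rule phiw_square_le[OF \<omega>])
  also have "\<dots> \<le> Lam * (3/2 * \<bar>deriv q (\<theta> y)\<bar>)\<^sup>2"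
    using Lam by (intro mult_left_mono power_mono norm_grad_transition) auto
  also have "\<dots> = 9/4 * (Lam * (deriv q (\<theta> y))\<^sup>2)" by (simp add: power_mult_distrib power2_eq_square)
  finally have "1/2 * (phiw \<Phi> \<tau> \<omega> y (grad w y))\<^sup>2 \<le> 9/4 * (Lam / 2 * (deriv q (\<theta> y))\<^sup>2)" by simp
  also have "\<dots> \<le> 3 * (Lam / 2 * (deriv q (\<theta> y))\<^sup>2)" using Lam by (intro mult_right_mono) auto
  moreover have "W (q (\<theta> y)) \<le> 3 * W (q (\<theta> y))" using W_nonneg[of "q (\<theta> y)"] q_range by simp
  ultimately show ?thesis by (simp add: G_def)
qed

text \<open>Along a line parallel to e the phase increases with slope at least 1/2, so it is an
  admissible change of variables at the cost of a factor 2.\<close>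

lemma line_integral_le:
  assumes f: "f \<in> borel_measurable borel"
  shows "(\<integral>\<^sup>+b. f (\<theta> (T a + b *\<^sub>R e)) \<partial>lborel) \<le> 2 * (\<integral>\<^sup>+s. f s \<partial>lborel)"
proof (rule nn_integral_substitution_le[OF f])
  let ?g' = "\<lambda>b. 1 - (x \<bullet> e) * (grad \<eta> (T a + b *\<^sub>R e) \<bullet> e)"
  have "((\<lambda>b. \<theta> (T a + b *\<^sub>R e)) has_derivative (\<lambda>t. (e - (x \<bullet> e) *\<^sub>R grad \<eta> (T a + b *\<^sub>R e)) \<bullet> (t *\<^sub>R e))) (at b)" for b
    by (rule has_derivative_compose[of "\<lambda>b. T a + b *\<^sub>R e" _ b UNIV \<theta>])
      (use transition_phase_has_derivative in \<open>auto intro!: derivative_eq_intros\<close>)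
  moreover have "(\<lambda>t. (e - (x \<bullet> e) *\<^sub>R grad \<eta> (T a + b *\<^sub>R e)) \<bullet> (t *\<^sub>R e)) = (*) (?g' b)" for b
    by (auto simp: inner_diff_left fun_eq_iff)
  ultimately show "((\<lambda>b. \<theta> (T a + b *\<^sub>R e)) has_real_derivative ?g' b) (at b)" for b
    by (simp add: has_field_derivative_def)
  show "continuous_on UNIV ?g'"
    by (intro continuous_intros continuous_on_compose2[OF continuous_on_grad[OF smooth_cutoff, of UNIV]]) auto
  show "1/2 \<le> ?g' b" for b
  proof -
    let ?z = "T a + b *\<^sub>R e"
    have "\<bar>(x \<bullet> e) * (grad \<eta> ?z \<bullet> e)\<bar> \<le> \<bar>x \<bullet> e\<bar> * norm (grad \<eta> ?z)"
      unfolding abs_mult by (intro mult_left_mono inner_e_le) auto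
    then show ?thesis using grad_cutoff_small[of ?z] by (simp add: abs_le_iff)
  qed
qed

lemma D_borel: "D \<in> sets borel"
proof -
  have "D = cyl R' - (\<lambda>y. y - x) -` cyl R" by auto
  moreover have "open ((\<lambda>y. y - x) -` cyl R)" by (intro open_vimage open_cyl continuous_intros)
  ultimately show ?thesis using open_cyl[of R'] by auto
qed

text \<open>The region is sliced by lines parallel to e. Over the annulus between the two bases a
  line may carry all the energy of q; over the smaller base only the part beyond the translated
  cylinder remains, where the phase is large and the tail of q is seen.\<close>

lemma transition_integral_le:
  "(\<integral>\<^sup>+y. ennreal (G (\<theta> y)) * indicator D y \<partial>lborel)
    \<le> ennreal (V\<^sub>1 * (R' ^ CARD('m) - R ^ CARD('m))) * (2 * tail 0) + ennreal (V\<^sub>1 * R' ^ CARD('m)) * (2 * tail (R - 2 * norm x))"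
proof -
  obtain a0 where a0: "x = T a0 + (x \<bullet> e) *\<^sub>R e" by (rule frame_decomp)
  have R'0: "0 < R'" using R R' \<kappa> norm_ge_zero[of x] divide_pos_pos[of 2 \<kappa>] by linarith
  let ?Q = "cube bs 0 R'" and ?P = "cube bs a0 R"
  have cylR': "T a + b *\<^sub>R e \<in> cyl R' \<longleftrightarrow> a \<in> ?Q \<and> \<bar>b\<bar> < R'" for a b
    by (simp add: cyl_def cube_def)
  have cylR: "T a + b *\<^sub>R e - x \<in> cyl R \<longleftrightarrow> a \<in> ?P \<and> \<bar>b - x \<bullet> e\<bar> < R" for a b
  proof -
    have "T a + b *\<^sub>R e - x = T (a - a0) + (b - x \<bullet> e) *\<^sub>R e"
      by (subst a0) (simp add: linear_diff[OF T_lin] algebra_simps)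
    then show ?thesis by (simp add: cyl_def cube_def)
  qed
  \<comment> \<open>The inclusion of the bases is read off from that of the cylinders at the height
    x.e.\<close>
  have sub: "?P \<subseteq> ?Q"
  proof
    fix a assume a: "a \<in> ?P"
    have "T a + (x \<bullet> e) *\<^sub>R e - x \<in> cyl R" using a R by (simp add: cylR)
    then have "T a + (x \<bullet> e) *\<^sub>R e \<in> cyl R'" using shift_cyl by (metis add.commute diff_add_cancel image_eqI subsetD)
    then show "a \<in> ?Q" by (simp add: cylR')
  qed
  \<comment> \<open>From |b - x.e| at least R follows |b| at least R - |x|, and the phase differs
    from b by at most another |x|.\<close>
  let ?r = "R - 2 * norm x"
  let ?f = "\<lambda>s. ennreal (G s)" and ?h = "\<lambda>s. ennreal (G s) * indicator {s. ?r \<le> \<bar>s\<bar>} s"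
  have fm: "?f \<in> borel_measurable borel" "?h \<in> borel_measurable borel" by measurable
  have \<theta>m: "\<theta> \<in> borel_measurable borel"
    by (rule borel_measurable_continuous_onI[OF smooth_fun_continuous[OF smooth_transition_phase]])
  have pt: "?f (\<theta> (T a + b *\<^sub>R e)) * indicator D (T a + b *\<^sub>R e)
      \<le> indicator (?Q - ?P) a * ?f (\<theta> (T a + b *\<^sub>R e)) + indicator ?Q a * ?h (\<theta> (T a + b *\<^sub>R e))" for a b
  proof (cases "T a + b *\<^sub>R e \<in> D")
    case False then show ?thesis by simp
  next
    case True
    then have Q: "a \<in> ?Q" and n: "a \<notin> ?P \<or> R \<le> \<bar>b - x \<bullet> e\<bar>" using cylR' cylR by auto
    show ?thesis
    proof (cases "a \<in> ?P")
      case False then show ?thesis using Q True by (simp add: indicator_def)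
    next
      case a: True
      then have "R \<le> \<bar>b - x \<bullet> e\<bar>" using n by simp
      moreover have "\<theta> (T a + b *\<^sub>R e) = b - (x \<bullet> e) * \<eta> (T a + b *\<^sub>R e)" by (simp add: transition_phase_def)
      moreover have "\<bar>(x \<bullet> e) * \<eta> (T a + b *\<^sub>R e)\<bar> \<le> norm x"
      proof -
        have "\<bar>x \<bullet> e\<bar> * \<bar>\<eta> (T a + b *\<^sub>R e)\<bar> \<le> norm x * 1"
          by (intro mult_mono inner_e_le) (auto simp: cutoff_bounds)
        then show ?thesis by (simp add: abs_mult)
      qed
      ultimately have "?r \<le> \<bar>\<theta> (T a + b *\<^sub>R e)\<bar>" using inner_e_le[of x] by linarith
      then show ?thesis using Q True by (simp add: indicator_def)
    qed
  qed
  have "(\<integral>\<^sup>+y. ?f (\<theta> y) * indicator D y \<partial>lborel) = (\<integral>\<^sup>+a. \<integral>\<^sup>+b. ?f (\<theta> (T a + b *\<^sub>R e)) * indicator D (T a + b *\<^sub>R e) \<partial>lborel \<partial>lborel)"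
    by (rule nn_integral_frame) (use \<theta>m D_borel in measurable)
  also have "\<dots> \<le> (\<integral>\<^sup>+a. indicator (?Q - ?P) a * (2 * tail 0) + indicator ?Q a * (2 * tail ?r) \<partial>lborel)"
  proof (rule nn_integral_mono)
    fix a
    have m: "(\<lambda>b. \<theta> (T a + b *\<^sub>R e)) \<in> borel_measurable borel"
      by (rule measurable_compose[OF _ \<theta>m]) measurable
    have "(\<integral>\<^sup>+b. ?f (\<theta> (T a + b *\<^sub>R e)) * indicator D (T a + b *\<^sub>R e) \<partial>lborel)
      \<le> (\<integral>\<^sup>+b. indicator (?Q - ?P) a * ?f (\<theta> (T a + b *\<^sub>R e)) + indicator ?Q a * ?h (\<theta> (T a + b *\<^sub>R e)) \<partial>lborel)"
      by (rule nn_integral_mono) (rule pt)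
    also have "\<dots> = indicator (?Q - ?P) a * (\<integral>\<^sup>+b. ?f (\<theta> (T a + b *\<^sub>R e)) \<partial>lborel) + indicator ?Q a * (\<integral>\<^sup>+b. ?h (\<theta> (T a + b *\<^sub>R e)) \<partial>lborel)"
      using measurable_compose[OF m fm(1)] measurable_compose[OF m fm(2)]
      by (subst nn_integral_add) (auto simp: nn_integral_cmult)
    also have "\<dots> \<le> indicator (?Q - ?P) a * (2 * (\<integral>\<^sup>+s. ?f s \<partial>lborel)) + indicator ?Q a * (2 * (\<integral>\<^sup>+s. ?h s \<partial>lborel))"
      by (intro add_mono mult_left_mono line_integral_le fm) auto
    finally show "(\<integral>\<^sup>+b. ?f (\<theta> (T a + b *\<^sub>R e)) * indicator D (T a + b *\<^sub>R e) \<partial>lborel)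
      \<le> indicator (?Q - ?P) a * (2 * tail 0) + indicator ?Q a * (2 * tail ?r)"
      by (simp add: tail_def)
  qed
  also have "\<dots> = emeasure lborel (?Q - ?P) * (2 * tail 0) + emeasure lborel ?Q * (2 * tail ?r)"
    by (subst nn_integral_add) (auto simp: nn_integral_multc)
  also have "emeasure lborel (?Q - ?P) = ennreal (V\<^sub>1 * (R' ^ CARD('m) - R ^ CARD('m)))"
    using sub R R'0 by (subst emeasure_Diff) (auto simp: emeasure_cube ennreal_minus right_diff_distrib)
  also have "emeasure lborel ?Q = ennreal (V\<^sub>1 * R' ^ CARD('m))" by (rule emeasure_cube[OF R'0])
  finally show ?thesis .
qed

text \<open>The energy splits over the translated cylinder and the rest D. On the former,
  \<open>phiw_shift\<close> moves the translation into the medium; on D only the smooth transition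
  is present.\<close>

lemma glued_admissible_energy:
  assumes u: "u \<in> admissible R" and \<omega>: "\<omega> \<in> space M"
  shows "\<exists>u'\<in>admissible R'. energy \<Phi> \<tau> W \<omega> u' (cyl R') \<le> energy \<Phi> \<tau> W (\<tau> x \<omega>) u (cyl R)
    + 3 * (\<integral>\<^sup>+y. ennreal (G (\<theta> y)) * indicator D y \<partial>lborel)"
proof -
  let ?U = "cyl R" and ?V = "cyl R'"
  define u' where "u' y = (if y - x \<in> ?U then u (y - x) else w y)" for y
  have uH: "u \<in> H1 ?U" and ur: "\<And>z. z \<in> ?U \<Longrightarrow> -1 \<le> u z \<and> u z \<le> 1" and u0: "(\<lambda>z. u z - qe q e z) \<in> H1_0 ?U"
    using u by (auto simp: admissible_def)
  note glue' = glue_shifted[OF open_cyl bounded_cyl open_cyl bounded_cyl shift_cyl smooth_qe smooth_transition transition_test_fun transition_eq u0,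
      folded u'_def[abs_def]]
  have glue: "u' \<in> H1 ?V" by (rule glue'(1))
  have glue0: "(\<lambda>y. u' y - qe q e y) \<in> H1_0 ?V" unfolding u'_def by (rule glue'(2))
  have glueD: "AE y in lebesgue. y \<in> ?V \<longrightarrow> Dw ?V u' y = (if y - x \<in> ?U then Dw ?U u (y - x) else grad w y)"
    by (rule glue'(3))
  have adm: "u' \<in> admissible R'"
    unfolding admissible_def using glue glue0 ur q_range by (auto simp: u'_def)
  let ?h = "\<lambda>z. ennreal (edens (\<tau> x \<omega>) z (Dw ?U u z) (u z)) * indicator ?U z"
  let ?k = "\<lambda>y. ennreal (edens \<omega> y (grad w y) (w y)) * indicator D y"
  have hm: "?h \<in> borel_measurable lebesgue"
    by (rule edens_measurable[OF tau_space[OF \<omega>] H1_measurable(2,1)[OF uH] _ ur]) (use open_cyl in auto)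
  have Dl: "D \<in> sets lebesgue" using D_borel by simp
  have km: "?k \<in> borel_measurable lebesgue"
  proof (rule edens_measurable[OF \<omega> _ _ Dl])
    have 1: "grad w \<in> borel_measurable lebesgue" "w \<in> borel_measurable lebesgue"
      using borel_measurable_continuous_onI[OF continuous_on_grad[OF smooth_transition]]
        borel_measurable_continuous_onI[OF smooth_fun_continuous[OF smooth_transition]]
      by (auto intro: measurable_completion)
    show "(\<lambda>y. indicator D y *\<^sub>R grad w y) \<in> borel_measurable lebesgue" "(\<lambda>y. indicator D y *\<^sub>R w y) \<in> borel_measurable lebesgue"
      by (rule borel_measurable_scaleR[OF borel_measurable_indicator[OF Dl] 1(1)], rule borel_measurable_scaleR[OF borel_measurable_indicator[OF Dl] 1(2)])
  qed (use q_range in auto)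
  have "energy \<Phi> \<tau> W \<omega> u' ?V = (\<integral>\<^sup>+y. ?h (y - x) + ?k y \<partial>lebesgue)"
    unfolding energy_def
  proof (rule nn_integral_cong_AE)
    show "AE y in lebesgue. ennreal (edens \<omega> y (Dw ?V u' y) (u' y)) * indicator ?V y = ?h (y - x) + ?k y"
      using glueD
    proof eventually_elim
      case (elim y)
      show ?case
      proof (cases "y \<in> ?V")
        case True
        then show ?thesis using elim phiw_shift[OF \<omega>, of x "y - x"] by (auto simp: u'_def indicator_def)
      next
        case False
        then have "y - x \<notin> ?U" using shift_cyl by (metis add.commute diff_add_cancel image_eqI subsetD)
        then show ?thesis using False by simp
      qed
    qed
  qed
  also have "\<dots> = (\<integral>\<^sup>+y. ?h (y - x) \<partial>lebesgue) + (\<integral>\<^sup>+y. ?k y \<partial>lebesgue)"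
    by (rule nn_integral_add[OF borel_measurable_lebesgue_translate[OF hm] km])
  also have "(\<integral>\<^sup>+y. ?h (y - x) \<partial>lebesgue) = energy \<Phi> \<tau> W (\<tau> x \<omega>) u ?U"
    unfolding nn_integral_lebesgue_translate[OF hm] energy_def ..
  finally have split: "energy \<Phi> \<tau> W \<omega> u' ?V = energy \<Phi> \<tau> W (\<tau> x \<omega>) u ?U + (\<integral>\<^sup>+y. ?k y \<partial>lebesgue)" .
  have "(\<integral>\<^sup>+y. ?k y \<partial>lebesgue) \<le> (\<integral>\<^sup>+y. 3 * (ennreal (G (\<theta> y)) * indicator D y) \<partial>lebesgue)"
  proof (rule nn_integral_mono)
    fix y
    have "ennreal (edens \<omega> y (grad w y) (w y)) \<le> ennreal (3 * G (\<theta> y))"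
      by (rule ennreal_leI[OF transition_edens_le[OF \<omega>]])
    also have "\<dots> = 3 * ennreal (G (\<theta> y))" by (simp add: ennreal_mult G_nonneg)
    finally show "?k y \<le> 3 * (ennreal (G (\<theta> y)) * indicator D y)"
      by (simp add: indicator_def)
  qed
  also have "\<dots> = 3 * (\<integral>\<^sup>+y. ennreal (G (\<theta> y)) * indicator D y \<partial>lborel)"
  proof -
    have "\<theta> \<in> borel_measurable borel"
      by (rule borel_measurable_continuous_onI[OF smooth_fun_continuous[OF smooth_transition_phase]])
    then have "(\<lambda>y. ennreal (G (\<theta> y))) \<in> borel_measurable lborel" by measurable
    moreover have "indicator D \<in> borel_measurable lborel" using borel_measurable_indicator[OF D_borel] by simp
    ultimately show ?thesis
      unfolding nn_integral_completion by (intro nn_integral_cmult borel_measurable_times_ennreal)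
  qed
  finally have "energy \<Phi> \<tau> W \<omega> u' ?V \<le> energy \<Phi> \<tau> W (\<tau> x \<omega>) u ?U + 3 * (\<integral>\<^sup>+y. ennreal (G (\<theta> y)) * indicator D y \<partial>lborel)"
    unfolding split by (rule add_left_mono)
  with adm show ?thesis by blast
qed

lemma cell_energy_shift_le:
  assumes \<omega>: "\<omega> \<in> space M"
  shows "cell_energy \<omega> R' \<le> cell_energy (\<tau> x \<omega>) R
    + 3 * (ennreal (V\<^sub>1 * (R' ^ CARD('m) - R ^ CARD('m))) * (2 * tail 0) + ennreal (V\<^sub>1 * R' ^ CARD('m)) * (2 * tail (R - 2 * norm x)))"
    (is "_ \<le> _ + 3 * ?E")
proof (cases "3 * ?E = \<top>")
  case True
  show ?thesis unfolding True by simp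
next
  case False
  \<comment> \<open>The finite error is moved to the left so that the right side is a bare infimum
    and can be treated competitor by competitor.\<close>
  have "cell_energy \<omega> R' - 3 * ?E \<le> cell_energy (\<tau> x \<omega>) R"
    unfolding cell_energy_def[of "\<tau> x \<omega>"]
  proof (rule INF_greatest)
    fix u assume "u \<in> admissible R"
    from glued_admissible_energy[OF this \<omega>] obtain u' where u': "u' \<in> admissible R'"
      "energy \<Phi> \<tau> W \<omega> u' (cyl R') \<le> energy \<Phi> \<tau> W (\<tau> x \<omega>) u (cyl R) + 3 * (\<integral>\<^sup>+y. ennreal (G (\<theta> y)) * indicator D y \<partial>lborel)"
      by blast
    have "cell_energy \<omega> R' \<le> energy \<Phi> \<tau> W \<omega> u' (cyl R')" unfolding cell_energy_def by (rule INF_lower[OF u'(1)])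
    also note u'(2)
    also have "energy \<Phi> \<tau> W (\<tau> x \<omega>) u (cyl R) + 3 * (\<integral>\<^sup>+y. ennreal (G (\<theta> y)) * indicator D y \<partial>lborel) \<le> energy \<Phi> \<tau> W (\<tau> x \<omega>) u (cyl R) + 3 * ?E"
      by (intro add_left_mono mult_left_mono transition_integral_le) auto
    finally show "cell_energy \<omega> R' - 3 * ?E \<le> energy \<Phi> \<tau> W (\<tau> x \<omega>) u (cyl R)"
      using False by (subst ennreal_minus_le_iff) (auto simp: add.commute)
  qed
  then show ?thesis using False by (subst (asm) ennreal_minus_le_iff) (auto simp: add.commute)
qed

end

end

section \<open>Measurability of the cell energy\<close>

text \<open>Integrable functions are reached in successive approximations: from simple functions to
  indicators of open sets by outer regularity, then to finite unions of basis sets, and finally to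
  coefficients in a countable dense set.\<close>

lemma L1_lebesgue_countable_dense:
  obtains C :: "('a::euclidean_space \<Rightarrow> 'b::{banach, second_countable_topology}) set"
  where "countable C"
    and "\<And>f \<epsilon>. integrable lebesgue f \<Longrightarrow> 0 < \<epsilon> \<Longrightarrow> \<exists>g\<in>C. integrable lebesgue g \<and> (\<integral>x. norm (f x - g x) \<partial>lebesgue) < \<epsilon>"
proof -
  obtain \<B> :: "'a set set" where B: "countable \<B>" "topological_basis \<B>"
    using ex_countable_basis by blast
  obtain E :: "'b set" where E: "countable E" "\<And>X. open X \<Longrightarrow> X \<noteq> {} \<Longrightarrow> \<exists>d\<in>E. d \<in> X"
    using countable_dense_exists by blast
  define \<A> where "\<A> = Union ` {F. finite F \<and> F \<subseteq> \<B>}"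
  have cA: "countable \<A>"
    unfolding \<A>_def using B(1) by (intro countable_image countable_Collect_finite_subset)
  \<comment> \<open>Lists of pairs encode simple functions: concatenation is addition, and lists
    over a countable alphabet are countable.\<close>
  define fn :: "('a set \<times> 'b) list \<Rightarrow> 'a \<Rightarrow> 'b" where "fn l x = (\<Sum>(A, d)\<leftarrow>l. indicator A x *\<^sub>R d)" for l x
  define C where "C = fn ` lists (\<A> \<times> E)"
  have cC: "countable C"
    unfolding C_def using cA E(1) by (intro countable_image countable_lists countable_SIGMA)
  have C_add: "(\<lambda>x. f x + g x) \<in> C" if fg: "f \<in> C" "g \<in> C" for f g
  proof -
    obtain k l where k: "k \<in> lists (\<A> \<times> E)" "f = fn k" and l: "l \<in> lists (\<A> \<times> E)" "g = fn l"
      using fg unfolding C_def by blast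
    have "(\<lambda>x. f x + g x) = fn (k @ l)" unfolding k(2) l(2) by (simp add: fn_def fun_eq_iff)
    moreover have "k @ l \<in> lists (\<A> \<times> E)" using k l by simp
    ultimately show ?thesis unfolding C_def by blast
  qed
  have C_ind: "(\<lambda>x. indicator A x *\<^sub>R d) \<in> C" if "A \<in> \<A>" "d \<in> E" for A d
  proof -
    have "(\<lambda>x. indicator A x *\<^sub>R d) = fn [(A, d)]" by (simp add: fn_def fun_eq_iff)
    moreover have "[(A, d)] \<in> lists (\<A> \<times> E)" using that by simp
    ultimately show ?thesis unfolding C_def by blast
  qed
  \<comment> \<open>A basis may contain sets of infinite measure, so members of C can fail to be
    integrable; integrability of the approximant is therefore demanded.\<close>
  define approx where "approx f \<longleftrightarrow> integrable lebesgue f \<and>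
    (\<forall>\<epsilon>>0. \<exists>g\<in>C. integrable lebesgue g \<and> (\<integral>x. norm (f x - g x) \<partial>lebesgue) < \<epsilon>)" for f
  have tri: "(\<integral>x. norm (f x - h x) \<partial>lebesgue) \<le> (\<integral>x. norm (f x - g x) \<partial>lebesgue) + (\<integral>x. norm (g x - h x) \<partial>lebesgue)"
    if "integrable lebesgue f" "integrable lebesgue g" "integrable lebesgue h" for f g h :: "'a \<Rightarrow> 'b"
  proof -
    have "(\<integral>x. norm (f x - h x) \<partial>lebesgue) \<le> (\<integral>x. norm (f x - g x) + norm (g x - h x) \<partial>lebesgue)"
    proof (rule integral_mono)
      show "integrable lebesgue (\<lambda>x. norm (f x - h x))" "integrable lebesgue (\<lambda>x. norm (f x - g x) + norm (g x - h x))"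
        using that by auto
      show "norm (f x - h x) \<le> norm (f x - g x) + norm (g x - h x)" for x
        using norm_triangle_ineq[of "f x - g x" "g x - h x"] by simp
    qed
    also have "\<dots> = (\<integral>x. norm (f x - g x) \<partial>lebesgue) + (\<integral>x. norm (g x - h x) \<partial>lebesgue)"
      using that by (intro Bochner_Integration.integral_add integrable_norm Bochner_Integration.integrable_diff)
    finally show ?thesis .
  qed
  have approx_limit: "approx f"
    if f: "integrable lebesgue f" and s: "\<And>\<epsilon>. 0 < \<epsilon> \<Longrightarrow> \<exists>g. approx g \<and> (\<integral>x. norm (f x - g x) \<partial>lebesgue) < \<epsilon>" for f
    unfolding approx_def
  proof (intro conjI allI impI f)
    fix \<epsilon> :: real assume "0 < \<epsilon>"
    then have e2: "0 < \<epsilon> / 2" by simp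
    obtain g where g: "approx g" "(\<integral>x. norm (f x - g x) \<partial>lebesgue) < \<epsilon> / 2" using s[OF e2] by blast
    obtain h where h: "h \<in> C" "integrable lebesgue h" "(\<integral>x. norm (g x - h x) \<partial>lebesgue) < \<epsilon> / 2"
      using g(1) e2 unfolding approx_def by blast
    have "(\<integral>x. norm (f x - h x) \<partial>lebesgue) < \<epsilon>"
      using tri[OF f _ h(2), of g] g h unfolding approx_def by linarith
    with h show "\<exists>g\<in>C. integrable lebesgue g \<and> (\<integral>x. norm (f x - g x) \<partial>lebesgue) < \<epsilon>" by blast
  qed
  \<comment> \<open>Pointwise limits dominated by twice |f| are what the limit case of
    \<open>integrable_induct\<close> supplies; the exhaustion of an open set by finite unions is of
    this kind too.\<close>
  have approx_seq: "approx f"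
    if f: "integrable lebesgue f" and s: "\<And>i. approx (s i)" and l: "\<And>x. (\<lambda>i. s i x) \<longlonglongrightarrow> f x"
      and b: "\<And>i x. norm (s i x) \<le> 2 * norm (f x)" for f and s :: "nat \<Rightarrow> 'a \<Rightarrow> 'b"
  proof (rule approx_limit[OF f])
    fix \<epsilon> :: real assume \<epsilon>: "0 < \<epsilon>"
    have "(\<lambda>i. \<integral>x. norm (f x - s i x) \<partial>lebesgue) \<longlonglongrightarrow> integral\<^sup>L (lebesgue :: 'a measure) (\<lambda>x. 0)"
    proof (rule integral_dominated_convergence[where w = "\<lambda>x. 3 * norm (f x)"])
      show "integrable lebesgue (\<lambda>x. 3 * norm (f x))" using f by simp
      show "(\<lambda>x. norm (f x - s i x)) \<in> borel_measurable lebesgue" for i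
        using f s[of i] unfolding approx_def by (intro borel_measurable_norm borel_measurable_diff borel_measurable_integrable) auto
      show "AE x in lebesgue. (\<lambda>i. norm (f x - s i x)) \<longlonglongrightarrow> 0"
      proof (intro AE_I2)
        fix x show "(\<lambda>i. norm (f x - s i x)) \<longlonglongrightarrow> 0"
          using tendsto_norm[OF tendsto_diff[OF tendsto_const l[of x], of "f x"]] by simp
      qed
      show "AE x in lebesgue. norm (norm (f x - s i x)) \<le> 3 * norm (f x)" for i
      proof (intro AE_I2)
        fix x show "norm (norm (f x - s i x)) \<le> 3 * norm (f x)"
          using norm_triangle_ineq4[of "f x" "s i x"] b[of i x] by simp
      qed
    qed simp
    then have "\<forall>\<^sub>F i in sequentially. (\<integral>x. norm (f x - s i x) \<partial>lebesgue) < \<epsilon>"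
      using \<epsilon> by (intro order_tendstoD) auto
    then obtain i where "(\<integral>x. norm (f x - s i x) \<partial>lebesgue) < \<epsilon>" unfolding eventually_sequentially by blast
    then show "\<exists>g. approx g \<and> (\<integral>x. norm (f x - g x) \<partial>lebesgue) < \<epsilon>" using s by blast
  qed
  have ind_int: "integrable lebesgue (\<lambda>x. indicator A x *\<^sub>R c)"
    if "A \<in> sets lebesgue" "emeasure lebesgue A < \<infinity>" for A :: "'a set" and c :: 'b
    using that by (intro integrable_scaleR_left integrable_real_indicator)
  have frac: "m * (r / (m + 1)) < r" if "0 \<le> m" "0 < r" for m r :: real
  proof -
    have "0 < m + 1" using that by simp
    then show ?thesis using that by (simp add: pos_divide_less_eq algebra_simps)
  qed
  have approx_A: "approx (\<lambda>x. indicator A x *\<^sub>R c)"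
    if A: "A \<in> \<A>" "A \<in> sets lebesgue" "emeasure lebesgue A < \<infinity>" for A and c :: 'b
    unfolding approx_def
  proof (intro conjI allI impI ind_int A)
    fix \<epsilon> :: real assume \<epsilon>: "0 < \<epsilon>"
    define \<delta> where "\<delta> = \<epsilon> / (measure lebesgue A + 1)"
    have "0 < \<delta>" using \<epsilon> measure_nonneg[of lebesgue A] by (simp add: \<delta>_def add_nonneg_pos)
    then obtain d where d: "d \<in> E" "norm (c - d) < \<delta>" using E(2)[of "ball c \<delta>"] by (auto simp: dist_norm)
    have "(\<integral>x. norm (indicator A x *\<^sub>R c - indicator A x *\<^sub>R d) \<partial>lebesgue) = (\<integral>x. indicator A x * norm (c - d) \<partial>lebesgue)"
      by (intro Bochner_Integration.integral_cong) (auto simp: indicator_def)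
    also have "\<dots> = measure lebesgue A * norm (c - d)" using A by simp
    also have "\<dots> \<le> measure lebesgue A * \<delta>" using d by (intro mult_left_mono) auto
    also have "\<dots> < \<epsilon>" unfolding \<delta>_def using \<epsilon> by (intro frac) auto
    finally show "\<exists>g\<in>C. integrable lebesgue g \<and> (\<integral>x. norm (indicator A x *\<^sub>R c - g x) \<partial>lebesgue) < \<epsilon>"
      using C_ind[OF A(1) d(1)] ind_int[OF A(2,3)] by blast
  qed
  have approx_open: "approx (\<lambda>x. indicator T x *\<^sub>R c)"
    if T: "open T" "emeasure lebesgue T < \<infinity>" for T and c :: 'b
  \<comment> \<open>The enumeration of the basis sets that make up T requires that there be at least
    one.\<close>
  proof (cases "T = {}")
    case True
    have "{} \<in> \<A>" unfolding \<A>_def by (rule image_eqI[of _ _ "{}"]) auto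
    from approx_A[OF this] show ?thesis using True by simp
  next
    case False
    obtain F where F: "F \<subseteq> \<B>" "\<Union>F = T" using topological_basisE[OF B(2) T(1)] B(2) T(1) unfolding topological_basis_def by metis
    have F': "countable F" "F \<noteq> {}" using F B(1) False countable_subset by auto
    let ?S = "\<lambda>n. \<Union>(from_nat_into F ` {..<n})"
    have sub: "?S n \<subseteq> T" for n using F from_nat_into[OF F'(2)] by auto
    have Sop: "open (?S n)" for n
      using F from_nat_into[OF F'(2)] topological_basis_open[OF B(2)] by (intro open_Union) auto
    show ?thesis
    proof (rule approx_seq[of _ "\<lambda>n x. indicator (?S n) x *\<^sub>R c"])
      show "integrable lebesgue (\<lambda>x. indicator T x *\<^sub>R c)" using T by (intro ind_int) auto
      show "approx (\<lambda>x. indicator (?S n) x *\<^sub>R c)" for n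
      proof (rule approx_A)
        show "?S n \<in> \<A>" unfolding \<A>_def using F(1) from_nat_into[OF F'(2)] by (intro imageI) auto
        show "?S n \<in> sets lebesgue" using Sop by auto
        show "emeasure lebesgue (?S n) < \<infinity>"
          using emeasure_mono[OF sub[of n], of lebesgue] T by (auto intro: le_less_trans)
      qed
      show "(\<lambda>n. indicator (?S n) x *\<^sub>R c) \<longlonglongrightarrow> indicator T x *\<^sub>R c" for x
      proof (cases "x \<in> T")
        case True
        then obtain X where X: "X \<in> F" "x \<in> X" using F(2) by blast
        obtain m where m: "from_nat_into F m = X" using from_nat_into_surj[OF F'(1) X(1)] by blast
        have "indicator (?S n) x *\<^sub>R c = indicator T x *\<^sub>R c" if "n > m" for n
        proof -
          have "x \<in> ?S n" using m X(2) that by auto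
          then show ?thesis using True by simp
        qed
        then show ?thesis
          by (intro tendsto_eventually) (auto simp: eventually_sequentially intro!: exI[of _ "Suc m"])
      next
        case False
        then have "x \<notin> ?S n" for n using sub by blast
        then have "(\<lambda>n. indicator (?S n) x *\<^sub>R c) = (\<lambda>n. indicator T x *\<^sub>R c)"
          using False by (simp add: indicator_def)
        then show ?thesis by simp
      qed
      show "norm (indicator (?S n) x *\<^sub>R c) \<le> 2 * norm (indicator T x *\<^sub>R c)" for n x
      proof -
        have "x \<in> ?S n \<Longrightarrow> x \<in> T" using sub by blast
        then show ?thesis by (auto simp: indicator_def)
      qed
    qed
  qed
  have approx_all: "approx f" if "integrable lebesgue f" for f
    using that
  proof (induction f rule: integrable_induct)
    case (base A c)
    show ?case
    proof (rule approx_limit)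
      show "integrable lebesgue (\<lambda>x. indicator A x *\<^sub>R c)" using base by (intro ind_int)
      fix \<epsilon> :: real assume \<epsilon>: "0 < \<epsilon>"
      define \<delta> where "\<delta> = \<epsilon> / (norm c + 1)"
      have \<delta>: "0 < \<delta>" using \<epsilon> by (simp add: \<delta>_def add_nonneg_pos)
      obtain T where T: "open T" "A \<subseteq> T" "(T - A) \<in> lmeasurable" "emeasure lebesgue (T - A) < ennreal \<delta>"
        using sets_lebesgue_outer_open[OF base(1) \<delta>] by blast
      have Tm: "emeasure lebesgue T < \<infinity>"
      proof -
        have "emeasure lebesgue T \<le> emeasure lebesgue A + emeasure lebesgue (T - A)"
          using emeasure_subadditive[of A lebesgue "T - A"] base(1) T by (auto simp: Un_absorb1)
        also have "\<dots> < \<infinity>" using base(2) T(4) by (auto simp: less_top[symmetric])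
        finally show ?thesis .
      qed
      have "(\<integral>x. norm (indicator A x *\<^sub>R c - indicator T x *\<^sub>R c) \<partial>lebesgue) = (\<integral>x. indicator (T - A) x * norm c \<partial>lebesgue)"
        using T(2) by (intro Bochner_Integration.integral_cong) (auto simp: indicator_def)
      also have "\<dots> = measure lebesgue (T - A) * norm c" using T(3) by (auto simp: fmeasurable_def)
      also have "\<dots> \<le> \<delta> * norm c"
      proof (rule mult_right_mono)
        have "ennreal (measure lebesgue (T - A)) < ennreal \<delta>" using T(3,4) by (simp add: emeasure_eq_measure2)
        then show "measure lebesgue (T - A) \<le> \<delta>" using \<delta> by (simp add: ennreal_less_iff)
      qed simp
      also have "\<dots> < \<epsilon>" unfolding \<delta>_def using frac[of "norm c" \<epsilon>] \<epsilon> by (simp add: mult.commute)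
      finally show "\<exists>g. approx g \<and> (\<integral>x. norm (indicator A x *\<^sub>R c - g x) \<partial>lebesgue) < \<epsilon>"
        using approx_open[OF T(1) Tm] by blast
    qed
  next
    case (add f g)
    show ?case
      unfolding approx_def
    proof (intro conjI allI impI)
      show "integrable lebesgue (\<lambda>x. f x + g x)" using add by simp
      fix \<epsilon> :: real assume "0 < \<epsilon>"
      then have e2: "0 < \<epsilon> / 2" by simp
      obtain f' where f': "f' \<in> C" "integrable lebesgue f'" "(\<integral>x. norm (f x - f' x) \<partial>lebesgue) < \<epsilon> / 2"
        using add e2 unfolding approx_def by blast
      obtain g' where g': "g' \<in> C" "integrable lebesgue g'" "(\<integral>x. norm (g x - g' x) \<partial>lebesgue) < \<epsilon> / 2"
        using add e2 unfolding approx_def by blast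
      have "(\<integral>x. norm (f x + g x - (f' x + g' x)) \<partial>lebesgue) \<le> (\<integral>x. norm (f x - f' x) + norm (g x - g' x) \<partial>lebesgue)"
        using add f' g' by (intro integral_mono) (auto intro!: norm_diff_triangle_ineq)
      also have "\<dots> = (\<integral>x. norm (f x - f' x) \<partial>lebesgue) + (\<integral>x. norm (g x - g' x) \<partial>lebesgue)"
        using add f' g' by (intro Bochner_Integration.integral_add integrable_norm Bochner_Integration.integrable_diff)
      finally have "(\<integral>x. norm (f x + g x - (f' x + g' x)) \<partial>lebesgue) < \<epsilon>" using f' g' by linarith
      moreover have "integrable lebesgue (\<lambda>x. f' x + g' x)" using f' g' by simp
      ultimately show "\<exists>h\<in>C. integrable lebesgue h \<and> (\<integral>x. norm (f x + g x - h x) \<partial>lebesgue) < \<epsilon>"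
        using C_add[OF f'(1) g'(1)] by blast
    qed
  next
    case (lim f s)
    then show ?case by (intro approx_seq[of f s]) auto
  qed
  show ?thesis
    using that[OF cC] approx_all unfolding approx_def by blast
qed

text \<open>The dense functions need not belong to S. For every dense c and every n, one element of
  S within distance 1/(n+1) of c is chosen whenever there is one; the triangle inequality makes
  these choices dense in S.\<close>

lemma L1_lebesgue_subset_separable:
  fixes S :: "('a::euclidean_space \<Rightarrow> 'b::{banach, second_countable_topology}) set"
  assumes S: "\<And>f. f \<in> S \<Longrightarrow> integrable lebesgue f"
  obtains D where "countable D" "D \<subseteq> S"
    "\<And>f \<epsilon>. f \<in> S \<Longrightarrow> 0 < \<epsilon> \<Longrightarrow> \<exists>g\<in>D. (\<integral>x. norm (f x - g x) \<partial>lebesgue) < \<epsilon>"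
proof -
  obtain C :: "('a \<Rightarrow> 'b) set" where C: "countable C"
    "\<And>f \<epsilon>. integrable lebesgue f \<Longrightarrow> 0 < \<epsilon> \<Longrightarrow> \<exists>g\<in>C. integrable lebesgue g \<and> (\<integral>x. norm (f x - g x) \<partial>lebesgue) < \<epsilon>"
    using L1_lebesgue_countable_dense by blast
  define P where "P c n f \<longleftrightarrow> f \<in> S \<and> integrable lebesgue c \<and> (\<integral>x. norm (f x - c x) \<partial>lebesgue) < inverse (real (Suc n))" for c n f
  define D where "D = (\<lambda>(c, n). SOME f. P c n f) ` {(c, n). c \<in> C \<and> (\<exists>f. P c n f)}"
  have "countable {(c, n). c \<in> C \<and> (\<exists>f. P c n f)}"
    by (rule countable_subset[of _ "C \<times> (UNIV :: nat set)"]) (use C(1) in auto)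
  then have "countable D" unfolding D_def by (rule countable_image)
  moreover have "D \<subseteq> S"
  proof
    fix f assume "f \<in> D"
    then obtain c n where "f = (SOME f. P c n f)" "\<exists>f. P c n f" unfolding D_def by auto
    then have "P c n f" using someI_ex by metis
    then show "f \<in> S" by (simp add: P_def)
  qed
  moreover have "\<exists>g\<in>D. (\<integral>x. norm (f x - g x) \<partial>lebesgue) < \<epsilon>" if f: "f \<in> S" and \<epsilon>: "0 < \<epsilon>" for f \<epsilon>
  proof -
    obtain n where n: "inverse (real (Suc n)) < \<epsilon> / 2" using reals_Archimedean[of "\<epsilon> / 2"] \<epsilon> by auto
    obtain c where c: "c \<in> C" "integrable lebesgue c" "(\<integral>x. norm (f x - c x) \<partial>lebesgue) < inverse (real (Suc n))"
      using C(2)[OF S[OF f], of "inverse (real (Suc n))"] by auto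
    then have ex: "\<exists>f. P c n f" using f unfolding P_def by blast
    define g where "g = (SOME f. P c n f)"
    have g: "P c n g" unfolding g_def by (rule someI_ex[OF ex])
    have "g \<in> D" unfolding D_def g_def using c(1) ex by (intro image_eqI[of _ _ "(c, n)"]) auto
    moreover have "(\<integral>x. norm (f x - g x) \<partial>lebesgue) < \<epsilon>"
    proof -
      have gi: "integrable lebesgue g" using g S by (simp add: P_def)
      note fi = S[OF f]
      have "(\<integral>x. norm (f x - g x) \<partial>lebesgue) \<le> (\<integral>x. norm (f x - c x) + norm (g x - c x) \<partial>lebesgue)"
      proof (rule integral_mono)
        show "integrable lebesgue (\<lambda>x. norm (f x - g x))" "integrable lebesgue (\<lambda>x. norm (f x - c x) + norm (g x - c x))"
          using gi fi c(2) by auto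
        show "norm (f x - g x) \<le> norm (f x - c x) + norm (g x - c x)" for x
          using norm_triangle_ineq4[of "f x - c x" "g x - c x"] by simp
      qed
      also have "\<dots> = (\<integral>x. norm (f x - c x) \<partial>lebesgue) + (\<integral>x. norm (g x - c x) \<partial>lebesgue)"
        using gi fi c(2) by (intro Bochner_Integration.integral_add) auto
      also have "\<dots> < \<epsilon>" using c(3) g n unfolding P_def by linarith
      finally show ?thesis .
    qed
    ultimately show ?thesis by blast
  qed
  ultimately show ?thesis by (rule that)
qed

text \<open>In the identity \<open>eq\<close> the last term is controlled because | |p|^2 - |r|^2 |
  is the difference of the norms of |p| p and |r| r. Twice that distance and once more give the
  factor 3.\<close>

lemma norm_scale_diff_le:
  fixes p r :: "'a::real_normed_vector"
  shows "(norm p + norm r) * norm (p - r) \<le> 3 * norm (norm p *\<^sub>R p - norm r *\<^sub>R r)"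
proof -
  let ?N = "norm (norm p *\<^sub>R p - norm r *\<^sub>R r)"
  have eq: "(norm p + norm r) *\<^sub>R (p - r) = 2 *\<^sub>R (norm p *\<^sub>R p - norm r *\<^sub>R r) - (norm p - norm r) *\<^sub>R (p + r)"
    unfolding scaleR_2 scaleR_left_distrib scaleR_right_distrib scaleR_left_diff_distrib scaleR_right_diff_distrib
    by simp
  have "(norm p + norm r) * norm (p - r) = norm ((norm p + norm r) *\<^sub>R (p - r))" by simp
  also have "\<dots> \<le> 2 * ?N + \<bar>norm p - norm r\<bar> * norm (p + r)"
    unfolding eq by (rule order_trans[OF norm_triangle_ineq4]) simp
  also have "\<bar>norm p - norm r\<bar> * norm (p + r) \<le> \<bar>norm p - norm r\<bar> * (norm p + norm r)"
    by (intro mult_left_mono norm_triangle_ineq) simp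
  also have "\<bar>norm p - norm r\<bar> * (norm p + norm r) = \<bar>norm (norm p *\<^sub>R p) - norm (norm r *\<^sub>R r)\<bar>"
  proof -
    have "\<bar>norm p - norm r\<bar> * (norm p + norm r) = \<bar>(norm p - norm r) * (norm p + norm r)\<bar>"
      by (simp add: abs_mult)
    also have "(norm p - norm r) * (norm p + norm r) = norm p * norm p - norm r * norm r" by (simp add: algebra_simps)
    finally show ?thesis by simp
  qed
  also have "\<dots> \<le> ?N" by (rule norm_triangle_ineq3)
  finally show ?thesis by simp
qed

section \<open>Reducing an uncountable infimum to a countable one\<close>

context random_medium
begin

text \<open>The difference of squares is factored; growth and Lipschitz bounds reduce it to the
  product (|p| + |r|) |p - r|. The constant does not depend on the medium.\<close>

lemma phiw_square_diff_le:
  assumes \<omega>: "\<omega> \<in> space M"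
  shows "(phiw \<Phi> \<tau> \<omega> x p)\<^sup>2 \<le> (phiw \<Phi> \<tau> \<omega> x r)\<^sup>2 + 3 * Lam * norm (norm p *\<^sub>R p - norm r *\<^sub>R r)"
proof -
  have f: "\<Phi> (\<tau> x \<omega>) \<in> Fd lam Lam" using \<omega> by (simp add: Phi_Fd tau_space)
  let ?h = "hom_ext (\<Phi> (\<tau> x \<omega>))"
  have "(?h p)\<^sup>2 - (?h r)\<^sup>2 = (?h p + ?h r) * (?h p - ?h r)" by (simp add: power2_eq_square algebra_simps)
  also have "\<dots> \<le> (?h p + ?h r) * \<bar>?h p - ?h r\<bar>"
    using hom_ext_nonneg[OF lam f] by (intro mult_left_mono) auto
  also have "\<dots> \<le> (sqrt Lam * norm p + sqrt Lam * norm r) * (sqrt Lam * norm (p - r))"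
    using hom_ext_nonneg[OF lam f] Lam by (intro mult_mono add_mono hom_ext_le[OF f] hom_ext_Lipschitz[OF f]) auto
  also have "\<dots> = Lam * ((norm p + norm r) * norm (p - r))"
  proof -
    have "(sqrt Lam * norm p + sqrt Lam * norm r) * (sqrt Lam * norm (p - r)) = (sqrt Lam * sqrt Lam) * ((norm p + norm r) * norm (p - r))"
      by (simp only: distrib_left distrib_right mult_ac)
    then show ?thesis using Lam by simp
  qed
  also have "\<dots> \<le> Lam * (3 * norm (norm p *\<^sub>R p - norm r *\<^sub>R r))"
    using Lam by (intro mult_left_mono norm_scale_diff_le) auto
  finally show ?thesis by (simp add: phiw_eq algebra_simps)
qed

text \<open>The energy density is Lipschitz in |p| p, although quadratic in p; so separability of L1 suffices.\<close>

definition eprofile :: "(real^'n) set \<Rightarrow> (real^'n \<Rightarrow> real) \<Rightarrow> real^'n \<Rightarrow> real \<times> (real^'n)" where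
  "eprofile U u x = indicator U x *\<^sub>R (W (u x), norm (Dw U u x) *\<^sub>R Dw U u x)"

text \<open>W is bounded on [-1,1] and U has finite measure, while the vector part has norm |Du|^2,
  integrable because u is in H1.\<close>

lemma eprofile_integrable:
  assumes U: "open U" "bounded U" and u: "u \<in> H1 U" and r: "\<And>x. x \<in> U \<Longrightarrow> -1 \<le> u x \<and> u x \<le> 1"
  shows "integrable lebesgue (eprofile U u)"
proof -
  have Um: "U \<in> sets lebesgue" using U(1) by simp
  have fin: "emeasure lebesgue U < \<infinity>"
    using fmeasurableD2[OF bounded_set_imp_lmeasurable[OF U(2) Um]] by (simp add: less_top)
  have "compact (W ` {-1..1})" by (intro compact_continuous_image W_cont compact_Icc)
  then obtain B where B: "\<And>y. y \<in> W ` {-1..1} \<Longrightarrow> norm y \<le> B" using compact_imp_bounded bounded_iff by metis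
  have Wm: "(\<lambda>x. indicator U x * W (u x)) \<in> borel_measurable lebesgue"
  proof -
    have "(\<lambda>x. indicator U x * W' (indicator U x *\<^sub>R u x)) \<in> borel_measurable lebesgue"
      using measurable_compose[OF H1_measurable(1)[OF u] W'_measurable] Um
      by (intro borel_measurable_times borel_measurable_indicator)
    also have "(\<lambda>x. indicator U x * W' (indicator U x *\<^sub>R u x)) = (\<lambda>x. indicator U x * W (u x))"
      using r by (auto simp: fun_eq_iff indicator_def W'_eq)
    finally show ?thesis .
  qed
  let ?g = "\<lambda>x. indicator U x *\<^sub>R Dw U u x"
  have gm: "?g \<in> borel_measurable lebesgue" by (rule H1_measurable(2)[OF u])
  have eq: "eprofile U u = (\<lambda>x. (indicator U x * W (u x), norm (?g x) *\<^sub>R ?g x))"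
    by (auto simp: eprofile_def fun_eq_iff indicator_def zero_prod_def)
  have D: "set_integrable lebesgue U (\<lambda>x. (norm (Dw U u x))\<^sup>2)"
    by (rule L2_norm_square_integrable) (use has_wgrad_Dw[OF u] in \<open>auto simp: has_wgrad_def\<close>)
  show ?thesis
  proof (rule Bochner_Integration.integrable_bound)
    show "integrable lebesgue (\<lambda>x. B * indicator U x + indicator U x *\<^sub>R (norm (Dw U u x))\<^sup>2)"
      using D fin Um unfolding set_integrable_def
      by (intro Bochner_Integration.integrable_add integrable_mult_right integrable_real_indicator)
    show "eprofile U u \<in> borel_measurable lebesgue"
      unfolding eq by (rule borel_measurable_Pair[OF Wm borel_measurable_scaleR[OF measurable_compose[OF gm borel_measurable_norm] gm]])
    show "AE x in lebesgue. norm (eprofile U u x) \<le> norm (B * indicator U x + indicator U x *\<^sub>R (norm (Dw U u x))\<^sup>2)"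
    proof (intro AE_I2)
      fix x
      show "norm (eprofile U u x) \<le> norm (B * indicator U x + indicator U x *\<^sub>R (norm (Dw U u x))\<^sup>2)"
      proof (cases "x \<in> U")
        case True
        have "norm (eprofile U u x) \<le> norm (W (u x)) + norm (norm (Dw U u x) *\<^sub>R Dw U u x)"
          using True norm_Pair_le[of "W (u x)" "norm (Dw U u x) *\<^sub>R Dw U u x"] by (simp add: eprofile_def)
        also have "\<dots> \<le> B + (norm (Dw U u x))\<^sup>2"
          using B[of "W (u x)"] r[OF True] by (simp add: power2_eq_square)
        finally show ?thesis using True by simp
      qed (simp add: eprofile_def)
    qed
  qed
qed

text \<open>Half of the constant 3 Lam comes from the gradient term, and 1 from W; each component of
  the profile difference is bounded by its norm.\<close>

lemma energy_le_eprofile: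
  assumes \<omega>: "\<omega> \<in> space M" and U: "open U" "bounded U"
    and u: "u \<in> H1 U" "\<And>x. x \<in> U \<Longrightarrow> -1 \<le> u x \<and> u x \<le> 1"
    and v: "v \<in> H1 U" "\<And>x. x \<in> U \<Longrightarrow> -1 \<le> v x \<and> v x \<le> 1"
  shows "energy \<Phi> \<tau> W \<omega> v U \<le> energy \<Phi> \<tau> W \<omega> u U
    + ennreal ((3/2 * Lam + 1) * (\<integral>x. norm (eprofile U u x - eprofile U v x) \<partial>lebesgue))"
proof -
  let ?N = "\<lambda>x. norm (eprofile U u x - eprofile U v x)" and ?K = "3/2 * Lam + 1"
  have iu: "integrable lebesgue (eprofile U u)" and iv: "integrable lebesgue (eprofile U v)"
    using eprofile_integrable[OF U] u v by blast+
  then have iN: "integrable lebesgue ?N" by simp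
  have um: "(\<lambda>x. ennreal (edens \<omega> x (Dw U u x) (u x)) * indicator U x) \<in> borel_measurable lebesgue"
    by (rule edens_measurable[OF \<omega> H1_measurable(2,1)[OF u(1)] _ u(2)]) (use U in auto)
  have pt: "ennreal (edens \<omega> x (Dw U v x) (v x)) * indicator U x \<le> ennreal (edens \<omega> x (Dw U u x) (u x)) * indicator U x + ennreal (?K * ?N x)" for x
  proof (cases "x \<in> U")
    case True
    let ?P = "norm (Dw U u x) *\<^sub>R Dw U u x" and ?Q = "norm (Dw U v x) *\<^sub>R Dw U v x"
    have d: "eprofile U u x - eprofile U v x = (W (u x) - W (v x), ?P - ?Q)" using True by (simp add: eprofile_def)
    have n1: "\<bar>W (u x) - W (v x)\<bar> \<le> ?N x"
      using norm_fst_le[of "W (u x) - W (v x)" "?P - ?Q"] unfolding d by simp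
    have n2: "norm (?P - ?Q) \<le> ?N x"
      using norm_snd_le[of "?P - ?Q" "W (u x) - W (v x)"] unfolding d by simp
    have "(phiw \<Phi> \<tau> \<omega> x (Dw U v x))\<^sup>2 \<le> (phiw \<Phi> \<tau> \<omega> x (Dw U u x))\<^sup>2 + 3 * Lam * norm (?Q - ?P)"
      by (rule phiw_square_diff_le[OF \<omega>])
    also have "\<dots> \<le> (phiw \<Phi> \<tau> \<omega> x (Dw U u x))\<^sup>2 + 3 * Lam * ?N x"
      using n2 Lam by (intro add_left_mono mult_left_mono) (auto simp: norm_minus_commute)
    finally have "edens \<omega> x (Dw U v x) (v x) \<le> edens \<omega> x (Dw U u x) (u x) + ?K * ?N x"
      using n1 by (simp add: algebra_simps)
    then have "ennreal (edens \<omega> x (Dw U v x) (v x)) \<le> ennreal (edens \<omega> x (Dw U u x) (u x) + ?K * ?N x)"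
      by (rule ennreal_leI)
    also have "\<dots> = ennreal (edens \<omega> x (Dw U u x) (u x)) + ennreal (?K * ?N x)"
      using Lam W_nonneg[of "u x"] u(2)[OF True] by (intro ennreal_plus) auto
    finally show ?thesis using True by simp
  qed simp
  have "energy \<Phi> \<tau> W \<omega> v U \<le> (\<integral>\<^sup>+x. ennreal (edens \<omega> x (Dw U u x) (u x)) * indicator U x + ennreal (?K * ?N x) \<partial>lebesgue)"
    unfolding energy_def by (rule nn_integral_mono) (rule pt)
  also have "\<dots> = energy \<Phi> \<tau> W \<omega> u U + (\<integral>\<^sup>+x. ennreal (?K * ?N x) \<partial>lebesgue)"
    unfolding energy_def using um iN by (intro nn_integral_add) auto
  also have "(\<integral>\<^sup>+x. ennreal (?K * ?N x) \<partial>lebesgue) = ennreal (\<integral>x. ?K * ?N x \<partial>lebesgue)"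
    using iN Lam by (intro nn_integral_eq_integral) auto
  also have "(\<integral>x. ?K * ?N x \<partial>lebesgue) = ?K * (\<integral>x. ?N x \<partial>lebesgue)" by simp
  finally show ?thesis .
qed

text \<open>A countable set of competitors with dense profiles realises the infimum. It can be fixed
  before the medium, since the estimate of the energies by profiles is uniform in the
  medium.\<close>

lemma INF_energy_measurable:
  assumes U: "open U" "bounded U"
    and S: "\<And>u. u \<in> S \<Longrightarrow> u \<in> H1 U" "\<And>u x. u \<in> S \<Longrightarrow> x \<in> U \<Longrightarrow> -1 \<le> u x \<and> u x \<le> 1"
  shows "(\<lambda>\<omega>. INF u\<in>S. energy \<Phi> \<tau> W \<omega> u U) \<in> borel_measurable M"
proof -
  have int: "integrable lebesgue f" if "f \<in> eprofile U ` S" for f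
    using that S eprofile_integrable[OF U] by blast
  obtain D where D: "countable D" "D \<subseteq> eprofile U ` S"
    "\<And>f \<epsilon>. f \<in> eprofile U ` S \<Longrightarrow> 0 < \<epsilon> \<Longrightarrow> \<exists>g\<in>D. (\<integral>x. norm (f x - g x) \<partial>lebesgue) < \<epsilon>"
    using L1_lebesgue_subset_separable[of "eprofile U ` S", OF int] by blast
  obtain S' where S': "countable S'" "S' \<subseteq> S" "D = eprofile U ` S'"
    using D(1,2) countable_subset_image by meson
  have "(INF u\<in>S. energy \<Phi> \<tau> W \<omega> u U) = (INF u\<in>S'. energy \<Phi> \<tau> W \<omega> u U)" if \<omega>: "\<omega> \<in> space M" for \<omega>
  proof (rule antisym)
    show "(INF u\<in>S. energy \<Phi> \<tau> W \<omega> u U) \<le> (INF u\<in>S'. energy \<Phi> \<tau> W \<omega> u U)"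
      by (rule INF_superset_mono[OF S'(2)]) simp
    show "(INF u\<in>S'. energy \<Phi> \<tau> W \<omega> u U) \<le> (INF u\<in>S. energy \<Phi> \<tau> W \<omega> u U)"
    proof (rule INF_greatest)
      fix u assume u: "u \<in> S"
      show "(INF u\<in>S'. energy \<Phi> \<tau> W \<omega> u U) \<le> energy \<Phi> \<tau> W \<omega> u U"
      proof (rule ennreal_le_epsilon)
        fix \<epsilon> :: real assume \<epsilon>: "0 < \<epsilon>"
        let ?K = "3/2 * Lam + 1"
        have K: "0 < ?K" using Lam by simp
        obtain v where v: "v \<in> S'" "(\<integral>x. norm (eprofile U u x - eprofile U v x) \<partial>lebesgue) < \<epsilon> / ?K"
          using D(3)[of "eprofile U u" "\<epsilon> / ?K"] u K \<epsilon> unfolding S'(3) by auto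
        then have "v \<in> S" using S' by blast
        have "(INF u\<in>S'. energy \<Phi> \<tau> W \<omega> u U) \<le> energy \<Phi> \<tau> W \<omega> v U" by (rule INF_lower[OF v(1)])
        also have "\<dots> \<le> energy \<Phi> \<tau> W \<omega> u U + ennreal (?K * (\<integral>x. norm (eprofile U u x - eprofile U v x) \<partial>lebesgue))"
          by (rule energy_le_eprofile[OF \<omega> U S(1)[OF u] S(2)[OF u] S(1)[OF \<open>v \<in> S\<close>] S(2)[OF \<open>v \<in> S\<close>]])
        also have "\<dots> \<le> energy \<Phi> \<tau> W \<omega> u U + ennreal \<epsilon>"
          using v(2) K by (intro add_left_mono ennreal_leI) (simp add: field_simps)
        finally show "(INF u\<in>S'. energy \<Phi> \<tau> W \<omega> u U) \<le> energy \<Phi> \<tau> W \<omega> u U + ennreal \<epsilon>" .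
      qed
    qed
  qed
  moreover have "(\<lambda>\<omega>. INF u\<in>S'. energy \<Phi> \<tau> W \<omega> u U) \<in> borel_measurable M"
    using S' S U(1) by (intro borel_measurable_INF energy_measurable) auto
  ultimately show ?thesis by (subst measurable_cong)
qed

end

section \<open>The effective surface tension\<close>

lemma Liminf_at_top_le_sequentially:
  fixes f :: "real \<Rightarrow> ennreal"
  shows "Liminf at_top f \<le> Liminf sequentially (\<lambda>n. f (real n))"
  unfolding le_Liminf_iff
proof (intro allI impI)
  fix y assume "y < Liminf at_top f"
  from eventually_compose_filterlim[OF less_LiminfD[OF this] filterlim_real_sequentially]
  show "\<forall>\<^sub>F n in sequentially. y < f (real n)" .
qed

context planar_cell
begin

lemma cell_energy_measurable: "(\<lambda>\<omega>. cell_energy \<omega> R) \<in> borel_measurable M"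
  unfolding cell_energy_def
  by (rule INF_energy_measurable[OF open_cyl bounded_cyl]) (auto simp: admissible_def)

text \<open>A real-valued copy of \<open>tail\<close>, for limits and arithmetic over the
  reals.\<close>

definition tailr :: "real \<Rightarrow> real" where
  "tailr r = (\<integral>s. G s * indicator {s. r \<le> \<bar>s\<bar>} s \<partial>lborel)"

lemma G_integrable: "integrable lborel G"
proof (rule integrableI_bounded)
  have "ennreal (norm (G s)) = ennreal (Lam / 2 * (deriv q s)\<^sup>2 + W (q s))" for s
    using G_nonneg[of s] by (simp add: G_def)
  then show "(\<integral>\<^sup>+s. ennreal (norm (G s)) \<partial>lborel) < \<infinity>" using q_energy by simp
qed simp

lemma tail_eq: "tail r = ennreal (tailr r)" and tailr_nonneg: "0 \<le> tailr r"
proof -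
  have "integrable lborel (\<lambda>s. G s * indicator {s. r \<le> \<bar>s\<bar>} s)"
    by (rule Bochner_Integration.integrable_bound[OF G_integrable]) (auto simp: indicator_def)
  then have "(\<integral>\<^sup>+s. ennreal (G s * indicator {s. r \<le> \<bar>s\<bar>} s) \<partial>lborel) = ennreal (tailr r)"
    unfolding tailr_def using G_nonneg by (intro nn_integral_eq_integral) auto
  moreover have "ennreal (G s * indicator {s. r \<le> \<bar>s\<bar>} s) = ennreal (G s) * indicator {s. r \<le> \<bar>s\<bar>} s" for s
    by (simp add: indicator_def)
  ultimately show "tail r = ennreal (tailr r)" by (simp add: tail_def)
  show "0 \<le> tailr r"
    unfolding tailr_def by (intro Bochner_Integration.integral_nonneg) (simp add: G_nonneg)
qed

lemma tailr_tendsto: "(tailr \<longlongrightarrow> 0) at_top"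
proof -
  have "((\<lambda>r. \<integral>s. G s * indicator {s. r \<le> \<bar>s\<bar>} s \<partial>lborel) \<longlongrightarrow> integral\<^sup>L (lborel :: real measure) (\<lambda>s. 0)) at_top"
  proof (rule integral_dominated_convergence_at_top[OF _ _ G_integrable])
    show "(\<lambda>s. G s * indicator {s. r \<le> \<bar>s\<bar>} s) \<in> borel_measurable lborel" for r by measurable
    show "\<forall>\<^sub>F r in at_top. AE s in lborel. norm (G s * indicator {s. r \<le> \<bar>s\<bar>} s) \<le> G s"
      using G_nonneg by (auto simp: indicator_def)
    show "AE s in lborel. ((\<lambda>r. G s * indicator {s. r \<le> \<bar>s\<bar>} s) \<longlongrightarrow> 0) at_top"
    proof (intro AE_I2 tendsto_eventually)
      fix s :: real
      show "\<forall>\<^sub>F r in at_top. G s * indicator {s. r \<le> \<bar>s\<bar>} s = 0"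
        using eventually_gt_at_top[of "\<bar>s\<bar>"] by eventually_elim (simp add: indicator_def)
    qed
  qed simp
  then show ?thesis by (simp add: tailr_def[abs_def])
qed

text \<open>Integers on one side and reals on the other let this single inequality yield both
  reductions: x = 0 gives the passage to integers, general x the shift invariance. Each real R is
  compared with an integer slightly above \<open>R + K\<close>.\<close>

lemma liminf_cell_energy_shift:
  assumes \<omega>: "\<omega> \<in> space M"
  shows "Liminf sequentially (\<lambda>n. ennreal (real n powr - real CARD('m)) * cell_energy \<omega> (real n))
    \<le> Liminf at_top (\<lambda>R. ennreal (R powr - real CARD('m)) * cell_energy (\<tau> x \<omega>) R)"
proof -
  let ?m = "CARD('m)"
  obtain c where c: "0 < c" "\<And>s t. \<bar>smooth_step s - smooth_step t\<bar> \<le> c * \<bar>s - t\<bar>"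
    using smooth_step_Lipschitz by blast
  \<comment> \<open>\<open>2 * D * \<kappa>\<close> bounds the slope of the cutoff. The summand 1 in
    B avoids division by zero when x.e = 0, and the 4 in \<open>\<kappa>\<close> brings the product
    with |x.e| down to 1/2.\<close>
  define D B where "D = (real ?m + 1) * c" and "B = \<bar>x \<bullet> e\<bar> + 1"
  have DB: "0 < D" "0 < B" "\<bar>x \<bullet> e\<bar> \<le> B" using c by (auto simp: D_def B_def)
  define \<kappa> where "\<kappa> = 1 / (4 * D * B)"
  have \<kappa>: "0 < \<kappa>" using DB by (simp add: \<kappa>_def)
  have small: "\<bar>x \<bullet> e\<bar> * (2 * (real ?m + 1) * c * \<kappa>) \<le> 1/2"
  proof -
    have "2 * (real ?m + 1) * c * \<kappa> = 2 * D * \<kappa>" by (simp add: D_def)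
    also have "\<dots> = 1 / (2 * B)" using DB by (simp add: \<kappa>_def field_simps)
    finally have eq: "2 * (real ?m + 1) * c * \<kappa> = 1 / (2 * B)" .
    show ?thesis unfolding eq using DB(2,3) by (simp add: divide_simps)
  qed
  define K where "K = 2 * norm x + 2 / \<kappa> + 1"
  have K: "0 < K" using \<kappa> by (simp add: K_def add_nonneg_pos)
  \<comment> \<open>Rounding up stays within 1 of \<open>R + K\<close>, so the ratio to R tends to 1
    and the annulus is negligible.\<close>
  define n where "n R = nat \<lceil>R + K\<rceil>" for R
  have n: "R + K \<le> real (n R)" "real (n R) \<le> R + K + 1" if "0 < R" for R
    using that K unfolding n_def by linarith+
  \<comment> \<open>This is the error after division by \<open>R ^ CARD('m)\<close>, with the
    integer replaced by its upper bound \<open>R + K + 1\<close>.\<close>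
  define \<delta> where "\<delta> R = 3 * (V\<^sub>1 * (((R + K + 1) / R) ^ ?m - 1) * (2 * tailr 0)
      + V\<^sub>1 * ((R + K + 1) / R) ^ ?m * (2 * tailr (R - 2 * norm x)))" for R
  have \<delta>: "(\<delta> \<longlongrightarrow> 0) at_top"
  proof -
    have "((\<lambda>R. 1 + (K + 1) / R) \<longlongrightarrow> 1 + 0) at_top"
      by (intro tendsto_intros tendsto_divide_0[OF tendsto_const] filterlim_at_top_imp_at_infinity filterlim_ident)
    moreover have "\<forall>\<^sub>F R in at_top. 1 + (K + 1) / R = (R + K + 1) / R"
      using eventually_gt_at_top[of 0] by eventually_elim (simp add: field_simps)
    ultimately have q: "((\<lambda>R. (R + K + 1) / R) \<longlongrightarrow> 1) at_top"
      by (simp add: tendsto_cong)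
    have "filterlim (\<lambda>R. R - 2 * norm x) at_top at_top"
      using filterlim_tendsto_add_at_top[OF tendsto_const filterlim_ident, of "- (2 * norm x)"] by simp
    then have t: "((\<lambda>R. tailr (R - 2 * norm x)) \<longlongrightarrow> 0) at_top"
      by (rule filterlim_compose[OF tailr_tendsto])
    have "(\<delta> \<longlongrightarrow> 3 * (V\<^sub>1 * (1 ^ ?m - 1) * (2 * tailr 0) + V\<^sub>1 * 1 ^ ?m * (2 * 0))) at_top"
      unfolding \<delta>_def by (intro tendsto_intros q t)
    then show ?thesis by simp
  qed
  have key: "ennreal (real (n R) powr - real ?m) * cell_energy \<omega> (real (n R))
      \<le> ennreal (R powr - real ?m) * cell_energy (\<tau> x \<omega>) R + ennreal (\<delta> R)" if R: "0 < R" for R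
  proof -
    let ?N = "real (n R)"
    have N: "0 < ?N" "R \<le> ?N" using n[OF R] R K by linarith+
    let ?E = "3 * (V\<^sub>1 * (?N ^ ?m - R ^ ?m) * (2 * tailr 0) + V\<^sub>1 * ?N ^ ?m * (2 * tailr (R - 2 * norm x)))"
    have pos: "0 \<le> ?N ^ ?m - R ^ ?m" using N R by (simp add: power_mono)
    have powr: "t powr - real ?m = 1 / t ^ ?m" if "0 < t" for t
      using that by (simp add: powr_minus powr_realpow divide_inverse)
    have "cell_energy \<omega> ?N \<le> cell_energy (\<tau> x \<omega>) R
      + 3 * (ennreal (V\<^sub>1 * (?N ^ ?m - R ^ ?m)) * (2 * tail 0) + ennreal (V\<^sub>1 * ?N ^ ?m) * (2 * tail (R - 2 * norm x)))"
      by (rule cell_energy_shift_le[OF \<kappa> c small R _ \<omega>]) (use n(1)[OF R] in \<open>simp add: K_def\<close>)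
    also have "3 * (ennreal (V\<^sub>1 * (?N ^ ?m - R ^ ?m)) * (2 * tail 0) + ennreal (V\<^sub>1 * ?N ^ ?m) * (2 * tail (R - 2 * norm x))) = ennreal ?E"
    proof -
      have two: "2 * ennreal t = ennreal (2 * t)" and three: "3 * ennreal t = ennreal (3 * t)" if "0 \<le> t" for t
        using that by (simp_all add: ennreal_mult)
      have A: "0 \<le> V\<^sub>1 * (?N ^ ?m - R ^ ?m)" "0 \<le> V\<^sub>1 * ?N ^ ?m" using pos N by simp_all
      show ?thesis
        unfolding tail_eq two[OF tailr_nonneg] using A tailr_nonneg
        by (subst three[symmetric]) (auto simp: ennreal_mult ennreal_plus simp del: ennreal_plus[symmetric])
    qed
    \<comment> \<open>Because the integer is at least R, its normalising factor is the smaller one,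
      and that of R may be used on the right.\<close>
    finally have "ennreal (?N powr - real ?m) * cell_energy \<omega> ?N \<le> ennreal (R powr - real ?m) * (cell_energy (\<tau> x \<omega>) R + ennreal ?E)"
      using N R by (intro mult_mono ennreal_leI) (auto simp: powr frac_le power_mono)
    also have "\<dots> = ennreal (R powr - real ?m) * cell_energy (\<tau> x \<omega>) R + ennreal (R powr - real ?m * ?E)"
      by (subst ennreal_mult'[where b = ?E]) (simp, rule distrib_left)
    also have "\<dots> \<le> ennreal (R powr - real ?m) * cell_energy (\<tau> x \<omega>) R + ennreal (\<delta> R)"
    proof (intro add_left_mono ennreal_leI)
      have le: "?N ^ ?m / R ^ ?m \<le> ((R + K + 1) / R) ^ ?m"
        using n(2)[OF R] N R by (simp add: power_divide divide_right_mono power_mono)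
      have "R powr - real ?m * ?E = 3 * (V\<^sub>1 * (?N ^ ?m / R ^ ?m - 1) * (2 * tailr 0) + V\<^sub>1 * (?N ^ ?m / R ^ ?m) * (2 * tailr (R - 2 * norm x)))"
        using R by (simp add: powr divide_simps)
      also have "\<dots> \<le> \<delta> R"
        unfolding \<delta>_def using le tailr_nonneg
        by (intro mult_left_mono add_mono mult_right_mono) auto
      finally show "R powr - real ?m * ?E \<le> \<delta> R" .
    qed
    finally show ?thesis .
  qed
  show ?thesis
    unfolding le_Liminf_iff
  proof (intro allI impI)
    fix y assume "y < Liminf sequentially (\<lambda>n. ennreal (real n powr - real ?m) * cell_energy \<omega> (real n))"
    \<comment> \<open>The gap between y and z absorbs \<open>\<delta> R\<close>, which is eventually
      smaller.\<close>
    then obtain z where z: "y < z" "z < Liminf sequentially (\<lambda>n. ennreal (real n powr - real ?m) * cell_energy \<omega> (real n))"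
      using dense by blast
    have nlim: "filterlim n sequentially at_top"
    proof -
      have "filterlim (\<lambda>R. real (n R)) at_top at_top"
      proof (rule filterlim_at_top_mono[OF filterlim_ident])
        show "\<forall>\<^sub>F R in at_top. R \<le> real (n R)"
          using eventually_gt_at_top[of 0] by eventually_elim (use n(1) K in fastforce)
      qed
      then show ?thesis by (simp add: filterlim_sequentially_iff_filterlim_real)
    qed
    have 1: "\<forall>\<^sub>F R in at_top. z < ennreal (real (n R) powr - real ?m) * cell_energy \<omega> (real (n R))"
      using eventually_compose_filterlim[OF less_LiminfD[OF z(2)] nlim] .
    have "((\<lambda>R. y + ennreal (\<delta> R)) \<longlongrightarrow> y + ennreal 0) at_top"
      by (intro tendsto_add tendsto_const tendsto_ennrealI \<delta>)
    then have 2: "\<forall>\<^sub>F R in at_top. y + ennreal (\<delta> R) < z"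
      using z(1) by (intro order_tendstoD) auto
    show "\<forall>\<^sub>F R in at_top. y < ennreal (R powr - real ?m) * cell_energy (\<tau> x \<omega>) R"
      using 1 2 eventually_gt_at_top[of 0]
    proof eventually_elim
      case (elim R)
      show ?case
      proof (rule ccontr)
        assume "\<not> y < ennreal (R powr - real ?m) * cell_energy (\<tau> x \<omega>) R"
        then have "ennreal (R powr - real ?m) * cell_energy (\<tau> x \<omega>) R + ennreal (\<delta> R) \<le> y + ennreal (\<delta> R)"
          by (intro add_right_mono) (simp add: not_less)
        from less_le_trans[OF elim(1) order_trans[OF key[OF elim(3)] this]] elim(2) show False
          by (rule order.asym)
      qed
    qed
  qed
qed

definition surface_tension :: "'w \<Rightarrow> ennreal" where
  "surface_tension \<omega> = Liminf at_top (\<lambda>R. ennreal (R powr - real CARD('m)) * cell_energy \<omega> R)"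

text \<open>The shift inequality at x = 0 compares the same medium at real and integer sizes; the
  converse holds for every function, by restriction to a sequence. Countably many sizes are what
  measurability requires.\<close>

lemma surface_tension_eq_liminf_nat:
  assumes "\<omega> \<in> space M"
  shows "surface_tension \<omega> = Liminf sequentially (\<lambda>n. ennreal (real n powr - real CARD('m)) * cell_energy \<omega> (real n))"
  using liminf_cell_energy_shift[OF assms, of 0] Liminf_at_top_le_sequentially
  unfolding surface_tension_def tau_zero[OF assms] by (intro antisym)

lemma surface_tension_shift:
  assumes "\<omega> \<in> space M" shows "surface_tension (\<tau> x \<omega>) = surface_tension \<omega>"
proof (rule antisym)
  have le: "surface_tension \<omega> \<le> surface_tension (\<tau> x \<omega>)" if "\<omega> \<in> space M" for \<omega> x
    using liminf_cell_energy_shift[OF that, of x] unfolding surface_tension_eq_liminf_nat[OF that]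
    by (simp add: surface_tension_def)
  have "\<tau> (- x) (\<tau> x \<omega>) = \<omega>" using tau_add[OF assms, of "- x" x] tau_zero[OF assms] by simp
  then show "surface_tension (\<tau> x \<omega>) \<le> surface_tension \<omega>"
    using le[OF tau_space[OF assms], of x "- x"] by simp
  show "surface_tension \<omega> \<le> surface_tension (\<tau> x \<omega>)" by (rule le[OF assms])
qed

lemma surface_tension_measurable: "surface_tension \<in> borel_measurable M"
proof -
  have "(\<lambda>\<omega>. Liminf sequentially (\<lambda>n. ennreal (real n powr - real CARD('m)) * cell_energy \<omega> (real n))) \<in> borel_measurable M"
    using cell_energy_measurable by (intro borel_measurable_liminf borel_measurable_times_ennreal) auto
  then show ?thesis
    by (subst measurable_cong[OF surface_tension_eq_liminf_nat])
qed

text \<open>Invariance holds at every point of the space, so a preimage is itself an invariant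
  event, not merely up to a null set.\<close>

lemma surface_tension_invariant_measurable:
  "surface_tension \<in> borel_measurable (sigma (space M) (invariant_events M \<tau>))"
proof (rule measurableI)
  have inv: "invariant_events M \<tau> \<subseteq> Pow (space M)"
    by (auto simp: invariant_events_def dest: sets.sets_into_space)
  fix A :: "ennreal set" assume A: "A \<in> sets borel"
  let ?E = "surface_tension -` A \<inter> space M"
  have "?E \<in> sets M" by (rule measurable_sets[OF surface_tension_measurable A])
  moreover have "\<tau> x -` ?E \<inter> space M = ?E" for x
    using surface_tension_shift tau_space by auto
  ultimately have "?E \<in> invariant_events M \<tau>" by (simp add: invariant_events_def)
  then show "surface_tension -` A \<inter> space (sigma (space M) (invariant_events M \<tau>)) \<in> sets (sigma (space M) (invariant_events M \<tau>))"
    using inv by (simp add: space_measure_of_conv sets_measure_of sigma_sets.Basic)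
qed simp

end

theorem theorem4p2:
  fixes lam Lam :: real
    and M :: "'w measure"
    and \<Phi> :: "'w \<Rightarrow> real^'n \<Rightarrow> real"
    and \<tau> :: "real^'n \<Rightarrow> 'w \<Rightarrow> 'w"
    and W :: "real \<Rightarrow> real"
    and q :: "real \<Rightarrow> real"
    and Oe :: "real^'n \<Rightarrow> real^'m \<Rightarrow> real^'n"
    and bs :: "'m \<Rightarrow> real^'m"
    and e :: "real^'n"
  assumes dim: "CARD('n) = CARD('m) + 1"
    and lam: "0 < lam" and Lam: "0 < Lam"
    and P: "prob_space M"
    and Phi_meas: "\<Phi> \<in> measurable M (Fd_borel lam Lam)"
    and tau_meas: "(\<lambda>(x, \<omega>). \<tau> x \<omega>) \<in> measurable (borel \<Otimes>\<^sub>M M) M"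
    and tau_zero: "\<forall>\<omega>\<in>space M. \<tau> 0 \<omega> = \<omega>"
    and tau_add: "\<forall>x y. \<forall>\<omega>\<in>space M. \<tau> (x + y) \<omega> = \<tau> x (\<tau> y \<omega>)"
    and tau_pres: "\<forall>x. \<tau> x \<in> measurable M M \<and> distr M M (\<tau> x) = M"
    and ergodic: "\<forall>E\<in>invariant_events M \<tau>. prob_space.prob M E = 0 \<or> prob_space.prob M E = 1"
    and W_cont: "continuous_on {-1..1} W"
    and W_nonneg: "\<forall>s\<in>{-1..1}. 0 \<le> W s"
    and W_zero: "{s\<in>{-1..1}. W s = 0} = {-1, 1}"
    and q_range: "\<forall>s. -1 \<le> q s \<and> q s \<le> 1"
    and q_smooth: "\<forall>k s. ((deriv ^^ k) q) differentiable (at s)"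
    and q_lim_top: "(q \<longlongrightarrow> 1) at_top"
    and q_lim_bot: "(q \<longlongrightarrow> -1) at_bot"
    and q_energy: "(\<integral>\<^sup>+ s. ennreal (Lam / 2 * (deriv q s)\<^sup>2 + W (q s)) \<partial>lborel) < \<infinity>"
    and O_lin: "\<forall>e'\<in>sphere 0 1. linear (Oe e')"
    and O_iso: "\<forall>e'\<in>sphere 0 1. \<forall>a. norm (Oe e' a) = norm a"
    and O_onto: "\<forall>e'\<in>sphere 0 1. range (Oe e') = {x. x \<bullet> e' = 0}"
    and bs_orth: "\<forall>i j. bs i \<bullet> bs j = (if i = j then 1 else 0)"
    and e_sphere: "e \<in> sphere 0 1"
  shows "(\<lambda>\<omega>. phi_tilde \<Phi> \<tau> W q Oe bs \<omega> e)
           \<in> borel_measurable (sigma (space M) (invariant_events M \<tau>))"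
proof -
  interpret planar_cell lam Lam M \<Phi> \<tau> W "Oe e" e bs q
  proof (intro planar_cell.intro random_medium.intro frame.intro planar_cell_axioms.intro)
    show "smooth1 q" unfolding smooth1_def by (rule q_smooth)
    show "range (Oe e) = {x. x \<bullet> e = 0}" "linear (Oe e)" "norm (Oe e a) = norm a" for a
      using O_onto O_lin O_iso e_sphere by blast+
  qed (fact | use assms in auto)+
  \<comment> \<open>With height equal to the side length of the cube, the set built by
    \<open>oplus\<close> is exactly \<open>cyl R\<close>, so both infima range over the same
    competitors.\<close>
  have "cell \<Phi> \<tau> W q Oe \<omega> e (cube bs 0 R) R = cell_energy \<omega> R" for \<omega> R
    unfolding cell_def Let_def oplus_def cell_energy_def admissible_def cyl_eq ..
  moreover have "1 - real CARD('n) = - real CARD('m)" using dim by simp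
  ultimately have "(\<lambda>\<omega>. phi_tilde \<Phi> \<tau> W q Oe bs \<omega> e) = surface_tension"
    by (simp add: phi_tilde_def surface_tension_def fun_eq_iff)
  then show ?thesis using surface_tension_invariant_measurable by simp
qed

end
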